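(* Up to combinatorial equivalence (isomorphism of face lattices), there are exactly five strongly self-dual polyhedra in $\mathbb{R}^3$ with at most eight vertices. Four of them are combinatorial types of polyhedra produced by Lovász's construction ($L$-type ssd-polyhedra), namely the regular tetrahedron (4 vertices), the pyramid over a pentagon (6 vertices), the polyhedron with 7 vertices having 3 quadrangular and 4 triangular faces, and the pyramid over a heptagon (8 vertices); the fifth has 8 vertices, with one pentagonal, two quadrangular and five triangular faces, and is realized by a strongly self-dual polyhedron not obtained by Lovász's construction.
   Context: A convex polytope $P\subset\mathbb{R}^3$ is strongly self-dual (ssd) if: its vertices lie on the unit sphere $S^2$ centred at the origin $O$; it is circumscribed about the sphere of centre $O$ and radius $r$ with $0<r<1$ (this sphere touches every face); and there is a bijection $\sigma$ from the vertices to the faces of $P$ such that $\sigma(v)$ is orthogonal to $v$ for every vertex $v$. Lovász's construction in $\mathbb{R}^3$: in a plane take the unit circle $C$ centred at $O$ and an ellipse $E$ centred at $O$ with axes $2$ and $2r_0$ ($0<r_0<1$) touching $C$ at the ends $x,y$ of its major axis; choose $0<t<r_0$ so that an odd polygon $(x_0=x,x_1,\ldots,x_{2k+1}=x)$ is inscribed in $E$ with sides tangent to the circle of radius $t$ about $O$; let $\alpha$ be the orthogonal affine map taking $E$ to $C$ and $y_i=\alpha(x_i)$; regarding $C$ as a meridian of $S^2$ with north pole $x$, take a regular odd $l$-gon $P_0$ inscribed in the equator, the half-meridians $M_v$ through its vertices $v$ and the parallels $L_i$ through $y_i$ ($i=1,\ldots,k$), and let $u(v,i)=M_v\cap L_i$,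 $u(v,0)=x$; the resulting polyhedron $\mathrm{conv}\{u(v,i)\}$ is an $L$-type ssd-polyhedron. *)

theory Defs
  imports "HOL-Analysis.Analysis" "HOL-Library.Multiset"
begin

definition vertices :: "'a::real_vector set \<Rightarrow> 'a set" where
  "vertices P = {v. v extreme_point_of P}"

definition facets :: "'a::euclidean_space set \<Rightarrow> 'a set set" where
  "facets P = {F. F facet_of P}"

definition combinatorially_equivalent ::
    "'a::real_vector set \<Rightarrow> 'b::real_vector set \<Rightarrow> bool" where
  "combinatorially_equivalent P Q \<longleftrightarrow>
     (\<exists>f. bij_betw f {F. F face_of P} {G. G face_of Q} \<and>
          (\<forall>F F'. F face_of P \<longrightarrow> F' face_of P \<longrightarrow> (F \<subseteq> F' \<longleftrightarrow> f F \<subseteq> f F')))"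

(* The inclusion of the ball makes a common point of a facet and the sphere a point of
   tangency; it also forces the polytope to be 3-dimensional. *)
definition strongly_self_dual :: "(real^3) set \<Rightarrow> bool" where
  "strongly_self_dual P \<longleftrightarrow>
     polytope P \<and>
     vertices P \<subseteq> sphere 0 1 \<and>
     (\<exists>r. 0 < r \<and> r < 1 \<and> cball 0 r \<subseteq> P \<and> (\<forall>F\<in>facets P. F \<inter> sphere 0 r \<noteq> {})) \<and>
     (\<exists>\<sigma>. bij_betw \<sigma> (vertices P) (facets P) \<and>
          (\<forall>v\<in>vertices P. \<forall>p\<in>\<sigma> v. \<forall>q\<in>\<sigma> v. orthogonal v (p - q)))"

(* The number of vertices of each facet. *)
definition facet_sizes :: "'a::euclidean_space set \<Rightarrow> nat multiset" where
  "facet_sizes P = image_mset (\<lambda>F. card (vertices F)) (mset_set (facets P))"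

definition regular_tetrahedron :: "(real^3) set \<Rightarrow> bool" where
  "regular_tetrahedron P \<longleftrightarrow>
     (\<exists>S d. card S = 4 \<and> 0 < d \<and> pairwise (\<lambda>p q. dist p q = d) S \<and> P = convex hull S)"

definition pyramid_over_gon :: "nat \<Rightarrow> (real^3) set \<Rightarrow> bool" where
  "pyramid_over_gon n P \<longleftrightarrow>
     (\<exists>B apex. polytope B \<and> aff_dim B = 2 \<and> card (vertices B) = n \<and>
               apex \<notin> affine hull B \<and> P = convex hull (insert apex B))"

(* The plane of the circle C is the complex plane, C is the unit circle, and the point x at
   which the ellipse E touches C is 1. *)
definition ellipse :: "real \<Rightarrow> complex set" where
  "ellipse r0 = {z. (Re z)\<^sup>2 + (Im z / r0)\<^sup>2 = 1}"

definition ellipse_to_circle :: "real \<Rightarrow> complex \<Rightarrow> complex" where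
  "ellipse_to_circle r0 z = Complex (Re z) (Im z / r0)"

(* A convex polygon with 2k+1 vertices, listed in cyclic order: consecutive vertices span
   edges of the hull.  A side is tangent to the circle of radius t when its line meets the
   circle in exactly one point. *)
definition inscribed_tangent_polygon :: "real \<Rightarrow> real \<Rightarrow> nat \<Rightarrow> (nat \<Rightarrow> complex) \<Rightarrow> bool" where
  "inscribed_tangent_polygon r0 t k x \<longleftrightarrow>
     x 0 = 1 \<and> x (2 * k + 1) = 1 \<and> inj_on x {..2 * k} \<and>
     (\<forall>i\<le>2 * k. x i \<in> ellipse r0 \<and>
        closed_segment (x i) (x (Suc i)) edge_of convex hull (x ` {..2 * k}) \<and>
        (\<exists>p. affine hull {x i, x (Suc i)} \<inter> sphere 0 t = {p}))"

definition half_meridian :: "real^3 \<Rightarrow> real^3 \<Rightarrow> (real^3) set" where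
  "half_meridian pole v = {cos \<phi> *\<^sub>R pole + sin \<phi> *\<^sub>R v | \<phi>. 0 \<le> \<phi> \<and> \<phi> \<le> pi}"

definition parallel_at :: "real^3 \<Rightarrow> real \<Rightarrow> (real^3) set" where
  "parallel_at pole h = {p \<in> sphere 0 1. p \<bullet> pole = h}"

(* The pole, together with an orthonormal basis e, f of the equatorial plane, may be placed
   arbitrarily.  The minor semi-axis r0 of the ellipse is the inradius cos (pi / l) of the
   regular l-gon inscribed in the equator; this is the value for which the construction
   yields a strongly self-dual polyhedron. *)
definition lovasz_polyhedron :: "(real^3) set \<Rightarrow> bool" where
  "lovasz_polyhedron P \<longleftrightarrow>
     (\<exists>l k r0 t x y pole e f V.
        odd l \<and> l \<ge> 3 \<and> k \<ge> 1 \<and>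
        r0 = cos (pi / real l) \<and> 0 < t \<and> t < r0 \<and>
        inscribed_tangent_polygon r0 t k x \<and>
        (\<forall>i. y i = ellipse_to_circle r0 (x i)) \<and>
        norm pole = 1 \<and> norm e = 1 \<and> norm f = 1 \<and>
        orthogonal pole e \<and> orthogonal pole f \<and> orthogonal e f \<and>
        V = {cos (2 * pi * real j / real l) *\<^sub>R e + sin (2 * pi * real j / real l) *\<^sub>R f | j. j < l} \<and>
        P = convex hull (insert pole
              (\<Union>v\<in>V. \<Union>i\<in>{1..k}. half_meridian pole v \<inter> parallel_at pole (Re (y i)))))"

end

theory Submission
  imports Defs
begin

text \<open>A facet of a strongly self-dual polytope \<open>P\<close> that is orthogonal to a vertex \<open>v\<close> must be
  \<open>P \<inter> {x. v \<bullet> x = - r}\<close>, so \<open>P\<close> is strongly self-dual iff it is the convex hull of a finite set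
  \<open>V\<close> of unit vectors with \<open>conv V = {x. \<forall>v\<in>V. - r \<le> v \<bullet> x}\<close>. Everything combinatorial about
  \<open>P\<close> is then encoded in the graph \<open>G\<close> on \<open>V\<close> that joins \<open>u\<close> and \<open>v\<close> iff \<open>u \<bullet> v = - r\<close>.

  Conversely, unit vectors with all inner products at least \<open>- r\<close> form such a set as soon as \<open>G\<close>
  satisfies a local condition saying that enough edges are present at each vertex: by a simplex
  argument a local maximum of a linear functional over \<open>V\<close> is then a global one over the polar set.
  This reduces the existence of the five polyhedra to prescribing their Gram matrices.

  For the classification, two distinct vertices of \<open>G\<close> have at most two common neighbours, all
  degrees are at least three, pairs with exactly two common neighbours are the edges of \<open>P\<close>, the
  edges within a neighbourhood form a cycle, and the edges form a connected graph on \<open>V\<close>. An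
  exhaustive search over adjacency matrices, started from a vertex of maximal degree and its
  cyclically ordered neighbours, leaves five graphs with at most eight vertices.

  Finally, a polytope from Lovasz's construction is invariant under a rotation of odd order
  \<open>l \<ge> 3\<close> about the pole. The unique pentagon of the fifth polyhedron would be invariant as well,
  which is incompatible with the numbers of vertices.\<close>

section \<open>Combinatorial equivalence of polytopes\<close>

text \<open>The classification never decides which graphs are realizable. The conditions drawn from
  a self-polar set are only necessary, but up to eight vertices every graph that satisfies them
  turns out to have a realization. As facets are indexed by vertices, the graph alone fixes the face
  lattice, so neither Gram matrices nor radii of two polytopes are ever compared.

  The combinatorial conditions come from linear optimization at a vertex instead of planar topology.
  The sphere enters mainly through two facts: a line meets it in at most two points, which bounds
  common neighbours and separates slopes within a facet; and the functional
  \<open>y \<bullet> _\<close> of a vertex \<open>y\<close> is larger at \<open>y\<close> than at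
  any other vertex, which gives both connectedness statements.

  The radii of the polyhedron with seven vertices and of the fifth polyhedron are roots of
  polynomials of degree four and five without a convenient closed form. The intermediate value
  theorem supplies them, and only their equations and rational bounds are used.\<close>

lemma convex_hull_Int_hyperplane:
  fixes S :: "'a::euclidean_space set"
  assumes "finite S" and le: "\<And>x. x \<in> S \<Longrightarrow> b \<le> a \<bullet> x"
  shows "convex hull S \<inter> {x. a \<bullet> x = b} = convex hull {x \<in> S. a \<bullet> x = b}"
proof
  have ge: "b \<le> a \<bullet> x" if "x \<in> convex hull S" for x
  proof -
    have "convex hull S \<subseteq> {x. a \<bullet> x \<ge> b}"
      by (rule hull_minimal) (use le convex_halfspace_ge in auto)
    then show ?thesis using that by auto
  qed
  have "(convex hull S \<inter> {x. a \<bullet> x = b}) face_of (convex hull S)"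
    by (rule face_of_Int_supporting_hyperplane_ge) (use ge in auto)
  \<comment> \<open>A face of the hull of a finite set is spanned by some of the generators, and
    these must then lie in the hyperplane.\<close>
  then obtain S' where S': "S' \<subseteq> S" "convex hull S \<inter> {x. a \<bullet> x = b} = convex hull S'"
    using face_of_convex_hull_subset[OF finite_imp_compact[OF \<open>finite S\<close>]] by blast
  then have "S' \<subseteq> {x \<in> S. a \<bullet> x = b}"
    using hull_subset[of S' convex] by blast
  then show "convex hull S \<inter> {x. a \<bullet> x = b} \<subseteq> convex hull {x \<in> S. a \<bullet> x = b}"
    using S' hull_mono by metis
  have "convex hull {x \<in> S. a \<bullet> x = b} \<subseteq> {x. a \<bullet> x = b}"
    by (rule hull_minimal) (auto simp: convex_hyperplane)
  moreover have "convex hull {x \<in> S. a \<bullet> x = b} \<subseteq> convex hull S"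
    by (rule hull_mono) auto
  ultimately show "convex hull {x \<in> S. a \<bullet> x = b} \<subseteq> convex hull S \<inter> {x. a \<bullet> x = b}"
    by blast
qed

lemma inner_eq_1_imp_eq:
  fixes x y :: "'a::real_inner"
  assumes "norm x = 1" "norm y = 1" "x \<bullet> y = 1"
  shows "x = y"
  using assms norm_cauchy_schwarz_eq[of x y] by simp

lemma inner_less_1:
  fixes x y :: "'a::real_inner"
  assumes "norm x = 1" "norm y = 1" "x \<noteq> y"
  shows "x \<bullet> y < 1"
  using assms inner_eq_1_imp_eq[of x y] norm_cauchy_schwarz[of x y] by force

text \<open>The tangent plane of the sphere at \<open>x\<close> supports the hull and contains no
  other point of \<open>S\<close>, so no generator is redundant.\<close>

lemma vertices_convex_hull_sphere:
  fixes S :: "'a::euclidean_space set"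
  assumes "finite S" "S \<subseteq> sphere 0 1"
  shows "vertices (convex hull S) = S"
proof
  show "vertices (convex hull S) \<subseteq> S"
    using extreme_point_of_convex_hull by (auto simp: vertices_def)
  show "S \<subseteq> vertices (convex hull S)"
  proof
    fix x assume x: "x \<in> S"
    have le: "-1 \<le> (-x) \<bullet> y" if "y \<in> S" for y
    proof -
      have "norm x = 1" "norm y = 1" using assms(2) x that by auto
      then show ?thesis using norm_cauchy_schwarz[of x y] by simp
    qed
    have "y = x" if "y \<in> S" "x \<bullet> y = 1" for y
    proof -
      have "norm x = 1" "norm y = 1" using assms(2) x that by auto
      then show ?thesis using inner_eq_1_imp_eq[of x y] that by simp
    qed
    moreover have "x \<bullet> x = 1" using assms(2) x by (auto simp: dot_square_norm)
    ultimately have "{y \<in> S. (-x) \<bullet> y = -1} = {x}" using x by auto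
    then have eq: "convex hull S \<inter> {y. (-x) \<bullet> y = -1} = {x}"
      using convex_hull_Int_hyperplane[OF assms(1), of "-1" "-x", OF le] by simp
    have "-1 \<le> (-x) \<bullet> y" if "y \<in> convex hull S" for y
    proof -
      have "convex hull S \<subseteq> {y. (-x) \<bullet> y \<ge> -1}"
        by (rule hull_minimal) (use le convex_halfspace_ge[of "-1" "-x"] in auto)
      then show ?thesis using that by auto
    qed
    then have "(convex hull S \<inter> {y. (-x) \<bullet> y = -1}) face_of convex hull S"
      by (intro face_of_Int_supporting_hyperplane_ge) auto
    then show "x \<in> vertices (convex hull S)"
      unfolding eq by (simp add: face_of_singleton vertices_def)
  qed
qed

lemma vertices_face:
  assumes "F face_of P" shows "vertices F = vertices P \<inter> F"
  using extreme_point_of_face[OF assms] by (auto simp: vertices_def)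

lemma polytope_eq_convex_hull_vertices:
  fixes P :: "'a::euclidean_space set"
  assumes "polytope P" shows "P = convex hull vertices P"
  unfolding vertices_def using assms
  by (intro Krein_Milman_Minkowski polytope_imp_compact polytope_imp_convex)

lemma finite_vertices: "polytope P \<Longrightarrow> finite (vertices (P :: 'a::euclidean_space set))"
  unfolding vertices_def using finite_polyhedron_extreme_points polytope_imp_polyhedron by blast

lemma vertices_mono_faces:
  fixes P :: "'a::euclidean_space set"
  assumes "polytope P" "F face_of P" "G face_of P"
  shows "F \<subseteq> G \<longleftrightarrow> vertices F \<subseteq> vertices G"
proof -
  have "F = convex hull vertices F" "G = convex hull vertices G"
    using assms face_of_polytope_polytope polytope_eq_convex_hull_vertices by blast+
  then show ?thesis
    using hull_mono[of "vertices F" "vertices G" convex] vertices_face[OF assms(2)] vertices_face[OF assms(3)]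
    by auto
qed

text \<open>Vertices as atoms and, in the next lemma, facets as coatoms of the face order:
  descriptions by inclusion alone, which every isomorphism of face lattices preserves.\<close>

lemma vertex_iff_minimal_face:
  fixes P :: "'a::euclidean_space set"
  assumes "polytope P"
  shows "(\<exists>v\<in>vertices P. F = {v}) \<longleftrightarrow>
    F face_of P \<and> F \<noteq> {} \<and> (\<forall>G. G face_of P \<longrightarrow> G \<subseteq> F \<longrightarrow> G = {} \<or> G = F)"
proof (intro iffI; elim bexE conjE)
  fix v assume "v \<in> vertices P" "F = {v}"
  then show "F face_of P \<and> F \<noteq> {} \<and> (\<forall>G. G face_of P \<longrightarrow> G \<subseteq> F \<longrightarrow> G = {} \<or> G = F)"
    by (auto simp: vertices_def face_of_singleton)
next
  assume F: "F face_of P" "F \<noteq> {}" "\<forall>G. G face_of P \<longrightarrow> G \<subseteq> F \<longrightarrow> G = {} \<or> G = F"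
  then have "polytope F" using assms face_of_polytope_polytope by blast
  then obtain v where v: "v extreme_point_of F"
    using extreme_point_exists_convex F(2) polytope_imp_compact polytope_imp_convex by blast
  then have "{v} face_of P" using face_of_trans F(1) face_of_singleton by blast
  moreover have "{v} \<subseteq> F" using v by (auto simp: extreme_point_of_def)
  ultimately have "v \<in> vertices P \<and> F = {v}"
    using F(3) unfolding vertices_def face_of_singleton[symmetric] by blast
  then show "\<exists>v\<in>vertices P. F = {v}" by blast
qed

lemma facet_iff_maximal_face:
  fixes P :: "'a::euclidean_space set"
  assumes "polytope P"
  shows "F \<in> facets P \<longleftrightarrow>
    F face_of P \<and> F \<noteq> {} \<and> F \<noteq> P \<and> (\<forall>G. G face_of P \<longrightarrow> F \<subseteq> G \<longrightarrow> G = F \<or> G = P)"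
proof (intro iffI; (elim conjE)?)
  assume "F \<in> facets P"
  then have F: "F facet_of P" by (simp add: facets_def)
  have "G = F \<or> G = P" if G: "G face_of P" "F \<subseteq> G" for G
  proof (rule ccontr)
    assume *: "\<not> (G = F \<or> G = P)"
    have "G \<noteq> {}" using F G by (auto simp: facet_of_def)
    then obtain F' where F': "F' facet_of P" "G \<subseteq> F'"
      using face_of_polyhedron_subset_facet[OF polytope_imp_polyhedron[OF assms] G(1)] * by blast
    have "aff_dim F < aff_dim G"
      using F G * face_of_aff_dim_lt[of G F] face_of_subset[OF facet_of_imp_face_of[OF F] G(2)]
        face_of_imp_convex face_of_imp_subset by blast
    then have "aff_dim F < aff_dim F'" using F' aff_dim_subset by (meson order_less_le_trans)
    then show False using F F' by (auto simp: facet_of_def)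
  qed
  moreover have "F \<noteq> P" using F by auto
  ultimately show "F face_of P \<and> F \<noteq> {} \<and> F \<noteq> P \<and> (\<forall>G. G face_of P \<longrightarrow> F \<subseteq> G \<longrightarrow> G = F \<or> G = P)"
    using F by (auto simp: facet_of_def)
next
  assume F: "F face_of P" "F \<noteq> {}" "F \<noteq> P" "\<forall>G. G face_of P \<longrightarrow> F \<subseteq> G \<longrightarrow> G = F \<or> G = P"
  then obtain F' where F': "F' facet_of P" "F \<subseteq> F'"
    using face_of_polyhedron_subset_facet[OF polytope_imp_polyhedron[OF assms]] by blast
  then have "F' = F" using F(4) facet_of_imp_face_of by fastforce
  then show "F \<in> facets P" using F' by (simp add: facets_def)
qed

text \<open>The number of vertices of a face is the number of atoms below it. The two invariants
  separate the five types and also exclude an equivalence of the fifth one with a polyhedron of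
  Lovasz.\<close>

lemma combinatorially_equivalent_imp_facet_sizes_eq:
  fixes P :: "'a::euclidean_space set" and Q :: "'b::euclidean_space set"
  assumes P: "polytope P" and Q: "polytope Q" and "combinatorially_equivalent P Q"
  shows "card (vertices P) = card (vertices Q)" and "facet_sizes P = facet_sizes Q"
proof -
  from assms(3) obtain f where bij: "bij_betw f {F. F face_of P} {G. G face_of Q}"
    and mono: "\<And>F F'. F face_of P \<Longrightarrow> F' face_of P \<Longrightarrow> F \<subseteq> F' \<longleftrightarrow> f F \<subseteq> f F'"
    unfolding combinatorially_equivalent_def by blast
  have face: "f F face_of Q" if "F face_of P" for F
    using bij that by (auto simp: bij_betw_def)
  have surj: "\<exists>F. F face_of P \<and> f F = G" if "G face_of Q" for G
  proof -
    have "G \<in> f ` {F. F face_of P}" using bij_betw_imp_surj_on[OF bij] that by simp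
    then show ?thesis by auto
  qed
  have eq: "f F = f F' \<longleftrightarrow> F = F'" if "F face_of P" "F' face_of P" for F F'
    using mono[of F F'] mono[of F' F] that by blast
  have f_empty: "f {} = {}"
  proof -
    obtain F where "F face_of P" "f F = {}" using surj[of "{}"] by auto
    then show ?thesis using mono[of "{}" F] by auto
  qed
  have f_P: "f P = Q"
  proof -
    have PP: "P face_of P" "Q face_of Q" using P Q by (auto simp: face_of_refl_eq polytope_imp_convex)
    then obtain F where F: "F face_of P" "f F = Q" using surj by blast
    then have "f F \<subseteq> f P" using mono[of F P] PP face_of_imp_subset by blast
    then show ?thesis using F face[OF PP(1)] face_of_imp_subset by blast
  qed
  let ?A = "\<lambda>P. (\<lambda>v. {v}) ` vertices P"
  have atom: "f F \<in> ?A Q \<longleftrightarrow> F \<in> ?A P" if F: "F face_of P" for F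
  proof -
    have "(\<forall>G. G face_of Q \<longrightarrow> G \<subseteq> f F \<longrightarrow> G = {} \<or> G = f F) \<longleftrightarrow>
        (\<forall>G. G face_of P \<longrightarrow> f G \<subseteq> f F \<longrightarrow> f G = {} \<or> f G = f F)"
      using surj face by blast
    also have "\<dots> \<longleftrightarrow> (\<forall>G. G face_of P \<longrightarrow> G \<subseteq> F \<longrightarrow> G = {} \<or> G = F)"
    proof -
      have "f G \<subseteq> f F \<longleftrightarrow> G \<subseteq> F" "f G = {} \<longleftrightarrow> G = {}" "f G = f F \<longleftrightarrow> G = F" if "G face_of P" for G
        using mono[OF that F] eq[OF that F] eq[OF that, of "{}"] f_empty by auto
      then show ?thesis by auto
    qed
    finally show ?thesis
      using vertex_iff_minimal_face[OF P, of F] vertex_iff_minimal_face[OF Q, of "f F"] F face[OF F]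
        eq[OF F, of "{}"] f_empty by (auto simp: image_iff)
  qed
  have facet: "f F \<in> facets Q \<longleftrightarrow> F \<in> facets P" if F: "F face_of P" for F
  proof -
    have PP: "P face_of P" using P by (auto simp: face_of_refl_eq polytope_imp_convex)
    have "(\<forall>G. G face_of Q \<longrightarrow> f F \<subseteq> G \<longrightarrow> G = f F \<or> G = Q) \<longleftrightarrow>
        (\<forall>G. G face_of P \<longrightarrow> f F \<subseteq> f G \<longrightarrow> f G = f F \<or> f G = Q)"
      using surj face by blast
    also have "\<dots> \<longleftrightarrow> (\<forall>G. G face_of P \<longrightarrow> F \<subseteq> G \<longrightarrow> G = F \<or> G = P)"
    proof -
      have "f F \<subseteq> f G \<longleftrightarrow> F \<subseteq> G" "f G = Q \<longleftrightarrow> G = P" "f G = f F \<longleftrightarrow> G = F" if "G face_of P" for G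
        using mono[OF F that] eq[OF that F] eq[OF that PP] f_P by auto
      then show ?thesis by auto
    qed
    finally show ?thesis
      using facet_iff_maximal_face[OF P, of F] facet_iff_maximal_face[OF Q, of "f F"] F face[OF F]
        eq[OF F, of "{}"] eq[OF F PP] f_empty f_P by auto
  qed
  have sizes: "card (vertices (f F)) = card (vertices F)" if F: "F face_of P" for F
  proof -
    have below: "{A \<in> ?A R. A \<subseteq> F} = (\<lambda>v. {v}) ` vertices F" if "F face_of R" for F and R :: "'c::euclidean_space set"
      using vertices_face[OF that] by auto
    have "f ` {A \<in> ?A P. A \<subseteq> F} = {B \<in> ?A Q. B \<subseteq> f F}"
    proof (intro equalityI subsetI)
      fix B assume "B \<in> f ` {A \<in> ?A P. A \<subseteq> F}"
      then obtain A where A: "A \<in> ?A P" "A \<subseteq> F" "B = f A" by blast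
      then have "A face_of P" by (auto simp: vertices_def face_of_singleton)
      then show "B \<in> {B \<in> ?A Q. B \<subseteq> f F}" using A atom[of A] mono[of A F] F by simp
    next
      fix B assume "B \<in> {B \<in> ?A Q. B \<subseteq> f F}"
      then have B: "B \<in> ?A Q" "B \<subseteq> f F" by auto
      then have "B face_of Q" by (auto simp: vertices_def face_of_singleton)
      then obtain A where A: "A face_of P" "f A = B" using surj by blast
      then have "A \<in> {A \<in> ?A P. A \<subseteq> F}" using B atom[of A] mono[of A F] F by simp
      then show "B \<in> f ` {A \<in> ?A P. A \<subseteq> F}" using A by auto
    qed
    moreover have "inj_on f {A \<in> ?A P. A \<subseteq> F}"
    proof (rule inj_onI)
      fix A B assume "A \<in> {A \<in> ?A P. A \<subseteq> F}" "B \<in> {A \<in> ?A P. A \<subseteq> F}" "f A = f B"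
      moreover from this have "A face_of P" "B face_of P"
        by (auto simp: vertices_def face_of_singleton)
      ultimately show "A = B" using eq[of A B] by simp
    qed
    ultimately have "card {A \<in> ?A P. A \<subseteq> F} = card {B \<in> ?A Q. B \<subseteq> f F}"
      using card_image by fastforce
    then show ?thesis using below[OF F] below[OF face[OF F]] by (simp add: card_image)
  qed
  show "card (vertices P) = card (vertices Q)"
    using sizes[of P] f_P P by (simp add: face_of_refl_eq polytope_imp_convex)
  have "f ` facets P = facets Q"
  proof (intro equalityI subsetI)
    fix G assume "G \<in> f ` facets P"
    then show "G \<in> facets Q" using facet by (auto simp: facets_def facet_of_imp_face_of)
  next
    fix G assume G: "G \<in> facets Q"
    then obtain F where F: "F face_of P" "f F = G"
      using surj[of G] by (auto simp: facets_def dest: facet_of_imp_face_of)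
    then have "F \<in> facets P" using facet[of F] G by simp
    then show "G \<in> f ` facets P" using F by auto
  qed
  moreover have "inj_on f (facets P)"
    using eq by (intro inj_onI) (simp add: facets_def facet_of_imp_face_of)
  ultimately have "mset_set (facets Q) = image_mset f (mset_set (facets P))"
    by (simp add: image_mset_mset_set)
  then have "facet_sizes Q = image_mset (\<lambda>F. card (vertices (f F))) (mset_set (facets P))"
    by (simp add: facet_sizes_def image_mset.compositionality comp_def)
  also have "\<dots> = facet_sizes P"
    unfolding facet_sizes_def
  proof (rule image_mset_cong)
    fix F assume "F \<in># mset_set (facets P)"
    then have "F face_of P"
      using finite_polytope_facets[OF P] by (auto simp: facets_def facet_of_imp_face_of)
    then show "card (vertices (f F)) = card (vertices F)" by (rule sizes)
  qed
  finally show "facet_sizes P = facet_sizes Q" ..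
qed

text \<open>A proper nonempty face is the intersection of the facets containing it, so the
  incidences determine its vertex set. \<open>missP\<close> covers the empty face: the intersection
  of all facets then contains no vertex and is empty.\<close>

lemma incidence_face:
  fixes P :: "'a::euclidean_space set" and Q :: "'b::euclidean_space set"
  assumes P: "polytope P" and Q: "polytope Q"
    and g: "bij_betw g (vertices P) (vertices Q)"
    and h: "bij_betw h (facets P) (facets Q)"
    and inc: "\<And>v F. v \<in> vertices P \<Longrightarrow> F \<in> facets P \<Longrightarrow> v \<in> F \<longleftrightarrow> g v \<in> h F"
    and missP: "\<And>v. v \<in> vertices P \<Longrightarrow> \<exists>F\<in>facets P. v \<notin> F"
    and F: "F face_of P"
  shows "\<exists>G. G face_of Q \<and> vertices G = g ` vertices F"
proof -
  define \<G> where "\<G> = {G \<in> facets P. F \<subseteq> G}"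
  have face: "\<Inter>(insert P \<G>) face_of P"
    by (rule face_of_Inter)
      (use P in \<open>auto simp: \<G>_def facets_def facet_of_imp_face_of face_of_refl_eq polytope_imp_convex\<close>)
  have "vertices F = {v \<in> vertices P. \<forall>G\<in>\<G>. v \<in> G}"
  proof -
    \<comment> \<open>Inserting \<open>P\<close> covers the face \<open>P\<close> itself, for which
      the family of facets is empty.\<close>
    have "F = \<Inter>(insert P \<G>)"
    proof -
      consider "F = {}" | "F = P" | "F \<noteq> {}" "F \<noteq> P" by blast
      then show ?thesis
      proof cases
        case 1
        have "vertices (\<Inter>(insert P \<G>)) = {}"
          using vertices_face[OF face] missP 1 by (auto simp: \<G>_def)
        moreover have "\<Inter>(insert P \<G>) = convex hull vertices (\<Inter>(insert P \<G>))"
          using face P face_of_polytope_polytope polytope_eq_convex_hull_vertices by blast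
        ultimately show ?thesis using 1 by simp
      next
        case 2
        then have "\<G> = {}"
          by (auto simp: \<G>_def facets_def) (metis facet_of_imp_subset facet_of_irrefl subset_antisym)
        then show ?thesis using 2 by simp
      next
        case 3
        then have "F = \<Inter>\<G>"
          using face_of_polyhedron[OF polytope_imp_polyhedron[OF P] F] by (simp add: \<G>_def facets_def)
        then show ?thesis using face_of_imp_subset[OF F] by auto
      qed
    qed
    then show ?thesis using vertices_face[OF F] by (auto simp: vertices_def extreme_point_of_def)
  qed
  also have "g ` \<dots> = {u \<in> vertices Q. \<forall>G\<in>\<G>. u \<in> h G}"
  proof (intro equalityI subsetI)
    fix u assume "u \<in> g ` {v \<in> vertices P. \<forall>G\<in>\<G>. v \<in> G}"
    then show "u \<in> {u \<in> vertices Q. \<forall>G\<in>\<G>. u \<in> h G}"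
      using g inc by (auto simp: bij_betw_def \<G>_def)
  next
    fix u assume u: "u \<in> {u \<in> vertices Q. \<forall>G\<in>\<G>. u \<in> h G}"
    then obtain v where "v \<in> vertices P" "g v = u"
      using bij_betw_imp_surj_on[OF g] by (metis (no_types, lifting) imageE mem_Collect_eq)
    then show "u \<in> g ` {v \<in> vertices P. \<forall>G\<in>\<G>. v \<in> G}"
      using u inc by (auto simp: \<G>_def)
  qed
  also have "\<dots> = vertices (\<Inter>(insert Q (h ` \<G>)))"
  proof -
    have "\<Inter>(insert Q (h ` \<G>)) face_of Q"
    proof (rule face_of_Inter)
      fix T assume "T \<in> insert Q (h ` \<G>)"
      then have "T = Q \<or> T \<in> facets Q" using h by (auto simp: \<G>_def bij_betw_def)
      then show "T face_of Q"
        using Q by (auto simp: facets_def facet_of_imp_face_of face_of_refl_eq polytope_imp_convex)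
    qed auto
    from vertices_face[OF this] show ?thesis by (auto simp: vertices_def extreme_point_of_def)
  qed
  moreover have "\<Inter>(insert Q (h ` \<G>)) face_of Q"
  proof (rule face_of_Inter)
    fix T assume "T \<in> insert Q (h ` \<G>)"
    then have "T = Q \<or> T \<in> facets Q" using h by (auto simp: \<G>_def bij_betw_def)
    then show "T face_of Q"
      using Q by (auto simp: facets_def facet_of_imp_face_of face_of_refl_eq polytope_imp_convex)
  qed auto
  ultimately show ?thesis by metis
qed

text \<open>A face is sent to the hull of the images of its vertices. By
  \<open>incidence_face\<close> this is a face, and the same lemma for the inverses of
  \<open>g\<close> and \<open>h\<close> gives surjectivity.\<close>

lemma combinatorially_equivalentI:
  fixes P :: "'a::euclidean_space set" and Q :: "'b::euclidean_space set"
  assumes P: "polytope P" and Q: "polytope Q"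
    and g: "bij_betw g (vertices P) (vertices Q)"
    and h: "bij_betw h (facets P) (facets Q)"
    and inc: "\<And>v F. v \<in> vertices P \<Longrightarrow> F \<in> facets P \<Longrightarrow> v \<in> F \<longleftrightarrow> g v \<in> h F"
    and missP: "\<And>v. v \<in> vertices P \<Longrightarrow> \<exists>F\<in>facets P. v \<notin> F"
  shows "combinatorially_equivalent P Q"
proof -
  define f where "f F = convex hull (g ` vertices F)" for F
  have f: "f F face_of Q \<and> vertices (f F) = g ` vertices F" if F: "F face_of P" for F
  proof -
    obtain G where "G face_of Q" "vertices G = g ` vertices F"
      using incidence_face[OF P Q g h inc missP F] by blast
    moreover from this have "G = f F"
      using polytope_eq_convex_hull_vertices face_of_polytope_polytope[OF Q] unfolding f_def by metis
    ultimately show ?thesis by simp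
  qed
  have mono: "F \<subseteq> F' \<longleftrightarrow> f F \<subseteq> f F'" if "F face_of P" "F' face_of P" for F F'
  proof -
    have "f F \<subseteq> f F' \<longleftrightarrow> g ` vertices F \<subseteq> g ` vertices F'"
      using vertices_mono_faces[OF Q, of "f F" "f F'"] f that by simp
    also have "\<dots> \<longleftrightarrow> vertices F \<subseteq> vertices F'"
      using g vertices_face that by (intro inj_on_image_subset_iff[of g "vertices P"]) (auto simp: bij_betw_def)
    finally show ?thesis using vertices_mono_faces[OF P] that by simp
  qed
  have "\<exists>F. F face_of P \<and> f F = G" if G: "G face_of Q" for G
  proof -
    let ?g = "the_inv_into (vertices P) g" and ?h = "the_inv_into (facets P) h"
    have g': "bij_betw ?g (vertices Q) (vertices P)" and h': "bij_betw ?h (facets Q) (facets P)"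
      using g h bij_betw_the_inv_into by blast+
    have g1: "g (?g u) = u" "?g u \<in> vertices P" if "u \<in> vertices Q" for u
      using g g' that f_the_inv_into_f_bij_betw[OF g] by (auto simp: bij_betw_def)
    have h1: "h (?h F) = F" "?h F \<in> facets P" if "F \<in> facets Q" for F
      using h h' that f_the_inv_into_f_bij_betw[OF h] by (auto simp: bij_betw_def)
    have "u \<in> F \<longleftrightarrow> ?g u \<in> ?h F" if "u \<in> vertices Q" "F \<in> facets Q" for u F
      using inc[of "?g u" "?h F"] g1 h1 that by simp
    moreover have "\<exists>F\<in>facets Q. u \<notin> F" if u: "u \<in> vertices Q" for u
    proof -
      obtain F where "F \<in> facets P" "?g u \<notin> F" using missP g1(2)[OF u] by blast
      then show ?thesis using inc[of "?g u" F] g1[OF u] h by (auto simp: bij_betw_def)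
    qed
    ultimately obtain F where F: "F face_of P" "vertices F = ?g ` vertices G"
      using incidence_face[OF Q P g' h' _ _ G] by blast
    have "g ` ?g ` vertices G = vertices G"
      using g1(1) vertices_face[OF G] by (force simp: image_image)
    then have "f F = convex hull vertices G" by (simp add: f_def F)
    then have "f F = G"
      using polytope_eq_convex_hull_vertices face_of_polytope_polytope[OF Q G] by metis
    then show ?thesis using F by blast
  qed
  moreover have "inj_on f {F. F face_of P}"
    using mono by (intro inj_onI) (auto intro!: subset_antisym)
  ultimately have "bij_betw f {F. F face_of P} {G. G face_of Q}"
    using f unfolding bij_betw_def by blast
  then show ?thesis using mono unfolding combinatorially_equivalent_def by blast
qed

section \<open>Self-polar sets of unit vectors\<close>

lemma finite_obtain_maximizer:
  fixes f :: "'a \<Rightarrow> real"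
  assumes "finite A" "A \<noteq> {}"
  obtains x where "x \<in> A" "\<And>y. y \<in> A \<Longrightarrow> f y \<le> f x"
proof -
  have "Max (f ` A) \<in> f ` A" using assms by (intro Max_in) auto
  then obtain x where "x \<in> A" "f x = Max (f ` A)" by auto
  moreover have "f y \<le> Max (f ` A)" if "y \<in> A" for y using assms that by simp
  ultimately show ?thesis using that by metis
qed

text \<open>Each of the functionals \<open>p\<close> and \<open>q\<close> vanishes on exactly one of
  \<open>d\<close> and \<open>e\<close>, which makes \<open>d\<close> and \<open>e\<close> a basis
  of the plane orthogonal to \<open>w\<close>.\<close>

lemma plane_combination:
  fixes d e w y :: "'a::euclidean_space"
  assumes "DIM('a) = 3" "w \<noteq> 0" "w \<bullet> d = 0" "w \<bullet> e = 0" "w \<bullet> y = 0"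
    and "p \<bullet> d = 0" "p \<bullet> e \<noteq> 0" "q \<bullet> e = 0" "q \<bullet> d \<noteq> 0"
  shows "\<exists>\<alpha> \<beta>. y = \<alpha> *\<^sub>R d + \<beta> *\<^sub>R e"
proof -
  have "d \<notin> span {e}"
    using assms by (auto simp: span_singleton)
  moreover have "e \<noteq> 0" "d \<noteq> e" using assms by auto
  ultimately have ind: "independent {d, e}" by (simp add: independent_insert)
  have sub: "span {d, e} \<subseteq> {x. w \<bullet> x = 0}"
    by (rule span_minimal) (use assms in \<open>auto simp: subspace_hyperplane\<close>)
  have "dim (span {d, e}) = 2"
    using dim_span_eq_card_independent[OF ind] \<open>d \<noteq> e\<close> by simp
  moreover have "dim {x. w \<bullet> x = 0} = 2"
    using dim_hyperplane[OF \<open>w \<noteq> 0\<close>] assms(1) by simp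
  ultimately have "span {d, e} = {x. w \<bullet> x = 0}"
    using subspace_dim_equal[OF subspace_span subspace_hyperplane sub] by simp
  then have "y \<in> span {d, e}" using assms(5) by auto
  then obtain a b where "y - a *\<^sub>R d = b *\<^sub>R e"
    by (auto simp: span_insert span_singleton)
  then have "y = a *\<^sub>R d + b *\<^sub>R e" by (simp add: algebra_simps)
  then show ?thesis by blast
qed

text \<open>Moving from \<open>y\<close> against one of the directions of \<open>X\<close> until a constraint of \<open>N\<close> becomes
  tight brings the point into a two-dimensional face of the cone cut out by \<open>N\<close>.\<close>

lemma cone_local_max:
  fixes c y :: "'a::euclidean_space"
  assumes dim: "DIM('a) = 3" and N: "finite N" "N \<noteq> {}"
    and edges: "\<And>w. w \<in> N \<Longrightarrow> \<exists>d\<in>X. \<exists>e\<in>X. \<exists>p\<in>N. \<exists>q\<in>N.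
      w \<bullet> d = 0 \<and> w \<bullet> e = 0 \<and> p \<bullet> d = 0 \<and> p \<bullet> e > 0 \<and> q \<bullet> e = 0 \<and> q \<bullet> d > 0"
    and cone: "\<And>w d. w \<in> N \<Longrightarrow> d \<in> X \<Longrightarrow> w \<bullet> d \<ge> 0"
    and c: "\<And>d. d \<in> X \<Longrightarrow> c \<bullet> d \<le> 0"
    and y: "\<And>w. w \<in> N \<Longrightarrow> w \<bullet> y \<ge> 0"
  shows "c \<bullet> y \<le> 0"
proof -
  obtain w0 where "w0 \<in> N" using N by blast
  then obtain d q where d: "d \<in> X" "q \<in> N" "q \<bullet> d > 0" using edges by blast
  let ?M = "{w \<in> N. w \<bullet> d > 0}"
  \<comment> \<open>Ratio test: the least \<open>u \<bullet> y / (u \<bullet> d)\<close> belongs to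
    the first constraint to become tight, so all others still hold at \<open>z\<close>.\<close>
  obtain w where w: "w \<in> ?M" and min: "\<And>u. u \<in> ?M \<Longrightarrow> - (u \<bullet> y / (u \<bullet> d)) \<le> - (w \<bullet> y / (w \<bullet> d))"
    using finite_obtain_maximizer[of ?M "\<lambda>u. - (u \<bullet> y / (u \<bullet> d))"] N d by auto
  define t where "t = w \<bullet> y / (w \<bullet> d)"
  have t: "t \<ge> 0" using w y by (auto simp: t_def)
  define z where "z = y - t *\<^sub>R d"
  have z: "u \<bullet> z \<ge> 0" if u: "u \<in> N" for u
  proof (cases "u \<bullet> d > 0")
    case True
    then have "t \<le> u \<bullet> y / (u \<bullet> d)" using min[of u] u by (auto simp: t_def)
    then have "t * (u \<bullet> d) \<le> u \<bullet> y" using True by (simp add: field_simps)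
    then show ?thesis by (simp add: z_def algebra_simps)
  next
    case False
    then have "u \<bullet> d = 0" using cone[OF u d(1)] by simp
    then show ?thesis using y[OF u] by (simp add: z_def algebra_simps)
  qed
  have wz: "w \<bullet> z = 0" using w by (auto simp: z_def t_def algebra_simps)
  obtain e e' p p' where e: "e \<in> X" "e' \<in> X" "p \<in> N" "p' \<in> N" "w \<bullet> e = 0" "w \<bullet> e' = 0"
    "p \<bullet> e = 0" "p \<bullet> e' > 0" "p' \<bullet> e' = 0" "p' \<bullet> e > 0" using edges[of w] w by blast
  obtain \<alpha> \<beta> where ab: "z = \<alpha> *\<^sub>R e + \<beta> *\<^sub>R e'"
    using plane_combination[OF dim, of w e e' z p p'] e w wz by (metis (mono_tags, lifting) inner_zero_left less_irrefl mem_Collect_eq)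
  \<comment> \<open>Up to positive factors, \<open>p'\<close> and \<open>p\<close> read off the
    coefficients of \<open>z\<close>.\<close>
  have "p' \<bullet> z = \<alpha> * (p' \<bullet> e)" "p \<bullet> z = \<beta> * (p \<bullet> e')"
    using e by (simp_all add: ab inner_add_right)
  then have "\<alpha> \<ge> 0" "\<beta> \<ge> 0" using z e by (metis zero_le_mult_iff not_le)+
  then have "c \<bullet> z \<le> 0"
    using c[OF e(1)] c[OF e(2)] by (simp add: ab inner_add_right add_nonpos_nonpos mult_nonneg_nonpos)
  moreover have "c \<bullet> y = c \<bullet> z + t * (c \<bullet> d)" by (simp add: z_def algebra_simps)
  ultimately show ?thesis using mult_nonneg_nonpos[OF t c[OF d(1)]] by simp
qed

definition nbrs :: "real \<Rightarrow> (real^3) set \<Rightarrow> real^3 \<Rightarrow> (real^3) set" where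
  "nbrs r V v = {u \<in> V. v \<bullet> u = - r}"

lemma nbrs_sym: "v \<in> V \<Longrightarrow> w \<in> nbrs r V v \<Longrightarrow> v \<in> nbrs r V w"
  by (auto simp: nbrs_def inner_commute)

lemma finite_nbrs: "finite V \<Longrightarrow> finite (nbrs r V v)"
  by (simp add: nbrs_def)

text \<open>The segments from \<open>v\<close> to \<open>x\<close> and \<open>y\<close> are the two edges at \<open>v\<close> of the facet opposite to \<open>w\<close>;
  \<open>p\<close> and \<open>q\<close> are opposite to the facets on their other sides.\<close>

definition flag_edges :: "real \<Rightarrow> (real^3) set \<Rightarrow> real^3 \<Rightarrow> real^3 \<Rightarrow> real^3 \<Rightarrow> real^3 \<Rightarrow> bool" where
  "flag_edges r V v w x y \<longleftrightarrow> x \<in> nbrs r V w \<and> y \<in> nbrs r V w \<and>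
     (\<exists>p\<in>nbrs r V v. p \<in> nbrs r V x \<and> p \<notin> nbrs r V y) \<and>
     (\<exists>q\<in>nbrs r V v. q \<in> nbrs r V y \<and> q \<notin> nbrs r V x)"

text \<open>\<open>cone_local_max\<close> is applied to \<open>y - v\<close>, with the directions
  from \<open>v\<close> to the points of \<open>V\<close> where \<open>c\<close> is no larger.
  Allowing any \<open>y\<close> in the polar set serves \<open>self_polarI\<close>; asking for only
  one suitable pair of edges for each \<open>w\<close> serves
  \<open>edges_connected\<close>.\<close>

lemma local_max_imp_global_max:
  fixes c :: "real^3"
  assumes fin: "finite V" and gram: "\<And>u v. u \<in> V \<Longrightarrow> v \<in> V \<Longrightarrow> - r \<le> u \<bullet> v"
    and v: "v \<in> V" and ne: "nbrs r V v \<noteq> {}"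
    and loc: "\<And>w. w \<in> nbrs r V v \<Longrightarrow> \<exists>x y. flag_edges r V v w x y \<and> c \<bullet> x \<le> c \<bullet> v \<and> c \<bullet> y \<le> c \<bullet> v"
    and y: "\<And>u. u \<in> V \<Longrightarrow> - r \<le> u \<bullet> y"
  shows "c \<bullet> y \<le> c \<bullet> v"
proof -
  define X where "X = {x - v | x. x \<in> V \<and> c \<bullet> x \<le> c \<bullet> v}"
  have "c \<bullet> (y - v) \<le> 0"
  proof (rule cone_local_max[of "nbrs r V v" X])
    show "DIM(real^3) = 3" by simp
    show "finite (nbrs r V v)" using fin by (rule finite_nbrs)
    show "nbrs r V v \<noteq> {}" by fact
    fix w assume w: "w \<in> nbrs r V v"
    have wv: "w \<in> V" "w \<bullet> v = - r" using w by (auto simp: nbrs_def inner_commute)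
    obtain x z p q where *: "x \<in> nbrs r V w" "z \<in> nbrs r V w" "p \<in> nbrs r V v" "p \<in> nbrs r V x"
      "p \<notin> nbrs r V z" "q \<in> nbrs r V v" "q \<in> nbrs r V z" "q \<notin> nbrs r V x"
      "c \<bullet> x \<le> c \<bullet> v" "c \<bullet> z \<le> c \<bullet> v"
      using loc[OF w] unfolding flag_edges_def by blast
    have "x - v \<in> X" "z - v \<in> X" using * by (auto simp: X_def nbrs_def)
    moreover have "p \<bullet> z > - r" "q \<bullet> x > - r"
      using * gram[of p z] gram[of q x] by (auto simp: nbrs_def inner_commute)
    then have "p \<bullet> (z - v) > 0" "q \<bullet> (x - v) > 0" "p \<bullet> (x - v) = 0" "q \<bullet> (z - v) = 0"
      "w \<bullet> (x - v) = 0" "w \<bullet> (z - v) = 0"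
      using * wv by (auto simp: nbrs_def inner_diff_right inner_commute)
    ultimately show "\<exists>d\<in>X. \<exists>e\<in>X. \<exists>p\<in>nbrs r V v. \<exists>q\<in>nbrs r V v.
      w \<bullet> d = 0 \<and> w \<bullet> e = 0 \<and> p \<bullet> d = 0 \<and> p \<bullet> e > 0 \<and> q \<bullet> e = 0 \<and> q \<bullet> d > 0"
      using *(3,6) by blast
    show "w \<bullet> (y - v) \<ge> 0" using y[OF wv(1)] wv by (simp add: inner_diff_right)
    fix d assume "d \<in> X"
    then obtain u where "u \<in> V" "d = u - v" by (auto simp: X_def)
    then show "w \<bullet> d \<ge> 0" using gram[OF wv(1), of u] wv by (simp add: inner_diff_right)
  next
    fix d assume "d \<in> X"
    then show "c \<bullet> d \<le> 0" by (auto simp: X_def inner_diff_right)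
  qed
  then show ?thesis by (simp add: inner_diff_right)
qed

text \<open>The last equation says that the polytope is its own polar body scaled by
  \<open>- r\<close>.\<close>

locale self_polar =
  fixes V :: "(real^3) set" and r :: real
  assumes finite_V: "finite V" and V_sphere: "V \<subseteq> sphere 0 1"
    and r_pos: "0 < r" and r_less: "r < 1"
    and polar: "convex hull V = {x. \<forall>v\<in>V. - r \<le> v \<bullet> x}"

text \<open>A point of the polar set outside the hull would be strictly separated from
  \<open>V\<close>; but the element of \<open>V\<close> that maximizes the separating functional
  already maximizes it over the whole polar set.\<close>

lemma self_polarI:
  assumes fin: "finite V" and sph: "V \<subseteq> sphere 0 1" and V: "V \<noteq> {}" and r: "0 < r" "r < 1"
    and gram: "\<And>u v. u \<in> V \<Longrightarrow> v \<in> V \<Longrightarrow> - r \<le> u \<bullet> v"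
    and ne: "\<And>v. v \<in> V \<Longrightarrow> nbrs r V v \<noteq> {}"
    and fl: "\<And>v w. v \<in> V \<Longrightarrow> w \<in> nbrs r V v \<Longrightarrow> \<exists>x y. flag_edges r V v w x y"
  shows "self_polar V r"
proof
  show "convex hull V = {x. \<forall>v\<in>V. - r \<le> v \<bullet> x}"
  proof
    have "convex (\<Inter>v\<in>V. {x. v \<bullet> x \<ge> - r})"
      by (intro convex_INT convex_halfspace_ge)
    moreover have "(\<Inter>v\<in>V. {x. v \<bullet> x \<ge> - r}) = {x. \<forall>v\<in>V. - r \<le> v \<bullet> x}" by auto
    ultimately have "convex {x. \<forall>v\<in>V. - r \<le> v \<bullet> x}" by simp
    then show "convex hull V \<subseteq> {x. \<forall>v\<in>V. - r \<le> v \<bullet> x}"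
      by (intro hull_minimal) (use gram in auto)
    show "{x. \<forall>v\<in>V. - r \<le> v \<bullet> x} \<subseteq> convex hull V"
    proof (rule ccontr)
      assume "\<not> ?thesis"
      then obtain y where y: "\<And>v. v \<in> V \<Longrightarrow> - r \<le> v \<bullet> y" "y \<notin> convex hull V" by blast
      moreover have "closed (convex hull V)" using fin finite_imp_compact_convex_hull compact_imp_closed by blast
      ultimately obtain a b where ab: "a \<bullet> y < b" "\<And>x. x \<in> convex hull V \<Longrightarrow> a \<bullet> x > b"
        using separating_hyperplane_closed_point[of "convex hull V" y] by auto
      obtain v where v: "v \<in> V" "\<And>u. u \<in> V \<Longrightarrow> (- a) \<bullet> u \<le> (- a) \<bullet> v"
        using finite_obtain_maximizer[OF fin V, of "\<lambda>u. (- a) \<bullet> u"] by metis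
      have "(- a) \<bullet> y \<le> (- a) \<bullet> v"
      proof (rule local_max_imp_global_max[OF fin gram v(1) ne[OF v(1)] _ y(1)])
        fix w assume "w \<in> nbrs r V v"
        then obtain x z where xz: "flag_edges r V v w x z" using fl v(1) by blast
        then have "x \<in> V" "z \<in> V" by (auto simp: flag_edges_def nbrs_def)
        then show "\<exists>x z. flag_edges r V v w x z \<and> - a \<bullet> x \<le> - a \<bullet> v \<and> - a \<bullet> z \<le> - a \<bullet> v"
          using xz v(2)[of x] v(2)[of z] by auto
      qed
      moreover have "a \<bullet> v > b" using ab(2)[OF hull_inc[OF v(1)]] .
      ultimately show False using ab(1) by simp
    qed
  qed
qed (use assms in auto)

section \<open>Facets of a self-polar polytope\<close>

context self_polar
begin

abbreviation "P \<equiv> convex hull V"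
abbreviation "N \<equiv> nbrs r V"

lemma norm_V: "v \<in> V \<Longrightarrow> norm v = 1"
  using V_sphere by auto

lemma inner_V_self: "v \<in> V \<Longrightarrow> v \<bullet> v = 1"
  using norm_V by (simp add: dot_square_norm)

lemma gram: "u \<in> V \<Longrightarrow> v \<in> V \<Longrightarrow> - r \<le> u \<bullet> v"
  using polar hull_inc[of v V convex] by blast

lemma polytope_P: "polytope P"
  using finite_V by (simp add: polytope_convex_hull)

lemma vertices_P: "vertices P = V"
  using vertices_convex_hull_sphere finite_V V_sphere by blast

lemma cball_subset: "cball 0 r \<subseteq> P"
proof
  fix x :: "real^3" assume "x \<in> cball 0 r"
  then have "\<bar>v \<bullet> x\<bar> \<le> r" if "v \<in> V" for v
    using norm_V[OF that] Cauchy_Schwarz_ineq2[of v x] by simp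
  then show "x \<in> P" unfolding polar by (force simp: abs_le_iff)
qed

lemma facet_eq: "v \<in> V \<Longrightarrow> convex hull N v = P \<inter> {x. v \<bullet> x = - r}"
  using convex_hull_Int_hyperplane[OF finite_V, of "- r" v] gram by (simp add: nbrs_def)

lemma facet_face: "v \<in> V \<Longrightarrow> convex hull N v face_of P"
  using face_of_Int_supporting_hyperplane_ge[where S = P and a = v and b = "- r", OF convex_convex_hull]
    facet_eq polar by simp

lemma pole_in_facet: assumes "v \<in> V" shows "- r *\<^sub>R v \<in> convex hull N v"
proof -
  have "norm (- r *\<^sub>R v) \<le> r" using norm_V[OF assms] r_pos by simp
  then have "- r *\<^sub>R v \<in> P" using cball_subset by (metis mem_cball_0 subsetD)
  then show ?thesis using facet_eq[OF assms] inner_V_self[OF assms] by simp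
qed

text \<open>The facet opposite to \<open>v\<close> touches the inner sphere at
  \<open>- r *\<^sub>R v\<close>, and this point lies on the facet plane of \<open>w\<close> only if
  \<open>w = v\<close>.\<close>

lemma facet_subset_imp_eq:
  assumes v: "v \<in> V" and w: "w \<in> V" and "convex hull N v \<subseteq> convex hull N w"
  shows "v = w"
proof -
  have "w \<bullet> (- r *\<^sub>R v) = - r" using pole_in_facet[OF v] assms(3) facet_eq[OF w] by blast
  then have "w \<bullet> v = 1" using r_pos by simp
  then show ?thesis using inner_eq_1_imp_eq[of w v] norm_V v w by simp
qed

lemma not_in_own_facet: "v \<in> V \<Longrightarrow> v \<notin> convex hull N v"
  using facet_eq inner_V_self r_pos by fastforce

lemma vertex_in_facet_iff: "v \<in> V \<Longrightarrow> w \<in> V \<Longrightarrow> v \<in> convex hull N w \<longleftrightarrow> v \<in> N w"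
  using facet_eq[of w] hull_inc[of v V convex] by (auto simp: nbrs_def)

text \<open>A point in the relative interior of a proper face makes some constraint tight, since it
  would otherwise be interior to \<open>P\<close>; the facet of that constraint then contains the
  whole face.\<close>

lemma proper_face_subset_facet:
  assumes G: "G face_of P" "G \<noteq> {}" "G \<noteq> P"
  shows "\<exists>w\<in>V. G \<subseteq> convex hull N w"
proof -
  have cG: "convex G" using G(1) by (rule face_of_imp_convex)
  then obtain x where x: "x \<in> rel_interior G" using rel_interior_eq_empty G(2) by blast
  have xG: "x \<in> G" using x rel_interior_subset by blast
  have "\<exists>w\<in>V. w \<bullet> x = - r"
  proof (rule ccontr)
    assume "\<not> ?thesis"
    moreover have "- r \<le> w \<bullet> x" if "w \<in> V" for w
      using that xG face_of_imp_subset[OF G(1)] polar by blast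
    ultimately have "x \<in> (\<Inter>w\<in>V. {x. w \<bullet> x > - r})" by force
    moreover have "open (\<Inter>w\<in>V. {x. w \<bullet> x > - r})"
      using finite_V by (intro open_INT) (auto simp: open_halfspace_gt)
    moreover have "(\<Inter>w\<in>V. {x. w \<bullet> x > - r}) \<subseteq> P" unfolding polar by force
    ultimately have "x \<in> interior P" by (meson interior_maximal subsetD)
    then show False using face_of_disjoint_interior[OF G(1,3)] xG by blast
  qed
  then obtain w where w: "w \<in> V" "w \<bullet> x = - r" by blast
  have "x \<in> convex hull N w"
    using xG face_of_imp_subset[OF G(1)] w facet_eq by auto
  then have "G \<subseteq> convex hull N w"
    using subset_of_face_of[OF facet_face[OF w(1)] face_of_imp_subset[OF G(1)]] x
    by (auto simp: disjnt_def)
  then show ?thesis using w by blast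
qed

text \<open>Every proper nonempty face lies below one of these sets, and two nested ones coincide by
  \<open>facet_subset_imp_eq\<close>; hence they are exactly the coatoms.\<close>

lemma facets_P: "facets P = (\<lambda>v. convex hull N v) ` V"
proof (intro equalityI subsetI)
  fix G assume "G \<in> facets P"
  then have G: "G face_of P" "G \<noteq> {}" "G \<noteq> P" "\<And>H. H face_of P \<Longrightarrow> G \<subseteq> H \<Longrightarrow> H = G \<or> H = P"
    using facet_iff_maximal_face[OF polytope_P] by auto
  then obtain w where "w \<in> V" "G \<subseteq> convex hull N w" using proper_face_subset_facet by blast
  moreover from this have "convex hull N w \<noteq> P"
    using not_in_own_facet hull_inc[of w V convex] by auto
  ultimately show "G \<in> (\<lambda>v. convex hull N v) ` V" using G(4) facet_face by blast
next
  fix G assume "G \<in> (\<lambda>v. convex hull N v) ` V"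
  then obtain v where v: "v \<in> V" "G = convex hull N v" by blast
  have "H = G \<or> H = P" if H: "H face_of P" "G \<subseteq> H" for H
  proof (rule ccontr)
    assume *: "\<not> (H = G \<or> H = P)"
    have "H \<noteq> {}" using pole_in_facet v H(2) by auto
    then obtain w where w: "w \<in> V" "H \<subseteq> convex hull N w"
      using proper_face_subset_facet[OF H(1)] * by blast
    then have "w = v" using facet_subset_imp_eq v H by blast
    then show False using w v H * by blast
  qed
  moreover have "G \<noteq> {}" "G \<noteq> P"
    using v not_in_own_facet[of v] hull_inc[of v V convex] pole_in_facet[of v] by auto
  ultimately show "G \<in> facets P" using facet_iff_maximal_face[OF polytope_P] facet_face v by blast
qed

lemma inj_facet: "inj_on (\<lambda>v. convex hull N v) V"
  using facet_subset_imp_eq by (auto intro!: inj_onI)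

lemma strongly_self_dual_P: "strongly_self_dual P"
  unfolding strongly_self_dual_def
proof (intro conjI exI)
  show "\<forall>F\<in>facets P. F \<inter> sphere 0 r \<noteq> {}"
  proof
    fix F assume "F \<in> facets P"
    then obtain v where v: "v \<in> V" "F = convex hull N v" using facets_P by blast
    then have "- r *\<^sub>R v \<in> F \<inter> sphere 0 r" using pole_in_facet norm_V r_pos by simp
    then show "F \<inter> sphere 0 r \<noteq> {}" by blast
  qed
  show "bij_betw (\<lambda>v. convex hull N v) (vertices P) (facets P)"
    using inj_facet facets_P vertices_P by (simp add: bij_betw_def)
  show "\<forall>v\<in>vertices P. \<forall>p\<in>convex hull N v. \<forall>q\<in>convex hull N v. orthogonal v (p - q)"
    using facet_eq vertices_P by (auto simp: orthogonal_def inner_diff_right)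
qed (use polytope_P vertices_P V_sphere r_pos r_less cball_subset in auto)

lemma facet_sizes_P: "facet_sizes P = image_mset (\<lambda>v. card (N v)) (mset_set V)"
proof -
  have "vertices (convex hull N v) = N v" for v
    using finite_V V_sphere by (intro vertices_convex_hull_sphere) (auto simp: nbrs_def)
  then show ?thesis
    by (simp add: facet_sizes_def facets_P image_mset_mset_set[OF inj_facet, symmetric]
        image_mset.compositionality comp_def)
qed

end

text \<open>Facets are indexed by vertices, so a bijection of the vertices that preserves the graph
  also matches the facets. The radii \<open>r\<close> and \<open>s\<close> may differ.\<close>

lemma self_polar_combinatorially_equivalent:
  assumes V: "self_polar V r" and W: "self_polar W s" and g: "bij_betw g V W"
    and adj: "\<And>u v. u \<in> V \<Longrightarrow> v \<in> V \<Longrightarrow> u \<bullet> v = - r \<longleftrightarrow> g u \<bullet> g v = - s"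
  shows "combinatorially_equivalent (convex hull V) (convex hull W)"
proof -
  interpret V: self_polar V r by fact
  interpret W: self_polar W s by fact
  let ?i = "the_inv_into V (\<lambda>v. convex hull V.N v)"
  have i: "bij_betw ?i (facets V.P) V"
    unfolding V.facets_P by (intro bij_betw_the_inv_into) (simp add: bij_betw_def V.inj_facet)
  have iF: "?i (convex hull V.N v) = v" if "v \<in> V" for v
    using the_inv_into_f_f[OF V.inj_facet that] .
  let ?j = "\<lambda>v. convex hull W.N v"
  have j: "bij_betw ?j W (facets W.P)"
    using W.inj_facet W.facets_P by (simp add: bij_betw_def)
  show ?thesis
  proof (rule combinatorially_equivalentI[OF V.polytope_P W.polytope_P, of g "?j \<circ> (g \<circ> ?i)"])
    show "bij_betw g (vertices V.P) (vertices W.P)" using g V.vertices_P W.vertices_P by simp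
    show "bij_betw (?j \<circ> (g \<circ> ?i)) (facets V.P) (facets W.P)"
      by (intro bij_betw_trans[OF _ j] bij_betw_trans[OF i g])
  next
    fix v F assume v: "v \<in> vertices V.P" and F: "F \<in> facets V.P"
    obtain w where w: "w \<in> V" "F = convex hull V.N w" using F V.facets_P by blast
    have "v \<in> V" using v V.vertices_P by simp
    moreover have "g v \<in> W" "g w \<in> W" using g w \<open>v \<in> V\<close> by (auto simp: bij_betw_def)
    ultimately show "v \<in> F \<longleftrightarrow> g v \<in> (?j \<circ> (g \<circ> ?i)) F"
      using w iF[OF w(1)] adj[of w v] V.vertex_in_facet_iff[of v w] W.vertex_in_facet_iff[of "g v" "g w"]
      by (simp add: nbrs_def)
  next
    fix v assume "v \<in> vertices V.P"
    then have "v \<in> V" using V.vertices_P by simp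
    then show "\<exists>F\<in>facets V.P. v \<notin> F" using V.facets_P V.not_in_own_facet by blast
  qed
qed

section \<open>From strong self-duality to self-polarity\<close>

lemma hyperplane_eq_imp_parallel:
  fixes a v :: "'a::euclidean_space"
  assumes sub: "{x. a \<bullet> x = b} \<subseteq> {x. v \<bullet> x = c}" and a: "norm a = 1"
  shows "v = (v \<bullet> a) *\<^sub>R a"
proof -
  define d where "d = v - (v \<bullet> a) *\<^sub>R a"
  have ad: "a \<bullet> d = 0" using a by (simp add: d_def inner_diff_right inner_commute dot_square_norm)
  have "b *\<^sub>R a \<in> {x. v \<bullet> x = c}" "b *\<^sub>R a + d \<in> {x. v \<bullet> x = c}"
    by (rule subsetD[OF sub]; use a ad in \<open>simp add: inner_add_right dot_square_norm\<close>)+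
  then have "v \<bullet> d = 0" by (simp add: inner_add_right)
  then have "d \<bullet> d = 0" using ad by (simp add: d_def inner_diff_left)
  then show ?thesis by (simp add: d_def)
qed

text \<open>Let \<open>n\<close> and \<beta> be the unit normal and the offset of the plane of the
  facet. The ball gives \<open>r \<le> \<beta>\<close>, the common point with the sphere gives the
  converse. Orthogonality leaves \<open>v = n\<close> or \<open>v = - n\<close>, and the former
  would put \<open>v\<close>, at height 1 in direction \<open>n\<close>, beyond the plane at height
  \<open>r\<close>.\<close>

lemma strongly_self_dual_facet:
  fixes Q :: "(real^3) set"
  assumes Q: "polytope Q" and r: "0 < r" "r < 1" and ball: "cball 0 r \<subseteq> Q"
    and F: "F \<in> facets Q" "F \<inter> sphere 0 r \<noteq> {}"
    and v: "v \<in> Q" "norm v = 1" and orth: "\<forall>p\<in>F. \<forall>q\<in>F. orthogonal v (p - q)"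
  shows "F = Q \<inter> {x. v \<bullet> x = - r}" and "Q \<subseteq> {x. - r \<le> v \<bullet> x}"
proof -
  have "interior Q \<noteq> {}"
    using interior_mono[OF ball] r by (metis interior_cball ball_eq_empty not_le subset_empty)
  then have dimQ: "aff_dim Q = 3"
    using aff_dim_nonempty_interior by fastforce
  have fQ: "F facet_of Q" using F by (simp add: facets_def)
  then have "F exposed_face_of Q"
    using exposed_face_of_polyhedron[OF polytope_imp_polyhedron[OF Q]] facet_of_imp_face_of by blast
  moreover have "F \<noteq> {}" "F \<noteq> Q" using fQ by (auto simp: facet_of_def)
  ultimately obtain a b where ab: "a \<noteq> 0" "Q \<subseteq> {x. a \<bullet> x \<le> b}" "F = Q \<inter> {x. a \<bullet> x = b}"
    using exposed_face_of[of F Q] by blast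
  define n where "n = a /\<^sub>R norm a"
  define \<beta> where "\<beta> = b / norm a"
  have n: "norm n = 1" using ab by (simp add: n_def)
  have le: "n \<bullet> x \<le> \<beta> \<longleftrightarrow> a \<bullet> x \<le> b" and eq: "n \<bullet> x = \<beta> \<longleftrightarrow> a \<bullet> x = b" for x
    using ab(1) by (simp_all add: n_def \<beta>_def field_simps)
  have "r *\<^sub>R n \<in> Q" using ball n r by (auto simp: subset_iff)
  then have "n \<bullet> (r *\<^sub>R n) \<le> \<beta>" using ab le by blast
  then have "r \<le> \<beta>" using n by (simp add: dot_square_norm)
  obtain p where "p \<in> F \<inter> sphere 0 r" using F(2) by blast
  then have p: "p \<in> F" "norm p = r" by auto
  then have "\<beta> \<le> r" using norm_cauchy_schwarz[of n p] eq[of p] ab(3) n by auto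
  with \<open>r \<le> \<beta>\<close> have \<beta>: "\<beta> = r" by simp
  \<comment> \<open>Otherwise the two-dimensional facet would lie in the intersection of two
    different planes, which has dimension at most one.\<close>
  have "{x. n \<bullet> x = r} \<subseteq> {x. v \<bullet> x = v \<bullet> p}"
  proof (rule ccontr)
    assume *: "\<not> ?thesis"
    have "F \<subseteq> {x. n \<bullet> x = r} \<inter> {x. v \<bullet> x = v \<bullet> p}"
    proof
      fix x assume x: "x \<in> F"
      then have "n \<bullet> x = r" using ab(3) eq[of x] \<beta> by simp
      moreover have "orthogonal v (x - p)" using orth x p(1) by blast
      ultimately show "x \<in> {x. n \<bullet> x = r} \<inter> {x. v \<bullet> x = v \<bullet> p}"
        by (simp add: orthogonal_def inner_diff_right)
    qed
    then have "aff_dim F \<le> aff_dim ({x. n \<bullet> x = r} \<inter> {x. v \<bullet> x = v \<bullet> p})" by (rule aff_dim_subset)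
    also have "\<dots> \<le> 1"
    proof -
      have "n \<noteq> 0" using n by auto
      then have "aff_dim {x. n \<bullet> x = r} = 2" by simp
      then have "aff_dim ({x. n \<bullet> x = r} \<inter> {x. v \<bullet> x = v \<bullet> p}) \<in> {-1, 2 - 1}"
        using aff_dim_affine_Int_hyperplane[OF affine_hyperplane, of n r v "v \<bullet> p"] *
        by (simp only: if_False insert_iff split: if_splits) simp_all
      then show ?thesis by auto
    qed
    finally show False using fQ dimQ by (simp add: facet_of_def)
  qed
  then have vn: "v = (v \<bullet> n) *\<^sub>R n" using hyperplane_eq_imp_parallel n by blast
  then have "\<bar>v \<bullet> n\<bar> = 1" using v(2) n by (metis norm_scaleR mult.right_neutral real_norm_def)
  moreover have "v \<bullet> n \<le> r" using ab(2) v(1) le[of v] \<beta> by (auto simp: inner_commute)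
  ultimately have "v \<bullet> n = -1" using r by linarith
  then have v': "v = - n" using vn by simp
  show "F = Q \<inter> {x. v \<bullet> x = - r}" using ab(3) eq \<beta> by (auto simp: v')
  show "Q \<subseteq> {x. - r \<le> v \<bullet> x}" using ab(2) le \<beta> by (auto simp: v')
qed

text \<open>The segment from 0 to a point \<open>x\<close> outside \<open>Q\<close> meets the
  frontier at some \<open>t *\<^sub>R x\<close> on a facet \<open>\<sigma> v\<close>. There
  \<open>t * (v \<bullet> x) = - r\<close> with \<open>t < 1\<close>, so \<open>x\<close> violates
  the inequality of \<open>v\<close>.\<close>

lemma strongly_self_dual_imp_self_polar:
  assumes "strongly_self_dual Q"
  shows "\<exists>r. self_polar (vertices Q) r" and "Q = convex hull vertices Q"
proof -
  note ssd = assms[unfolded strongly_self_dual_def]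
  have Q: "polytope Q" and sph: "vertices Q \<subseteq> sphere 0 1" using ssd by simp_all
  obtain r where r: "0 < r" "r < 1"
    and ball: "cball 0 r \<subseteq> Q" and tan: "\<forall>F\<in>facets Q. F \<inter> sphere 0 r \<noteq> {}"
    using ssd by (elim conjE exE)
  obtain \<sigma> where \<sigma>: "bij_betw \<sigma> (vertices Q) (facets Q)"
    and orth: "\<forall>v\<in>vertices Q. \<forall>p\<in>\<sigma> v. \<forall>q\<in>\<sigma> v. orthogonal v (p - q)"
    using ssd by (elim conjE exE)
  show hull: "Q = convex hull vertices Q" using Q by (rule polytope_eq_convex_hull_vertices)
  have vQ: "v \<in> Q" "norm v = 1" "\<sigma> v \<in> facets Q" if "v \<in> vertices Q" for v
    using that sph bij_betwE[OF \<sigma>] by (auto simp: vertices_def extreme_point_of_def)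
  have \<sigma>_eq: "\<sigma> v = Q \<inter> {x. v \<bullet> x = - r}" and le: "Q \<subseteq> {x. - r \<le> v \<bullet> x}" if "v \<in> vertices Q" for v
    using strongly_self_dual_facet[OF Q r ball vQ(3)[OF that] bspec[OF tan vQ(3)[OF that]] vQ(1,2)[OF that] bspec[OF orth that]]
    by blast+
  have "{x. \<forall>v\<in>vertices Q. - r \<le> v \<bullet> x} \<subseteq> Q"
  proof (rule ccontr)
    assume "\<not> ?thesis"
    then obtain x where x: "\<And>v. v \<in> vertices Q \<Longrightarrow> - r \<le> v \<bullet> x" "x \<notin> Q" by blast
    have int: "0 \<in> interior Q" using interior_mono[OF ball] r by (auto simp: interior_cball)
    have "rel_frontier Q = frontier Q" using rel_frontier_nonempty_interior int by blast
    then have fr: "frontier Q = \<Union>(facets Q)"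
      using rel_frontier_of_polyhedron[OF polytope_imp_polyhedron[OF Q]] by (simp add: facets_def)
    have "closed_segment 0 x \<inter> frontier Q \<noteq> {}"
      by (rule connected_Int_frontier) (use int x(2) interior_subset in auto)
    then obtain t where t: "0 \<le> t" "t \<le> 1" "t *\<^sub>R x \<in> frontier Q"
      by (auto simp: closed_segment_def)
    then obtain v where v: "v \<in> vertices Q" "t *\<^sub>R x \<in> \<sigma> v"
      using fr bij_betw_imp_surj_on[OF \<sigma>] by (metis UN_iff)
    then have eq: "t * (v \<bullet> x) = - r" and tQ: "t *\<^sub>R x \<in> Q" using \<sigma>_eq by auto
    then have "t \<noteq> 1" using x(2) by auto
    then have "t < 1" using t by simp
    moreover have "v \<bullet> x < 0" using eq r t(1) by (smt (verit) mult_nonneg_nonneg)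
    ultimately have "v \<bullet> x < t * (v \<bullet> x)" by (simp add: mult_less_cancel_right1)
    then show False using eq x(1)[OF v(1)] by simp
  qed
  then have "self_polar (vertices Q) r"
    using finite_vertices[OF Q] sph r le hull by unfold_locales auto
  then show "\<exists>r. self_polar (vertices Q) r" ..
qed

section \<open>The vertex-facet incidence graph\<close>

text \<open>Once the root 0 is divided out, the quadratic condition on the parameter becomes linear:
  a line through a point of a sphere meets it in at most one further point.\<close>

lemma sphere_line_unique:
  fixes a t :: "'a::real_inner"
  assumes "norm (a + \<beta> *\<^sub>R t) = norm a" "norm (a + \<gamma> *\<^sub>R t) = norm a" "\<beta> \<noteq> 0" "\<gamma> \<noteq> 0" "t \<noteq> 0"
  shows "\<beta> = \<gamma>"
proof -
  have *: "\<delta> * (t \<bullet> t) = - (2 * (a \<bullet> t))" if "norm (a + \<delta> *\<^sub>R t) = norm a" "\<delta> \<noteq> 0" for \<delta>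
  proof -
    have "(a + \<delta> *\<^sub>R t) \<bullet> (a + \<delta> *\<^sub>R t) = a \<bullet> a" using that(1) by (simp add: dot_square_norm)
    then have "\<delta> * (\<delta> * (t \<bullet> t) + 2 * (a \<bullet> t)) = 0"
      by (simp add: algebra_simps inner_commute)
    then show ?thesis using that(2) by simp
  qed
  have "\<beta> * (t \<bullet> t) = \<gamma> * (t \<bullet> t)" using *[of \<beta>] *[of \<gamma>] assms by simp
  then show ?thesis using assms(5) by simp
qed

lemma cross3_orthogonal_multiple:
  fixes u v d :: "real^3"
  assumes t: "cross3 u v \<noteq> 0" and d: "u \<bullet> d = 0" "v \<bullet> d = 0"
  shows "\<exists>k. d = k *\<^sub>R cross3 u v"
proof -
  have "cross3 d (cross3 u v) = 0"
    using d by (simp add: Lagrange inner_commute)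
  then have "collinear {0, d, cross3 u v}" by (simp add: cross_eq_0)
  then have "collinear {0, cross3 u v, d}" by (simp add: insert_commute)
  then show ?thesis using t by (metis collinear_lemma scaleR_zero_left)
qed

lemma finite_small_eps:
  fixes f g :: "'a \<Rightarrow> real"
  assumes "finite A" "\<And>x. x \<in> A \<Longrightarrow> f x > 0"
  obtains \<epsilon> where "\<epsilon> > 0" "\<And>x. x \<in> A \<Longrightarrow> f x + \<epsilon> * g x > 0"
proof -
  have "\<forall>\<^sub>F \<epsilon> in at_right 0. f x + \<epsilon> * g x > 0" if "x \<in> A" for x
  proof -
    have "((\<lambda>\<epsilon>. f x + \<epsilon> * g x) \<longlongrightarrow> f x + 0 * g x) (at_right 0)"
      by (intro tendsto_intros)
    then show ?thesis using assms(2)[OF that] by (intro order_tendstoD(1)) auto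
  qed
  then have "\<forall>\<^sub>F \<epsilon> in at_right 0. \<forall>x\<in>A. f x + \<epsilon> * g x > 0"
    using assms(1) by (simp add: eventually_ball_finite_distrib)
  moreover have "\<forall>\<^sub>F \<epsilon> in at_right (0::real). \<epsilon> > 0" by (simp add: eventually_at_right_less)
  ultimately have "\<forall>\<^sub>F \<epsilon> in at_right 0. \<epsilon> > 0 \<and> (\<forall>x\<in>A. f x + \<epsilon> * g x > 0)"
    by (rule eventually_conj[rotated])
  then show ?thesis using that eventually_happens'[OF trivial_limit_at_right_real] by blast
qed

section \<open>Degrees, codegrees and edges\<close>

context self_polar
begin

lemma nbrs_subset: "N v \<subseteq> V" by (auto simp: nbrs_def)

lemma finite_N: "finite (N v)" using finite_V by (rule finite_nbrs)

lemma cross3_V_nonzero: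
  assumes "u \<in> V" "v \<in> V" "u \<noteq> v" "u \<noteq> - v"
  shows "cross3 u v \<noteq> 0"
proof
  assume "cross3 u v = 0"
  then have "(norm (cross3 u v))\<^sup>2 = 0" by simp
  then have "(u \<bullet> v)\<^sup>2 = 1" using norm_cross_dot[of u v] norm_V assms by simp
  then have "u \<bullet> v = 1 \<or> u \<bullet> (- v) = 1" by (simp add: power2_eq_1_iff)
  then show False using inner_eq_1_imp_eq[of u v] inner_eq_1_imp_eq[of u "- v"] norm_V assms by auto
qed

text \<open>Common neighbours satisfy two independent linear equations; they lie on a line, which
  contains at most two unit vectors.\<close>

lemma codegree_le_2:
  assumes u: "u \<in> V" and v: "v \<in> V" and "u \<noteq> v"
  shows "card (N u \<inter> N v) \<le> 2"
proof (rule ccontr)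
  assume "\<not> ?thesis"
  then have "3 \<le> card (N u \<inter> N v)" by simp
  then obtain A where "A \<subseteq> N u \<inter> N v" "card A = 3"
    by (meson obtain_subset_with_card_n)
  then obtain a b c where abc: "a \<in> N u \<inter> N v" "b \<in> N u \<inter> N v" "c \<in> N u \<inter> N v"
    "a \<noteq> b" "a \<noteq> c" "b \<noteq> c" by (auto simp: card_3_iff)
  \<comment> \<open>A common neighbour \<open>a\<close> of antipodal points would satisfy both
    \<open>u \<bullet> a = - r\<close> and \<open>u \<bullet> a = r\<close>.\<close>
  have "u \<noteq> - v" using abc r_pos by (auto simp: nbrs_def)
  then have t: "cross3 u v \<noteq> 0" using cross3_V_nonzero assms by blast
  have "u \<bullet> (b - a) = 0" "v \<bullet> (b - a) = 0" "u \<bullet> (c - a) = 0" "v \<bullet> (c - a) = 0"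
    using abc by (auto simp: nbrs_def inner_diff_right)
  then obtain \<beta> \<gamma> where "b - a = \<beta> *\<^sub>R cross3 u v" "c - a = \<gamma> *\<^sub>R cross3 u v"
    using cross3_orthogonal_multiple[OF t] by meson
  then have bc: "b = a + \<beta> *\<^sub>R cross3 u v" "c = a + \<gamma> *\<^sub>R cross3 u v" by (auto simp: algebra_simps)
  moreover have "norm b = norm a" "norm c = norm a" using abc norm_V nbrs_subset by (metis IntD1 subsetD)+
  ultimately have "\<beta> = \<gamma>" using sphere_line_unique[of a \<beta> "cross3 u v" \<gamma>] t abc by auto
  then show False using bc abc by simp
qed

text \<open>The facet contains a neighbourhood of its point of tangency within its plane, whereas at
  most two vertices would confine it to a line.\<close>

lemma card_nbrs_ge_3:
  assumes v: "v \<in> V" shows "3 \<le> card (N v)"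
proof (rule ccontr)
  assume "\<not> ?thesis"
  then obtain a b where ab: "N v \<subseteq> {a, b}"
  proof -
    have "card (N v) = 0 \<or> card (N v) = 1 \<or> card (N v) = 2" using \<open>\<not> 3 \<le> card (N v)\<close> by linarith
    then show ?thesis
      using that finite_N[of v] by (auto simp: card_1_singleton_iff card_2_iff)
  qed
  have "dim (span {v, a - b}) < DIM(real^3)"
  proof -
    have "dim (span {v, a - b}) \<le> card {v, a - b}" using dim_le_card'[of "{v, a - b}"] by (simp add: dim_span)
    also have "\<dots> \<le> 2" by (simp add: card_insert_if)
    finally show ?thesis by simp
  qed
  then obtain d where d: "d \<noteq> 0" "\<And>y. y \<in> span {v, a - b} \<Longrightarrow> orthogonal d y"
    using orthogonal_to_subspace_exists[of "{v, a - b}"] by (auto simp: dim_span)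
  then have dv: "v \<bullet> d = 0" "d \<bullet> a = d \<bullet> b"
    using d(2)[of v] d(2)[of "a - b"]
    by (auto simp: orthogonal_def span_base inner_diff_right inner_commute)
  have hull: "d \<bullet> x = d \<bullet> a" if "x \<in> convex hull N v" for x
  proof -
    have "convex hull N v \<subseteq> {x. d \<bullet> x = d \<bullet> a}"
      by (rule hull_minimal) (use ab dv in \<open>auto simp: convex_hyperplane\<close>)
    then show ?thesis using that by blast
  qed
  have "\<exists>\<epsilon>>0. - r *\<^sub>R v + \<epsilon> *\<^sub>R e \<in> convex hull N v" if e: "v \<bullet> e = 0" for e
  proof -
    \<comment> \<open>At the point of tangency the constraint of \<open>v\<close> is the only tight
      one.\<close>
    have "r + u \<bullet> (- r *\<^sub>R v) > 0" if "u \<in> V - {v}" for u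
    proof -
      have "u \<bullet> v < 1" using that v norm_V inner_less_1 by blast
      then have "r * (u \<bullet> v) < r * 1" using r_pos by (intro mult_strict_left_mono)
      then show ?thesis by simp
    qed
    then obtain \<epsilon> where \<epsilon>: "\<epsilon> > 0" "\<And>u. u \<in> V - {v} \<Longrightarrow> r + u \<bullet> (- r *\<^sub>R v) + \<epsilon> * (u \<bullet> e) > 0"
      using finite_small_eps[of "V - {v}" "\<lambda>u. r + u \<bullet> (- r *\<^sub>R v)" "\<lambda>u. u \<bullet> e"] finite_V by auto
    have eq: "v \<bullet> (- r *\<^sub>R v + \<epsilon> *\<^sub>R e) = - r" using e inner_V_self[OF v] by (simp add: inner_add_right inner_diff_right)
    have "- r \<le> u \<bullet> (- r *\<^sub>R v + \<epsilon> *\<^sub>R e)" if "u \<in> V" for u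
    proof (cases "u = v")
      case True
      then show ?thesis using eq by simp
    next
      case False
      then show ?thesis using \<epsilon>(2)[of u] that by (simp add: inner_add_right inner_diff_right)
    qed
    then have "- r *\<^sub>R v + \<epsilon> *\<^sub>R e \<in> P" unfolding polar by blast
    then show ?thesis using eq \<epsilon>(1) facet_eq[OF v] by auto
  qed
  from this[of d] this[of "- d"] dv obtain \<epsilon> \<delta> where "\<epsilon> > 0" "\<delta> > 0"
    "- r *\<^sub>R v + \<epsilon> *\<^sub>R d \<in> convex hull N v" "- r *\<^sub>R v + \<delta> *\<^sub>R (- d) \<in> convex hull N v" by auto
  then have "d \<bullet> (\<epsilon> *\<^sub>R d) = d \<bullet> (\<delta> *\<^sub>R (- d))"
    using hull by (metis (no_types, lifting) add_left_cancel inner_add_right)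
  then have "(\<epsilon> + \<delta>) * (d \<bullet> d) = 0" by (simp add: algebra_simps)
  then show False using \<open>\<epsilon> > 0\<close> \<open>\<delta> > 0\<close> d(1) by simp
qed

definition E :: "real^3 \<Rightarrow> real^3 \<Rightarrow> bool" where
  "E u v \<longleftrightarrow> u \<noteq> v \<and> card (N u \<inter> N v) = 2"

text \<open>Within the plane of the facet opposite to \<open>w\<close>, the other vertices are seen from its vertex
  \<open>v\<close> under pairwise different slopes \<open>s\<close>; the two extreme slopes belong to the edges at \<open>v\<close>.\<close>

lemma slopes:
  assumes v: "v \<in> V" and w: "w \<in> N v"
  obtains p t s where "t \<noteq> 0" "w \<bullet> t = 0" "v \<bullet> t = 0" "w \<bullet> p = 0" "p \<bullet> t = 0" "v \<bullet> p = -1"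
    "\<forall>z\<in>N w - {v}. z \<bullet> v < 1 \<and> z - v = (1 - z \<bullet> v) *\<^sub>R (p + s z *\<^sub>R t)"
    "inj_on s (N w - {v})"
proof -
  have wV: "w \<in> V" and wv: "w \<bullet> v = - r" using w by (auto simp: nbrs_def inner_commute)
  define t where "t = cross3 w v"
  have "w \<noteq> v" "w \<noteq> - v" using wv inner_V_self[OF v] r_pos r_less by auto
  then have t: "t \<noteq> 0" using cross3_V_nonzero wV v by (simp add: t_def)
  have wt: "w \<bullet> t = 0" "v \<bullet> t = 0" by (simp_all add: t_def dot_cross_self)
  \<comment> \<open>The projection of \<open>v\<close> to the plane orthogonal to \<open>w\<close>
    is \<open>v + r *\<^sub>R w\<close>. The factor makes \<open>v \<bullet> p = - 1\<close>, so
    that \<open>1 - z \<bullet> v\<close> is the coefficient of \<open>p\<close> in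
    \<open>z - v\<close>.\<close>
  define p where "p = - (1 / (1 - r\<^sup>2)) *\<^sub>R (v + r *\<^sub>R w)"
  have "r\<^sup>2 < 1" using r_pos r_less by (simp add: power_less_one_iff)
  have ww: "w \<bullet> w = 1" "v \<bullet> v = 1" "v \<bullet> w = - r"
    using inner_V_self wV v wv by (auto simp: inner_commute)
  have wp: "w \<bullet> p = 0" using wv ww by (simp add: p_def inner_add_right)
  have vp: "v \<bullet> p = - 1" using ww \<open>r\<^sup>2 < 1\<close>
    by (simp add: p_def inner_add_right power2_eq_square divide_simps)
  have pt: "p \<bullet> t = 0" using wt by (simp add: p_def inner_add_left)
  define s where "s z = (z - v) \<bullet> t / ((1 - z \<bullet> v) * (t \<bullet> t))" for z
  have lt: "z \<bullet> v < 1" if "z \<in> N w - {v}" for z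
    using that inner_less_1[of z v] norm_V v nbrs_subset by blast
  have eq: "z - v = (1 - z \<bullet> v) *\<^sub>R (p + s z *\<^sub>R t)" if z: "z \<in> N w - {v}" for z
  proof -
    let ?d = "z - v - (1 - z \<bullet> v) *\<^sub>R (p + s z *\<^sub>R t)"
    have "w \<bullet> ?d = 0" using z wv wp wt by (simp add: nbrs_def inner_diff_right inner_add_right)
    moreover have "v \<bullet> ?d = 0" using vp wt ww by (simp add: inner_diff_right inner_add_right inner_commute)
    ultimately obtain k where k: "?d = k *\<^sub>R t" using cross3_orthogonal_multiple[of w v ?d] t by (auto simp: t_def)
    have "s z * (1 - z \<bullet> v) * (t \<bullet> t) = (z - v) \<bullet> t" using lt[OF z] t by (simp add: s_def)
    then have "?d \<bullet> t = 0" using pt by (simp add: inner_diff_left inner_add_left algebra_simps)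
    then have "k = 0" using k t by simp
    then show ?thesis using k by simp
  qed
  \<comment> \<open>Equal slopes would put \<open>x\<close> and \<open>y\<close> on one line through
    \<open>v\<close>, which meets the sphere in only one further point.\<close>
  have "inj_on s (N w - {v})"
  proof (rule inj_onI)
    fix x y assume x: "x \<in> N w - {v}" and y: "y \<in> N w - {v}" and s: "s x = s y"
    let ?q = "p + s x *\<^sub>R t"
    have xy: "x = v + (1 - x \<bullet> v) *\<^sub>R ?q" "y = v + (1 - y \<bullet> v) *\<^sub>R ?q"
      using eq[OF x] eq[OF y] s by (simp_all add: algebra_simps)
    moreover have "norm x = norm v" "norm y = norm v" using x y v norm_V nbrs_subset by (metis DiffD1 subsetD)+
    moreover have "1 - x \<bullet> v \<noteq> 0" "1 - y \<bullet> v \<noteq> 0" using lt[OF x] lt[OF y] by auto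
    moreover have "?q \<noteq> 0" using vp wt by (metis add_0_right inner_add_right inner_scaleR_right inner_zero_right mult_zero_right neg_eq_iff_add_eq_0 zero_neq_one add.inverse_neutral add.inverse_inverse)
    ultimately have "1 - x \<bullet> v = 1 - y \<bullet> v" by (metis sphere_line_unique)
    then show "x = y" using xy by metis
  qed
  moreover have "\<forall>z\<in>N w - {v}. z \<bullet> v < 1 \<and> z - v = (1 - z \<bullet> v) *\<^sub>R (p + s z *\<^sub>R t)"
    using lt eq by (intro ballI conjI)
  ultimately show ?thesis using that[of t p s] t wt wp pt vp by simp
qed

text \<open>If no second facet contained both \<open>v\<close> and \<open>x\<close>, the direction
  from \<open>v\<close> to \<open>x\<close> could be turned slightly further within the facet of
  \<open>w\<close> without leaving \<open>P\<close>, although the slope of \<open>x\<close> is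
  already extreme.\<close>

lemma extreme_slope_is_edge:
  assumes v: "v \<in> V" and w: "w \<in> N v"
    and t: "t \<noteq> 0" "w \<bullet> t = 0" "v \<bullet> t = 0" and p: "w \<bullet> p = 0" "p \<bullet> t = 0" "v \<bullet> p = -1"
    and s: "\<And>z. z \<in> N w - {v} \<Longrightarrow> z \<bullet> v < 1 \<and> z - v = (1 - z \<bullet> v) *\<^sub>R (p + s z *\<^sub>R t)"
    and x: "x \<in> N w - {v}" and max: "\<And>z. z \<in> N w - {v} \<Longrightarrow> s z \<le> s x"
  shows "E v x"
proof -
  have wV: "w \<in> V" and wv: "w \<bullet> v = - r" using w by (auto simp: nbrs_def inner_commute)
  have xV: "x \<in> V" "x \<noteq> v" "w \<in> N x" using x wV by (auto simp: nbrs_def inner_commute)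
  define q where "q = p + s x *\<^sub>R t"
  have xq: "x - v = (1 - x \<bullet> v) *\<^sub>R q" "x \<bullet> v < 1" using s[OF x] by (simp_all add: q_def)
  have "\<exists>u\<in>N v - {w}. u \<bullet> x = - r"
  proof (rule ccontr)
    assume no: "\<not> ?thesis"
    have "u \<bullet> q > 0" if u: "u \<in> N v - {w}" for u
    proof -
      have uV: "u \<in> V" and uv: "u \<bullet> v = - r" using u by (auto simp: nbrs_def inner_commute)
      have "u \<bullet> x > - r" using no gram[OF uV xV(1)] u by force
      then have "u \<bullet> (x - v) > 0" using uv by (simp add: inner_diff_right)
      then show ?thesis using xq by (simp add: zero_less_mult_iff)
    qed
    then obtain \<epsilon> where \<epsilon>: "\<epsilon> > 0" "\<And>u. u \<in> N v - {w} \<Longrightarrow> u \<bullet> q + \<epsilon> * (u \<bullet> t) > 0"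
      using finite_small_eps[of "N v - {w}" "\<lambda>u. u \<bullet> q" "\<lambda>u. u \<bullet> t"] finite_N by blast
    define d where "d = q + \<epsilon> *\<^sub>R t"
    have "r + u \<bullet> v > 0" if u: "u \<in> V - N v" for u
      using gram[of u v] u v by (force simp: nbrs_def inner_commute)
    then obtain \<delta> where \<delta>: "\<delta> > 0" "\<And>u. u \<in> V - N v \<Longrightarrow> r + u \<bullet> v + \<delta> * (u \<bullet> d) > 0"
      using finite_small_eps[of "V - N v" "\<lambda>u. r + u \<bullet> v" "\<lambda>u. u \<bullet> d"] finite_V by blast
    have wd: "w \<bullet> d = 0" using t p by (simp add: d_def q_def inner_add_right)
    have "- r \<le> u \<bullet> (v + \<delta> *\<^sub>R d)" if u: "u \<in> V" for u
    proof (cases "u \<in> N v")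
      case True
      then have "u \<bullet> d \<ge> 0" using \<epsilon>(2)[of u] wd by (cases "u = w") (auto simp: d_def inner_add_right)
      moreover have "u \<bullet> v = - r" using True by (simp add: nbrs_def inner_commute)
      ultimately show ?thesis using \<delta>(1) by (simp add: inner_add_right)
    next
      case False
      then show ?thesis using \<delta>(2)[of u] u by (simp add: inner_add_right)
    qed
    then have "v + \<delta> *\<^sub>R d \<in> P" unfolding polar by blast
    moreover have "w \<bullet> (v + \<delta> *\<^sub>R d) = - r" using wd wv by (simp add: inner_add_right)
    ultimately have inF: "v + \<delta> *\<^sub>R d \<in> convex hull N w" using facet_eq[OF wV] by blast
    \<comment> \<open>For \<open>z\<close> other than \<open>v\<close>,
      \<open>c \<bullet> (z - v)\<close> has the sign of \<open>s z - s x\<close>. On the facet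
      \<open>c\<close> is thus largest at \<open>v\<close>, yet it increases along
      \<open>d\<close>.\<close>
    define c where "c = t + ((t \<bullet> t) * s x) *\<^sub>R v"
    have tv: "t \<bullet> v = 0" "t \<bullet> p = 0" using t p by (auto simp: inner_commute)
    have "c \<bullet> z \<le> c \<bullet> v" if z: "z \<in> N w" for z
    proof (cases "z = v")
      case False
      then have z': "z \<in> N w - {v}" using z by blast
      have "c \<bullet> (p + s z *\<^sub>R t) = (t \<bullet> t) * (s z - s x)"
        using tv p t by (simp add: c_def inner_add_right inner_add_left algebra_simps)
      then have "c \<bullet> (z - v) = (1 - z \<bullet> v) * ((t \<bullet> t) * (s z - s x))"
        using s[OF z'] by (metis inner_scaleR_right)
      moreover have "\<dots> \<le> 0"
        using s[OF z'] max[OF z'] by (intro mult_nonneg_nonpos) auto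
      ultimately show ?thesis by (simp add: inner_diff_right)
    qed simp
    then have "convex hull N w \<subseteq> {z. c \<bullet> z \<le> c \<bullet> v}"
      by (intro hull_minimal convex_halfspace_le) auto
    then have "c \<bullet> (\<delta> *\<^sub>R d) \<le> 0" using inF by (auto simp: inner_add_right)
    moreover have "c \<bullet> d = \<epsilon> * (t \<bullet> t)"
      using tv p t by (simp add: c_def d_def q_def inner_add_right inner_add_left algebra_simps)
    ultimately have "\<delta> * (\<epsilon> * (t \<bullet> t)) \<le> 0" by simp
    moreover have "\<delta> * (\<epsilon> * (t \<bullet> t)) > 0" using \<delta>(1) \<epsilon>(1) t(1) by simp
    ultimately show False by simp
  qed
  then obtain u where u: "u \<in> N v" "u \<noteq> w" "u \<bullet> x = - r" by blast
  then have "{u, w} \<subseteq> N v \<inter> N x" using w xV by (auto simp: nbrs_def inner_commute)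
  then have "card {u, w} \<le> card (N v \<inter> N x)" using finite_N by (intro card_mono) auto
  then have "card (N v \<inter> N x) = 2" using codegree_le_2[OF v xV(1)] xV(2) u(2) by auto
  then show ?thesis using xV(2) by (simp add: E_def)
qed

text \<open>The vertices of greatest and least slope give the edges. Conversely, an edge to
  \<open>z\<close> lies on a second facet plane, that of some \<open>u\<close>, which has all of
  \<open>N w\<close> on one side; this forces the slope of \<open>z\<close> to be extreme. The cone
  description holds because every slope is a convex combination of the extreme ones.\<close>

lemma two_edges:
  assumes v: "v \<in> V" and w: "w \<in> N v"
  obtains x y where "x \<noteq> y" "{z \<in> N w. E v z} = {x, y}"
    "\<forall>z\<in>N w. \<exists>\<alpha>\<ge>0. \<exists>\<beta>\<ge>0. z - v = \<alpha> *\<^sub>R (x - v) + \<beta> *\<^sub>R (y - v)"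
proof -
  have wV: "w \<in> V" and wv: "w \<bullet> v = - r" using w by (auto simp: nbrs_def inner_commute)
  have vN: "v \<in> N w" using nbrs_sym v w by blast
  obtain p t s where t: "t \<noteq> 0" "w \<bullet> t = 0" "v \<bullet> t = 0" and p: "w \<bullet> p = 0" "p \<bullet> t = 0" "v \<bullet> p = -1"
    and s': "\<forall>z\<in>N w - {v}. z \<bullet> v < 1 \<and> z - v = (1 - z \<bullet> v) *\<^sub>R (p + s z *\<^sub>R t)"
    and inj: "inj_on s (N w - {v})"
    by (rule slopes[OF v w]) (rule that)
  note s = bspec[OF s']
  let ?A = "N w - {v}"
  have "card ?A \<ge> 2" using card_nbrs_ge_3[OF wV] vN finite_N by simp
  then have ne: "finite ?A" "?A \<noteq> {}" using finite_N by (simp, metis card.empty not_numeral_le_zero)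
  obtain x where x: "x \<in> ?A" "\<And>z. z \<in> ?A \<Longrightarrow> s z \<le> s x"
    using finite_obtain_maximizer[OF ne, of s] by blast
  obtain y where y: "y \<in> ?A" "\<And>z. z \<in> ?A \<Longrightarrow> - s z \<le> - s y"
    using finite_obtain_maximizer[OF ne, of "\<lambda>z. - s z"] by blast
  have "x \<noteq> y"
  proof
    assume "x = y"
    then have "s z = s x" if "z \<in> ?A" for z using x(2)[OF that] y(2)[OF that] by simp
    then have "?A \<subseteq> {x}" using inj x(1) unfolding inj_on_def by blast
    then have "card ?A \<le> 1" using card_mono[of "{x}" ?A] by simp
    then show False using \<open>card ?A \<ge> 2\<close> by simp
  qed
  have Ex: "E v x" by (rule extreme_slope_is_edge[OF v w t p s x])
  have Ey: "E v y"
  proof (rule extreme_slope_is_edge[OF v w, of "- t" p "\<lambda>z. - s z"])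
    show "z \<bullet> v < 1 \<and> z - v = (1 - z \<bullet> v) *\<^sub>R (p + - s z *\<^sub>R - t)" if "z \<in> ?A" for z
      using s[OF that] by simp
  qed (use t p y in auto)
  have "z = x \<or> z = y" if z: "z \<in> N w" "E v z" for z
  proof -
    have zA: "z \<in> ?A" using z by (auto simp: E_def)
    have zV: "z \<in> V" using z nbrs_subset by blast
    have "w \<in> N v \<inter> N z" using w z wV by (auto simp: nbrs_def inner_commute)
    moreover have "card (N v \<inter> N z) = 2" using z by (simp add: E_def)
    ultimately obtain u where u: "u \<in> N v \<inter> N z" "u \<noteq> w"
      by (metis card_2_iff insertCI insertE)
    have uV: "u \<in> V" using u nbrs_subset by blast
    have uv: "u \<bullet> v = - r" "u \<bullet> z = - r" using u by (auto simp: nbrs_def inner_commute)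
    \<comment> \<open>\<open>u\<close> vanishes along the direction of slope \<open>s z\<close>, so
      its value along another slope is proportional to the difference of the slopes.\<close>
    have val: "u \<bullet> (y' - v) = (1 - y' \<bullet> v) * ((s y' - s z) * (u \<bullet> t))" if y': "y' \<in> ?A" for y'
    proof -
      have "(1 - z \<bullet> v) * (u \<bullet> (p + s z *\<^sub>R t)) = 0"
        using s[OF zA] uv by (metis inner_diff_right inner_scaleR_right right_minus_eq)
      then have "u \<bullet> p + s z * (u \<bullet> t) = 0" using s[OF zA] by (simp add: inner_add_right)
      then have "u \<bullet> (p + s y' *\<^sub>R t) = (s y' - s z) * (u \<bullet> t)" by (simp add: inner_add_right algebra_simps)
      then show ?thesis using s[OF y'] by (metis inner_scaleR_right)
    qed
    have sgn: "(s y' - s z) * (u \<bullet> t) \<ge> 0" if y': "y' \<in> ?A" for y'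
    proof -
      have "y' \<in> V" using y' nbrs_subset by blast
      then have "u \<bullet> (y' - v) \<ge> 0" using gram[OF uV, of y'] uv by (simp add: inner_diff_right)
      then show ?thesis using val[OF y'] s[OF y'] by (simp add: zero_le_mult_iff)
    qed
    \<comment> \<open>Otherwise \<open>u\<close> would be adjacent to all of \<open>N w\<close>, and
      \<open>u\<close> and \<open>w\<close> would have three common neighbours.\<close>
    have "u \<bullet> t \<noteq> 0"
    proof
      assume 0: "u \<bullet> t = 0"
      have "N w \<subseteq> N u"
      proof
        fix y' assume y': "y' \<in> N w"
        then have "u \<bullet> (y' - v) = 0" using val[of y'] 0 by (cases "y' = v") auto
        then show "y' \<in> N u" using uv y' by (simp add: nbrs_def inner_diff_right)
      qed
      then have "N w \<inter> N u = N w" by blast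
      then show False using codegree_le_2[OF wV uV] card_nbrs_ge_3[OF wV] u(2) by auto
    qed
    then consider "u \<bullet> t > 0" | "u \<bullet> t < 0" by linarith
    then show ?thesis
    proof cases
      case 1
      then have "s z \<le> s y" using sgn[OF y(1)] by (simp add: zero_le_mult_iff)
      then have "s z = s y" using y(2)[OF zA] by simp
      then show ?thesis using inj zA y(1) by (meson inj_onD)
    next
      case 2
      then have "s x \<le> s z" using sgn[OF x(1)] by (simp add: zero_le_mult_iff)
      then have "s z = s x" using x(2)[OF zA] by simp
      then show ?thesis using inj zA x(1) by (meson inj_onD)
    qed
  qed
  then have set: "{z \<in> N w. E v z} = {x, y}" using Ex Ey x(1) y(1) by blast
  have "\<exists>\<alpha>\<ge>0. \<exists>\<beta>\<ge>0. z - v = \<alpha> *\<^sub>R (x - v) + \<beta> *\<^sub>R (y - v)" if z: "z \<in> N w" for z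
  proof (cases "z = v")
    case True
    then show ?thesis by (intro exI[of _ 0]) auto
  next
    case False
    then have zA: "z \<in> ?A" using z by blast
    have xy: "s y < s x" using x(2)[OF y(1)] inj x(1) y(1) \<open>x \<noteq> y\<close> by (metis inj_onD order_le_less)
    define \<mu> where "\<mu> = (s z - s y) / (s x - s y)"
    have \<mu>: "0 \<le> \<mu>" "\<mu> \<le> 1" using xy x(2)[OF zA] y(2)[OF zA] by (auto simp: \<mu>_def divide_simps)
    have "\<mu> * (s x - s y) = s z - s y" using xy by (simp add: \<mu>_def)
    then have sz: "s z = \<mu> * s x + (1 - \<mu>) * s y" by (simp add: algebra_simps)
    have xv: "p + s x *\<^sub>R t = (1 / (1 - x \<bullet> v)) *\<^sub>R (x - v)" "p + s y *\<^sub>R t = (1 / (1 - y \<bullet> v)) *\<^sub>R (y - v)"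
      using s[OF x(1)] s[OF y(1)] by simp_all
    have "p + s z *\<^sub>R t = \<mu> *\<^sub>R (p + s x *\<^sub>R t) + (1 - \<mu>) *\<^sub>R (p + s y *\<^sub>R t)"
      by (simp add: sz algebra_simps)
    then have "z - v = ((1 - z \<bullet> v) * (\<mu> * (1 / (1 - x \<bullet> v)))) *\<^sub>R (x - v)
        + ((1 - z \<bullet> v) * ((1 - \<mu>) * (1 / (1 - y \<bullet> v)))) *\<^sub>R (y - v)"
      using s[OF zA] unfolding xv by (simp add: scaleR_add_right)
    moreover have "(1 - z \<bullet> v) * (\<mu> * (1 / (1 - x \<bullet> v))) \<ge> 0" "(1 - z \<bullet> v) * ((1 - \<mu>) * (1 / (1 - y \<bullet> v))) \<ge> 0"
      using \<mu> s[OF zA] s[OF x(1)] s[OF y(1)] by (auto intro!: mult_nonneg_nonneg)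
    ultimately show ?thesis by blast
  qed
  then show ?thesis by (intro that[OF \<open>x \<noteq> y\<close> set] ballI)
qed

text \<open>For a vertex \<open>y\<close> of the facet outside \<open>C\<close>, let
  \<open>v\<close> maximize \<open>y \<bullet> _\<close> on \<open>C\<close>. Both edges at
  \<open>v\<close> stay in \<open>C\<close>, so the functional exceeds its value at \<open>v\<close>
  nowhere on the facet; but at the unit vector \<open>y\<close> itself it is larger.\<close>

lemma facet_connected:
  assumes w: "w \<in> V" and C: "C \<subseteq> N w" "C \<noteq> {}"
    and closed: "\<And>v z. v \<in> C \<Longrightarrow> z \<in> N w \<Longrightarrow> E v z \<Longrightarrow> z \<in> C"
  shows "C = N w"
proof (rule ccontr)
  assume "C \<noteq> N w"
  then obtain y where y: "y \<in> N w" "y \<notin> C" using C by blast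
  have "finite C" using C(1) finite_N finite_subset by blast
  then obtain v where v: "v \<in> C" "\<And>u. u \<in> C \<Longrightarrow> y \<bullet> u \<le> y \<bullet> v"
    using finite_obtain_maximizer[of C "\<lambda>u. y \<bullet> u"] C(2) by blast
  have vV: "v \<in> V" "w \<in> N v" using v(1) C(1) w by (auto simp: nbrs_def inner_commute)
  obtain a b where ab: "{z \<in> N w. E v z} = {a, b}"
    "\<forall>z\<in>N w. \<exists>\<alpha>\<ge>0. \<exists>\<beta>\<ge>0. z - v = \<alpha> *\<^sub>R (a - v) + \<beta> *\<^sub>R (b - v)"
    by (rule two_edges[OF vV]) (rule that)
  have "a \<in> C" "b \<in> C" using closed[OF v(1)] ab(1) by blast+
  then have "y \<bullet> (a - v) \<le> 0" "y \<bullet> (b - v) \<le> 0" using v(2) by (auto simp: inner_diff_right)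
  moreover obtain \<alpha> \<beta> where "\<alpha> \<ge> 0" "\<beta> \<ge> 0" "y - v = \<alpha> *\<^sub>R (a - v) + \<beta> *\<^sub>R (b - v)"
    using bspec[OF ab(2) y(1)] by blast
  ultimately have "y \<bullet> (y - v) \<le> 0"
    by (simp add: inner_add_right add_nonpos_nonpos mult_nonneg_nonpos)
  moreover have "y \<bullet> v < 1" "y \<bullet> y = 1"
    using inner_less_1[of y v] norm_V inner_V_self y v(1) vV(1) nbrs_subset by blast+
  ultimately show False by (simp add: inner_diff_right)
qed

text \<open>The second facet through the edge from \<open>v\<close> to \<open>a\<close>, that of
  \<open>u\<close>, cannot contain the end \<open>b\<close> of the other edge, because
  \<open>w\<close> and \<open>u\<close> would then share \<open>v\<close>, \<open>a\<close> and
  \<open>b\<close>.\<close>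

lemma flag_edges_two_edges:
  assumes v: "v \<in> V" and w: "w \<in> N v"
  shows "\<exists>x y. flag_edges r V v w x y \<and> E v x \<and> E v y"
proof -
  obtain x y where xy: "x \<noteq> y" "{z \<in> N w. E v z} = {x, y}"
    by (rule two_edges[OF v w]) (rule that)
  have wV: "w \<in> V" using w nbrs_subset by blast
  have vN: "v \<in> N w" using nbrs_sym v w by blast
  have aux: "\<exists>p\<in>N v. p \<in> N a \<and> p \<notin> N b" if a: "a \<in> N w" "E v a" and b: "b \<in> N w" "E v b" and "a \<noteq> b" for a b
  proof -
    have "w \<in> N v \<inter> N a" using w a wV by (auto simp: nbrs_def inner_commute)
    moreover have "card (N v \<inter> N a) = 2" using a by (simp add: E_def)
    ultimately obtain u where u: "u \<in> N v \<inter> N a" "u \<noteq> w"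
      by (metis card_2_iff insertCI insertE)
    have uV: "u \<in> V" using u nbrs_subset by blast
    have abV: "a \<in> V" "b \<in> V" using a b nbrs_subset by blast+
    have "u \<notin> N b"
    proof
      assume "u \<in> N b"
      then have "{v, a, b} \<subseteq> N w \<inter> N u"
        using u vN a b v abV uV by (auto simp: nbrs_def inner_commute)
      then have "card {v, a, b} \<le> card (N w \<inter> N u)" using finite_N by (intro card_mono) auto
      moreover have "card {v, a, b} = 3" using a b \<open>a \<noteq> b\<close> by (auto simp: E_def card_insert_if)
      ultimately show False using codegree_le_2[OF wV uV] u(2) by auto
    qed
    then show ?thesis using u by blast
  qed
  have "x \<in> N w" "E v x" "y \<in> N w" "E v y" using xy(2) by blast+
  then show ?thesis using aux[of x y] aux[of y x] xy(1) unfolding flag_edges_def by metis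
qed

text \<open>As in \<open>facet_connected\<close>, the functional is the inner product with a missing
  vertex; \<open>local_max_imp_global_max\<close> takes the place of the two-dimensional
  cone.\<close>

lemma edges_connected:
  assumes C: "C \<subseteq> V" "C \<noteq> {}"
    and closed: "\<And>v z. v \<in> C \<Longrightarrow> z \<in> V \<Longrightarrow> E v z \<Longrightarrow> z \<in> C"
  shows "C = V"
proof (rule ccontr)
  assume "C \<noteq> V"
  then obtain y where y: "y \<in> V" "y \<notin> C" using C by blast
  have "finite C" using C(1) finite_V finite_subset by blast
  then obtain v where v: "v \<in> C" "\<And>u. u \<in> C \<Longrightarrow> y \<bullet> u \<le> y \<bullet> v"
    using finite_obtain_maximizer[of C "\<lambda>u. y \<bullet> u"] C(2) by blast
  have vV: "v \<in> V" using v(1) C(1) by blast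
  have "y \<bullet> y \<le> y \<bullet> v"
  proof (rule local_max_imp_global_max[OF finite_V gram vV])
    show "N v \<noteq> {}" using card_nbrs_ge_3[OF vV] by auto
    fix w assume "w \<in> N v"
    then obtain a b where ab: "flag_edges r V v w a b" "E v a" "E v b"
      using flag_edges_two_edges[OF vV] by blast
    then have "a \<in> V" "b \<in> V" by (auto simp: flag_edges_def nbrs_def)
    then show "\<exists>a b. flag_edges r V v w a b \<and> y \<bullet> a \<le> y \<bullet> v \<and> y \<bullet> b \<le> y \<bullet> v"
      using ab v closed by blast
  qed (use gram y in auto)
  moreover have "y \<bullet> v < 1" "y \<bullet> y = 1"
    using inner_less_1[of y v] norm_V inner_V_self y v(1) vV by blast+
  ultimately show False by simp
qed

end

section \<open>Search over adjacency matrices\<close>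

text \<open>In a longest path both neighbours of the first vertex lie on the path. The one that is
  not its successor must be the last vertex, since inner vertices have both their neighbours beside
  them on the path. The resulting cycle is closed under \<open>R\<close>, so it exhausts
  \<open>A\<close>.\<close>

lemma two_regular_connected_cycle:
  assumes fin: "finite A" and ne: "A \<noteq> {}"
    and sym: "\<And>x y. x \<in> A \<Longrightarrow> y \<in> A \<Longrightarrow> R x y \<Longrightarrow> R y x" and irr: "\<And>x. \<not> R x x"
    and two: "\<And>x. x \<in> A \<Longrightarrow> card {y \<in> A. R x y} = 2"
    and conn: "\<And>C. C \<subseteq> A \<Longrightarrow> C \<noteq> {} \<Longrightarrow> (\<And>x y. x \<in> C \<Longrightarrow> y \<in> A \<Longrightarrow> R x y \<Longrightarrow> y \<in> C) \<Longrightarrow> C = A"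
  shows "\<exists>xs. distinct xs \<and> set xs = A \<and> 3 \<le> length xs \<and>
    (\<forall>i j. i < j \<longrightarrow> j < length xs \<longrightarrow> R (xs ! i) (xs ! j) = (j = Suc i \<or> i = 0 \<and> Suc j = length xs))"
proof -
  define path where "path xs \<longleftrightarrow> distinct xs \<and> set xs \<subseteq> A \<and> xs \<noteq> [] \<and>
    (\<forall>i. Suc i < length xs \<longrightarrow> R (xs ! i) (xs ! Suc i))" for xs
  obtain a where "a \<in> A" using ne by blast
  then have "path [a]" by (simp add: path_def)
  moreover have "length xs \<le> card A" if "path xs" for xs
    using that fin by (metis card_mono distinct_card path_def)
  ultimately obtain xs where xs: "path xs" and max: "\<And>ys. path ys \<Longrightarrow> length ys \<le> length xs"
    using ex_has_greatest_nat[of path "[a]" length "Suc (card A)"] by (metis less_Suc_eq_le)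
  have dist: "distinct xs" and sub: "set xs \<subseteq> A" and nonempty: "xs \<noteq> []"
    and step: "\<And>i. Suc i < length xs \<Longrightarrow> R (xs ! i) (xs ! Suc i)" using xs by (auto simp: path_def)
  define m where "m = length xs"
  have inA: "xs ! i \<in> A" if "i < m" for i using that sub by (auto simp: m_def)
  have inj: "xs ! i = xs ! j \<longleftrightarrow> i = j" if "i < m" "j < m" for i j
    using nth_eq_iff_index_eq[OF dist] that by (simp add: m_def)
  have nb: "{y \<in> A. R x y} = {y, z}" if "x \<in> A" "y \<in> A" "z \<in> A" "R x y" "R x z" "y \<noteq> z" for x y z
  proof -
    have "finite {y \<in> A. R x y}" using fin by simp
    moreover have "{y, z} \<subseteq> {y \<in> A. R x y}" using that by blast
    ultimately show ?thesis using two[OF that(1)] that(6) card_subset_eq[of "{y \<in> A. R x y}" "{y, z}"] by simp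
  qed
  have m0: "0 < m" using nonempty by (simp add: m_def)
  have first: "y \<in> set xs" if y: "y \<in> A" "R (xs ! 0) y" for y
  proof (rule ccontr)
    assume "y \<notin> set xs"
    moreover have "R ((y # xs) ! i) ((y # xs) ! Suc i)" if "Suc i < length (y # xs)" for i
      using that sym[OF inA[OF m0] y] step by (cases i) auto
    ultimately have "path (y # xs)" using y dist sub by (simp add: path_def)
    then show False using max by fastforce
  qed
  obtain y z where yz: "{u \<in> A. R (xs ! 0) u} = {y, z}" "y \<noteq> z"
    using two[OF inA[OF m0]] by (auto simp: card_2_iff)
  have m3: "3 \<le> m"
  proof -
    have "y \<in> A" "R (xs ! 0) y" "z \<in> A" "R (xs ! 0) z" using yz(1) by auto
    then have "{xs ! 0, y, z} \<subseteq> set xs" using first nonempty by simp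
    then have "card {xs ! 0, y, z} \<le> card (set xs)" by (intro card_mono) auto
    moreover have "xs ! 0 \<noteq> y" "xs ! 0 \<noteq> z" using yz(1) irr[of "xs ! 0"] by auto
    then have "card {xs ! 0, y, z} = 3" using yz(2) by simp
    ultimately show ?thesis using distinct_card[OF dist] by (simp add: m_def)
  qed
  have inner: "{u \<in> A. R (xs ! i) u} = {xs ! (i - 1), xs ! Suc i}" if "0 < i" "Suc i < m" for i
  proof (rule nb)
    show "R (xs ! i) (xs ! (i - 1))" 
    proof (rule sym)
      show "R (xs ! (i - 1)) (xs ! i)" using step[of "i - 1"] that by (simp add: m_def)
    qed (use that inA in auto)
    show "R (xs ! i) (xs ! Suc i)" using step[of i] that by (simp add: m_def)
    show "xs ! (i - 1) \<noteq> xs ! Suc i" using inj that by simp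
  qed (use that inA in auto)
  have R01: "R (xs ! 0) (xs ! 1)" using step[of 0] m3 by (simp add: m_def)
  have "\<exists>u\<in>A. R (xs ! 0) u \<and> u \<noteq> xs ! 1" using yz by blast
  then obtain u where u: "u \<in> A" "R (xs ! 0) u" "u \<noteq> xs ! 1" by blast
  obtain i where i: "i < m" "u = xs ! i" using first[OF u(1,2)] by (auto simp: in_set_conv_nth m_def)
  have "i \<noteq> 0" "i \<noteq> 1" using u i irr by (metis, metis)
  have "Suc i = m"
  proof (rule ccontr)
    assume "Suc i \<noteq> m"
    then have "{u \<in> A. R (xs ! i) u} = {xs ! (i - 1), xs ! Suc i}" using inner[of i] i \<open>i \<noteq> 0\<close> by simp
    moreover have "xs ! 0 \<in> {u \<in> A. R (xs ! i) u}" using sym[OF inA[OF m0] u(1,2)] i inA[OF m0] by simp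
    ultimately have "xs ! 0 \<in> {xs ! (i - 1), xs ! Suc i}" by (simp only:)
    then have "xs ! 0 = xs ! (i - 1) \<or> xs ! 0 = xs ! Suc i" by simp
    moreover have "i - 1 < m" "Suc i < m" "0 \<noteq> i - 1" "0 \<noteq> Suc i"
      using i \<open>Suc i \<noteq> m\<close> \<open>i \<noteq> 0\<close> \<open>i \<noteq> 1\<close> by linarith+
    ultimately show False using inj m0 by metis
  qed
  then have i': "i = m - 1" by simp
  then have R0: "R (xs ! 0) (xs ! (m - 1))" using u i by simp
  have zero: "{u \<in> A. R (xs ! 0) u} = {xs ! 1, xs ! (m - 1)}"
    by (rule nb) (use R01 R0 inA m3 inj in auto)
  have last: "{u \<in> A. R (xs ! (m - 1)) u} = {xs ! (m - 2), xs ! 0}"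
  proof (rule nb)
    show "R (xs ! (m - 1)) (xs ! 0)" by (rule sym[OF _ _ R0]) (use inA m3 in auto)
    have "R (xs ! (m - 2)) (xs ! (m - 1))"
      using step[of "m - 2"] m3 by (simp add: m_def Suc_diff_Suc numeral_2_eq_2)
    then show "R (xs ! (m - 1)) (xs ! (m - 2))" by (rule sym[rotated 2]) (use inA m3 in auto)
  qed (use inA m3 inj in auto)
  have nbrs_in: "y \<in> set xs" if "x \<in> set xs" "y \<in> A" "R x y" for x y
  proof -
    obtain j where j: "j < m" "x = xs ! j" using \<open>x \<in> set xs\<close> by (auto simp: in_set_conv_nth m_def)
    have "y \<in> {u \<in> A. R (xs ! j) u}" using that j by simp
    moreover have "j = 0 \<or> j = m - 1 \<or> 0 < j \<and> Suc j < m" using j by linarith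
    ultimately have "y \<in> {xs ! 1, xs ! (m - 1), xs ! (m - 2), xs ! 0} \<or> Suc j < m \<and> y \<in> {xs ! (j - 1), xs ! Suc j}"
      using zero last inner[of j] by auto
    moreover have "xs ! k \<in> set xs" if "k < m" for k using that by (simp add: m_def)
    ultimately show ?thesis using j m3 by auto
  qed
  have "set xs = A"
    by (rule conn) (use sub nonempty nbrs_in in auto)
  moreover have "R (xs ! j) (xs ! k) = (k = Suc j \<or> j = 0 \<and> Suc k = m)" if jk: "j < k" "k < m" for j k
  proof -
    have "R (xs ! j) (xs ! k) \<longleftrightarrow> xs ! k \<in> {u \<in> A. R (xs ! j) u}" using inA[OF jk(2)] by simp
    also have "\<dots> \<longleftrightarrow> k = Suc j \<or> j = 0 \<and> Suc k = m"
    proof (cases "j = 0")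
      case True
      then have "xs ! k \<in> {u \<in> A. R (xs ! j) u} \<longleftrightarrow> xs ! k \<in> {xs ! 1, xs ! (m - 1)}"
        using zero by (simp only:)
      also have "\<dots> \<longleftrightarrow> k = 1 \<or> k = m - 1" using inj[of k 1] inj[of k "m - 1"] jk m3 by simp
      finally show ?thesis using True jk by auto
    next
      case False
      then have "xs ! k \<in> {u \<in> A. R (xs ! j) u} \<longleftrightarrow> xs ! k \<in> {xs ! (j - 1), xs ! Suc j}"
        using inner[of j] jk by simp
      also have "\<dots> \<longleftrightarrow> k = j - 1 \<or> k = Suc j" using inj[of k "j - 1"] inj[of k "Suc j"] jk by simp
      finally show ?thesis using False jk by auto
    qed
    finally show ?thesis .
  qed
  ultimately show ?thesis using dist m3 unfolding m_def by blast
qed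

section \<open>Adjacency matrices and the tests that prune the search\<close>

definition adj_matrix :: "('a \<Rightarrow> 'a \<Rightarrow> bool) \<Rightarrow> 'a list \<Rightarrow> bool list list" where
  "adj_matrix R xs = map (\<lambda>x. map (R x) xs) xs"

lemma adj_matrix_nth [simp]:
  "length (adj_matrix R xs) = length xs"
  "i < length xs \<Longrightarrow> adj_matrix R xs ! i = map (R (xs ! i)) xs"
  by (simp_all add: adj_matrix_def)

fun codeg :: "bool list \<Rightarrow> bool list \<Rightarrow> nat" where
  "codeg (a # x) (b # y) = (if a \<and> b then Suc (codeg x y) else codeg x y)"
| "codeg _ _ = 0"

lemma codeg_map:
  "distinct xs \<Longrightarrow> codeg (map f xs) (map g xs) = card {x \<in> set xs. f x \<and> g x}"
proof (induction xs)
  case (Cons a xs)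
  have "{x \<in> set (a # xs). f x \<and> g x} =
      (if f a \<and> g a then insert a {x \<in> set xs. f x \<and> g x} else {x \<in> set xs. f x \<and> g x})" by auto
  then show ?case using Cons by (auto simp: card_insert_if)
qed simp

primrec bool_lists :: "nat \<Rightarrow> bool list list" where
  "bool_lists 0 = [[]]"
| "bool_lists (Suc n) = map (Cons True) (bool_lists n) @ map (Cons False) (bool_lists n)"

lemma in_bool_lists: "length xs = n \<Longrightarrow> xs \<in> set (bool_lists n)"
proof (induction n arbitrary: xs)
  case (Suc n)
  then obtain b ys where "xs = b # ys" "length ys = n" by (metis length_Suc_conv)
  then show ?case using Suc.IH[of ys] by (cases b) auto
qed simp

text \<open>The rows \<open>1, \<dots>, d\<close> belong to the neighbours of the first vertex, in cyclic order.\<close>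

primrec compatible :: "nat \<Rightarrow> nat \<Rightarrow> nat \<Rightarrow> bool list list \<Rightarrow> bool list \<Rightarrow> bool" where
  "compatible d i j [] r = True"
| "compatible d i j (s # R) r =
     (let c = codeg s r in
      if c \<le> 2 \<and> (1 \<le> j \<and> i \<le> d \<longrightarrow> (c = 2) = (i = Suc j \<or> j = 1 \<and> i = d))
      then compatible d i (Suc j) R r else False)"

lemma compatibleI:
  assumes "\<And>k. k < length R \<Longrightarrow> codeg (R ! k) r \<le> 2"
    and "\<And>k. k < length R \<Longrightarrow> 1 \<le> j + k \<Longrightarrow> i \<le> d \<Longrightarrow>
      (codeg (R ! k) r = 2) = (i = Suc (j + k) \<or> j + k = 1 \<and> i = d)"
  shows "compatible d i j R r"
  using assms
proof (induction R arbitrary: j)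
  case (Cons s R)
  have "compatible d i (Suc j) R r"
    by (rule Cons.IH) (use Cons.prems[of "Suc _"] in auto)
  then show ?case using Cons.prems[of 0] by (auto simp: Let_def)
qed simp

text \<open>Degrees are bounded below by \<open>card_nbrs_ge_3\<close> and above by the degree
  \<open>d\<close> of the starting vertex, which is maximal.\<close>

definition row_ok :: "nat \<Rightarrow> bool list list \<Rightarrow> bool list \<Rightarrow> bool" where
  "row_ok d R r = (let c = codeg r r in
     if 3 \<le> c \<and> c \<le> d then compatible d (length R) 0 R r else False)"

text \<open>The matrix form of the count in \<open>two_edges\<close>. It involves codegrees of
  arbitrary rows and is therefore tested on complete matrices only.\<close>

definition two_edges_matrix :: "bool list list \<Rightarrow> bool" where
  "two_edges_matrix M = list_all (\<lambda>v. list_all (\<lambda>w. if M ! v ! w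
     then length (filter (\<lambda>x. x \<noteq> v \<and> M ! w ! x \<and> codeg (M ! v) (M ! x) = 2) [0..<length M]) = 2
     else True) [0..<length M]) [0..<length M]"

text \<open>The first vertex and its neighbours in the edge graph are not a proper connected component.\<close>

definition star_not_component :: "bool list list \<Rightarrow> bool" where
  "star_not_component M =
     (let S = (\<lambda>x. x = 0 \<or> codeg (M ! 0) (M ! x) = 2) in
      list_all S [0..<length M] \<or>
      list_ex (\<lambda>x. S x \<and> list_ex (\<lambda>y. \<not> S y \<and> codeg (M ! x) (M ! y) = 2) [0..<length M]) [0..<length M])"

definition permute :: "nat list \<Rightarrow> bool list list \<Rightarrow> bool list list" where
  "permute p M = map (\<lambda>i. map (\<lambda>j. M ! i ! j) p) p"

text \<open>The permutations in \<open>ps\<close> are certificates of isomorphism with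
  \<open>T\<close>. With \<open>ps = []\<close>, a successful search means that no matrix passes the
  two tests.\<close>

definition accepted :: "nat list list \<Rightarrow> bool list list \<Rightarrow> bool list list \<Rightarrow> bool" where
  "accepted ps T M \<longleftrightarrow>
     (if two_edges_matrix M \<and> star_not_component M then list_ex (\<lambda>p. length p = length M \<and> distinct p \<and>
       list_all (\<lambda>i. i < length M) p \<and> permute p M = T) ps else True)"

text \<open>With \<open>Suc k\<close> rows missing, symmetry and the empty diagonal prescribe the
  new row up to its last \<open>k\<close> entries, so only these are enumerated.\<close>

primrec search :: "nat list list \<Rightarrow> bool list list \<Rightarrow> nat \<Rightarrow> nat \<Rightarrow> bool list list \<Rightarrow> bool" where
  "search ps T d 0 R = accepted ps T R"
| "search ps T d (Suc k) R = list_all (\<lambda>t. let r = map (\<lambda>s. s ! length R) R @ False # t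
      in if row_ok d R r then search ps T d k (R @ [r]) else True) (bool_lists k)"

text \<open>The rows of \<open>M\<close> form one branch of the search: by \<open>sym\<close> and
  \<open>irr\<close> each of them is among the candidates, and \<open>ok\<close> keeps the branch
  alive.\<close>

lemma search_imp_accepted:
  assumes len: "\<And>i. i < length M \<Longrightarrow> length (M ! i) = length M"
    and sym: "\<And>i j. i < length M \<Longrightarrow> j < length M \<Longrightarrow> M ! i ! j = M ! j ! i"
    and irr: "\<And>i. i < length M \<Longrightarrow> \<not> M ! i ! i"
    and ok: "\<And>i. 1 \<le> i \<Longrightarrow> i < length M \<Longrightarrow> row_ok d (take i M) (M ! i)"
  shows "1 \<le> i \<Longrightarrow> i + k = length M \<Longrightarrow> search ps T d k (take i M) \<Longrightarrow> accepted ps T M"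
proof (induction k arbitrary: i)
  case (Suc k)
  let ?t = "drop (Suc i) (M ! i)"
  have i: "i < length M" using Suc.prems by simp
  have "?t \<in> set (bool_lists k)" by (rule in_bool_lists) (use len[OF i] Suc.prems in simp)
  moreover have "map (\<lambda>s. s ! length (take i M)) (take i M) @ False # ?t = M ! i"
  proof (rule nth_equalityI)
    show "length (map (\<lambda>s. s ! length (take i M)) (take i M) @ False # ?t) = length (M ! i)"
      using i len by simp
    fix j assume "j < length (map (\<lambda>s. s ! length (take i M)) (take i M) @ False # ?t)"
    then have "j < length M" using i len by simp
    then show "(map (\<lambda>s. s ! length (take i M)) (take i M) @ False # ?t) ! j = M ! i ! j"
      using i sym[of i j] irr[of i] len by (auto simp: nth_append nth_Cons' min_def)
  qed
  moreover have "take i M @ [M ! i] = take (Suc i) M" using i by (simp add: take_Suc_conv_app_nth)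
  ultimately have "search ps T d k (take (Suc i) M)"
    using Suc.prems(3) ok[OF Suc.prems(1) i] by (auto simp: list_all_iff Let_def)
  then show ?case using Suc.IH[of "Suc i"] Suc.prems by simp
qed simp

section \<open>The five graphs and the evaluation of the search\<close>

definition graph :: "nat \<Rightarrow> (nat \<times> nat) list \<Rightarrow> bool list list" where
  "graph n es = map (\<lambda>i. map (\<lambda>j. list_ex (\<lambda>(a, b). a = i \<and> b = j \<or> a = j \<and> b = i) es) [0..<n]) [0..<n]"

text \<open>Vertex 0 is the apex. The base vertices are numbered around the polygon, and each is
  adjacent to the two farthest from it, the ends of the opposite base edge. With truncated
  subtraction, \<open>(i - j) + (j - i)\<close> is the distance of the indices.\<close>

definition wheel :: "nat \<Rightarrow> bool list list" where
  "wheel l = map (\<lambda>i. map (\<lambda>j. (i = 0) \<noteq> (j = 0) \<or>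
     0 < i \<and> 0 < j \<and> (2 * (i - j) + 2 * (j - i) = l - 1 \<or> 2 * (i - j) + 2 * (j - i) = l + 1)) [0..<Suc l]) [0..<Suc l]"

text \<open>Vertex 0 is the pole; 1, 2, 3 and 4, 5, 6 are the upper and the lower ring of three
  points in \<open>pts7\<close>.\<close>

definition graph7 :: "bool list list" where
  "graph7 = graph 7 [(0,4),(0,5),(0,6),(1,2),(1,3),(2,3),(1,5),(1,6),(2,4),(2,6),(3,4),(3,5)]"

text \<open>Vertex 0 is opposite to the pentagon, whose boundary runs through 4, 2, 1, 3, 5. The
  numbering makes the symmetry visible: it exchanges 2 with 3, 4 with 5 and 6 with 7.\<close>

definition graph8 :: "bool list list" where
  "graph8 = graph 8 [(0,1),(0,2),(0,3),(0,4),(0,5),(1,2),(1,3),(2,4),(2,6),(3,5),(3,7),(4,7),(5,6),(6,7)]"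

definition first_row :: "nat \<Rightarrow> nat \<Rightarrow> bool list" where
  "first_row n d = False # replicate d True @ replicate (n - 1 - d) False"

text \<open>There is one search for each number of vertices and each maximal degree. For a wheel the
  identity permutation is enough, because the cyclic numbering around the apex is unique up to
  automorphisms.\<close>

lemma search_4_3: "search [[0..<4]] (wheel 3) 3 3 [first_row 4 3]" by code_simp
lemma search_5_3: "search [] [] 3 4 [first_row 5 3]" by code_simp
lemma search_5_4: "search [] [] 4 4 [first_row 5 4]" by code_simp
lemma search_6_3: "search [] [] 3 5 [first_row 6 3]" by code_simp
lemma search_6_4: "search [] [] 4 5 [first_row 6 4]" by code_simp
lemma search_6_5: "search [[0..<6]] (wheel 5) 5 5 [first_row 6 5]" by code_simp
lemma search_7_3: "search [] [] 3 6 [first_row 7 3]" by code_simp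
text \<open>The four neighbours of the first vertex can be numbered cyclically in eight ways and the
  two other vertices in two ways; modulo the automorphism of order two that fixes the first vertex,
  eight matrices remain, one for each permutation.\<close>

lemma search_7_4: "search [[6, 0, 1, 2, 5, 4, 3], [5, 0, 1, 2, 6, 4, 3], [6, 0, 1, 4, 5, 2, 3],
    [5, 0, 1, 4, 6, 2, 3], [5, 0, 2, 3, 6, 1, 4], [5, 0, 3, 4, 6, 2, 1], [6, 0, 2, 3, 5, 1, 4],
    [6, 0, 3, 4, 5, 2, 1]] graph7 4 6 [first_row 7 4]" by code_simp
lemma search_7_5: "search [] [] 5 6 [first_row 7 5]" by code_simp
lemma search_7_6: "search [] [] 6 6 [first_row 7 6]" by code_simp

lemma search_8_3: "search [] [] 3 7 [first_row 8 3]" by code_simp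
lemma search_8_4: "search [] [] 4 7 [first_row 8 4]" by code_simp
text \<open>The same count with five neighbours: ten cyclic numberings, two of the remaining
  vertices and one reflection give ten matrices.\<close>

lemma search_8_5: "search [[0, 4, 1, 2, 3, 5, 6, 7], [0, 3, 1, 5, 4, 2, 6, 7], [0, 4, 1, 2, 3, 5, 7, 6],
    [0, 3, 1, 5, 4, 2, 7, 6], [0, 1, 3, 4, 5, 2, 6, 7], [0, 1, 3, 4, 5, 2, 7, 6], [0, 5, 2, 3, 4, 1, 6, 7],
    [0, 5, 2, 3, 4, 1, 7, 6], [0, 2, 4, 5, 1, 3, 7, 6], [0, 2, 4, 5, 1, 3, 6, 7]] graph8 5 7 [first_row 8 5]"
  by code_simp
lemma search_8_6: "search [] [] 6 7 [first_row 8 6]" by code_simp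
lemma search_8_7: "search [[0..<8]] (wheel 7) 7 7 [first_row 8 7]" by code_simp

section \<open>Classification\<close>

context self_polar
begin

abbreviation "A \<equiv> (\<lambda>x y. x \<bullet> y = - r)"

lemma E_sym: "E x y \<Longrightarrow> E y x"
  by (auto simp: E_def Int_commute)

lemma V_nonempty: "V \<noteq> {}"
proof
  assume "V = {}"
  moreover have "(0 :: real^3) \<in> P" using cball_subset r_pos by (auto simp: subset_iff)
  ultimately show False by simp
qed

lemma facet_cycle:
  assumes u: "u \<in> V"
  shows "\<exists>as. distinct as \<and> set as = N u \<and> 3 \<le> length as \<and>
    (\<forall>i j. i < j \<longrightarrow> j < length as \<longrightarrow> E (as ! i) (as ! j) = (j = Suc i \<or> i = 0 \<and> Suc j = length as))"
proof (rule two_regular_connected_cycle[OF finite_N])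
  show "N u \<noteq> {}" using card_nbrs_ge_3[OF u] by auto
  show "E y x" if "x \<in> N u" "y \<in> N u" "E x y" for x y using that(3) by (rule E_sym)
  show "\<not> E x x" for x by (simp add: E_def)
  show "card {z \<in> N u. E x z} = 2" if "x \<in> N u" for x
  proof -
    have "x \<in> V" "u \<in> N x" using that u nbrs_subset nbrs_sym by blast+
    then obtain y z where "y \<noteq> z" "{y' \<in> N u. E x y'} = {y, z}" by (rule two_edges) (rule that)
    then show ?thesis by simp
  qed
  fix C assume C: "C \<subseteq> N u" "C \<noteq> {}" and cl: "\<And>x y. x \<in> C \<Longrightarrow> y \<in> N u \<Longrightarrow> E x y \<Longrightarrow> y \<in> C"
  show "C = N u" by (rule facet_connected[OF u C cl])
qed

text \<open>The degree \<open>d\<close> is chosen before \<open>ps\<close> and \<open>T\<close>, so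
  that whichever search has been evaluated for it can be used. The clause
  \<open>ps \<noteq> []\<close> turns a successful search without certificates into a
  contradiction.\<close>

lemma search_imp_isomorphic:
  "\<exists>d\<ge>3. d < card V \<and> (\<forall>ps T. search ps T d (card V - 1) [first_row (card V) d] \<longrightarrow>
     ps \<noteq> [] \<and> (\<exists>xs. distinct xs \<and> set xs = V \<and> adj_matrix A xs = T))"
proof -
  obtain u where u: "u \<in> V" and max': "\<And>v. v \<in> V \<Longrightarrow> real (card (N v)) \<le> real (card (N u))"
    using finite_obtain_maximizer[OF finite_V V_nonempty, of "\<lambda>v. real (card (N v))"] by metis
  have max: "card (N v) \<le> card (N u)" if "v \<in> V" for v using max'[OF that] by simp
  obtain as where as: "distinct as" "set as = N u" "3 \<le> length as"
    and cyc: "\<forall>i j. i < j \<longrightarrow> j < length as \<longrightarrow> E (as ! i) (as ! j) = (j = Suc i \<or> i = 0 \<and> Suc j = length as)"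
    using facet_cycle[OF u] by blast
  obtain bs where bs: "set bs = V - insert u (N u)" "distinct bs"
    using finite_distinct_list[of "V - insert u (N u)"] finite_V by auto
  define d where "d = length as"
  have dN: "d = card (N u)" using as distinct_card by (fastforce simp: d_def)
  have uu: "u \<notin> N u" using inner_V_self[OF u] r_pos by (simp add: nbrs_def)
  \<comment> \<open>The numbering assumed by the search: \<open>u\<close> has index 0, its
    neighbours have the indices 1 to \<open>d\<close> in cyclic order, and the rest follow
    arbitrarily.\<close>
  define xs where "xs = u # as @ bs"
  have dist: "distinct xs" using as bs uu by (auto simp: xs_def)
  have set: "set xs = V" using as bs u nbrs_subset by (auto simp: xs_def)
  define n where "n = length xs"
  have n: "n = card V" using distinct_card[OF dist] set by (simp add: n_def)
  have dn: "d < n" by (simp add: n_def xs_def d_def)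
  define M where "M = adj_matrix A xs"
  have lenM: "length M = n" by (simp add: M_def n_def)
  have M: "M ! i = map (A (xs ! i)) xs" if "i < n" for i using that by (simp add: M_def n_def)
  have Mij: "M ! i ! j = A (xs ! i) (xs ! j)" if "i < n" "j < n" for i j
    using that M[OF that(1)] by (simp add: n_def)
  have inV: "xs ! i \<in> V" if "i < n" for i using that set nth_mem by (fastforce simp: n_def)
  have neq: "xs ! i \<noteq> xs ! j" if "i < n" "j < n" "i \<noteq> j" for i j
    using that dist by (simp add: n_def nth_eq_iff_index_eq)
  have codeg: "codeg (M ! i) (M ! j) = card (N (xs ! i) \<inter> N (xs ! j))" if "i < n" "j < n" for i j
  proof -
    have "{x \<in> V. A (xs ! i) x \<and> A (xs ! j) x} = N (xs ! i) \<inter> N (xs ! j)" by (auto simp: nbrs_def)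
    then show ?thesis using codeg_map[OF dist] M that set by simp
  qed
  have E_iff: "E (xs ! i) (xs ! j) \<longleftrightarrow> codeg (M ! i) (M ! j) = 2" if "i < n" "j < n" "i \<noteq> j" for i j
    using codeg neq that by (simp add: E_def)
  have ok: "row_ok d (take i M) (M ! i)" if i: "1 \<le> i" "i < n" for i
  proof -
    have "compatible d i 0 (take i M) (M ! i)"
    proof (rule compatibleI)
      fix k assume "k < length (take i M)"
      then have k: "k < i" by simp
      then have kn: "k < n" using i by simp
      have tk: "take i M ! k = M ! k" using k by simp
      show "codeg (take i M ! k) (M ! i) \<le> 2"
        unfolding tk codeg[OF kn i(2)] by (rule codegree_le_2) (use inV neq kn i k in auto)
      assume k1: "1 \<le> 0 + k" and id: "i \<le> d"
      \<comment> \<open>Positions in \<open>as\<close> are lower by one than in \<open>xs\<close>,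
        where \<open>u\<close> comes first.\<close>
      have "E (xs ! k) (xs ! i) = E (as ! (k - 1)) (as ! (i - 1))"
      proof -
        obtain k' i' where "k = Suc k'" "i = Suc i'" using k k1 by (metis One_nat_def Suc_le_D add_0 less_imp_Suc_add)
        then show ?thesis using k id by (simp add: xs_def nth_append d_def)
      qed
      also have "\<dots> = (i - 1 = Suc (k - 1) \<or> k - 1 = 0 \<and> Suc (i - 1) = d)"
      proof -
        have "k - 1 < i - 1" "i - 1 < length as" using k k1 id i by (auto simp: d_def)
        then show ?thesis using cyc by (simp add: d_def)
      qed
      also have "\<dots> = (i = Suc (0 + k) \<or> 0 + k = 1 \<and> i = d)" using k k1 by auto
      finally show "(codeg (take i M ! k) (M ! i) = 2) = (i = Suc (0 + k) \<or> 0 + k = 1 \<and> i = d)"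
        unfolding tk using E_iff[of k i] kn i k by simp
    qed
    moreover have "codeg (M ! i) (M ! i) = card (N (xs ! i))" using codeg[OF i(2) i(2)] by simp
    ultimately show ?thesis
      using card_nbrs_ge_3[OF inV[OF i(2)]] max[OF inV[OF i(2)]] i lenM
      by (simp add: row_ok_def Let_def dN min_def)
  qed
  have two: "two_edges_matrix M"
    unfolding two_edges_matrix_def list_all_iff lenM
  proof (intro ballI, simp only: split: if_split, intro conjI impI TrueI)
    fix v w assume "v \<in> set [0..<n]" "w \<in> set [0..<n]" and Mvw: "M ! v ! w"
    then have vw: "v < n" "w < n" by auto
    then have w: "xs ! w \<in> N (xs ! v)" using Mij inV Mvw by (simp add: nbrs_def)
    let ?S = "{x. x \<noteq> v \<and> M ! w ! x \<and> codeg (M ! v) (M ! x) = 2} \<inter> {0..<n}"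
    have im: "(!) xs ` ?S = {z \<in> N (xs ! w). E (xs ! v) z}"
    proof (intro equalityI subsetI)
      fix z assume "z \<in> (!) xs ` ?S"
      then show "z \<in> {z \<in> N (xs ! w). E (xs ! v) z}"
        using vw Mij inV E_iff by (auto simp: nbrs_def)
    next
      fix z assume z: "z \<in> {z \<in> N (xs ! w). E (xs ! v) z}"
      then have "z \<in> V" using nbrs_subset by blast
      then obtain x where x: "x < n" "z = xs ! x" using set by (metis in_set_conv_nth n_def)
      then have "x \<noteq> v" using z by (auto simp: E_def)
      then show "z \<in> (!) xs ` ?S" using x z vw Mij E_iff[of v x] by (auto simp: nbrs_def)
    qed
    have "inj_on ((!) xs) ?S" by (rule inj_on_nth[OF dist]) (simp add: n_def)
    then have "card ?S = card {z \<in> N (xs ! w). E (xs ! v) z}" unfolding im[symmetric] by (rule card_image[symmetric])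
    also have "\<dots> = 2"
    proof -
      obtain y z where "y \<noteq> z" "{y' \<in> N (xs ! w). E (xs ! v) y'} = {y, z}"
        by (rule two_edges[OF inV[OF vw(1)] w]) (rule that)
      then show ?thesis by simp
    qed
    finally show "length (filter (\<lambda>x. x \<noteq> v \<and> M ! w ! x \<and> codeg (M ! v) (M ! x) = 2) [0..<n]) = 2"
      by (simp add: distinct_length_filter)
  qed
  have star: "star_not_component M"
  proof -
    define S where "S x \<longleftrightarrow> x = 0 \<or> codeg (M ! 0) (M ! x) = 2" for x
    have "list_ex (\<lambda>x. S x \<and> list_ex (\<lambda>y. \<not> S y \<and> codeg (M ! x) (M ! y) = 2) [0..<n]) [0..<n]"
      if not_all: "\<not> list_all S [0..<n]"
    proof -
      let ?C = "(!) xs ` {x. x < n \<and> S x}"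
      obtain y where y: "y < n" "\<not> S y" using not_all by (auto simp: list_all_iff)
      have "xs ! y \<notin> ?C" using y neq by (auto simp: S_def)
      then have "?C \<noteq> V" using inV[OF y(1)] by blast
      moreover have "?C \<subseteq> V" using inV by auto
      moreover have "xs ! 0 \<in> ?C" using dn by (auto simp: S_def)
      \<comment> \<open>If no edge left the set \<open>?C\<close> formed by \<open>u\<close> and its
        neighbours in the edge graph, connectedness would make it all of \<open>V\<close>.\<close>
      ultimately obtain v z where vz: "v \<in> ?C" "z \<in> V" "E v z" "z \<notin> ?C"
        using edges_connected[of ?C] by blast
      obtain x where x: "x < n" "S x" "v = xs ! x" using vz(1) by blast
      obtain y where y: "y < n" "z = xs ! y" using vz(2) set by (metis in_set_conv_nth n_def)
      have "\<not> S y" using y vz(4) by blast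
      moreover have "codeg (M ! x) (M ! y) = 2" using vz(3) E_iff[of x y] x y by (auto simp: E_def)
      ultimately show ?thesis using x y unfolding list_ex_iff set_upt atLeastLessThan_iff by (intro bexI[of _ x] conjI bexI[of _ y]) auto
    qed
    then show ?thesis unfolding star_not_component_def Let_def lenM S_def by blast
  qed
  have row0: "take 1 M = [first_row n d]"
  proof -
    have "take 1 M = [M ! 0]" using dn lenM by (cases M) auto
    moreover have "M ! 0 = first_row n d"
    proof -
      have "map (A u) as = replicate d True"
      proof (rule replicate_eqI)
        fix b assume "b \<in> set (map (A u) as)"
        then obtain y where y: "y \<in> set as" "b = A u y" by auto
        then show "b = True" unfolding as(2) nbrs_def by simp
      qed (simp add: d_def)
      moreover have "map (A u) bs = replicate (length bs) False"
      proof (rule replicate_eqI)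
        fix b assume "b \<in> set (map (A u) bs)"
        then obtain y where y: "y \<in> set bs" "b = A u y" by auto
        then have "y \<in> V" "y \<notin> N u" unfolding bs(1) by auto
        then show "b = False" unfolding y(2) nbrs_def by simp
      qed simp
      moreover have "length bs = n - 1 - d" by (simp add: n_def xs_def d_def)
      moreover have "\<not> A u u" using uu u by (simp add: nbrs_def)
      ultimately show ?thesis using M[of 0] dn by (simp add: xs_def first_row_def)
    qed
    ultimately show ?thesis by simp
  qed
  have "ps \<noteq> [] \<and> (\<exists>xs. distinct xs \<and> set xs = V \<and> adj_matrix A xs = T)"
    if s: "search ps T d (n - 1) [first_row n d]" for ps T
  proof -
    have "accepted ps T M"
    proof (rule search_imp_accepted[of M d 1 "n - 1"])
      show "search ps T d (n - 1) (take 1 M)" using s row0 by simp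
      show "\<not> M ! i ! i" if "i < length M" for i
        using that Mij[of i i] inner_V_self[OF inV[of i]] r_pos by (simp add: lenM)
    qed (use lenM M Mij ok dn in \<open>auto simp: inner_commute n_def\<close>)
    then obtain p where p: "p \<in> set ps" "length p = n" "distinct p" "\<forall>i\<in>set p. i < n" "permute p M = T"
      using two star by (auto simp: accepted_def list_ex_iff list_all_iff lenM)
    have setp: "set p = {..<n}"
      using p card_subset_eq[of "{..<n}" "set p"] distinct_card[OF p(3)] by auto
    let ?ys = "map ((!) xs) p"
    have "distinct ?ys" using p inj_on_nth[OF dist, of "set p"] by (simp add: distinct_map n_def)
    moreover have "set ?ys = V"
    proof -
      have "set ?ys = (!) xs ` {..<n}" by (simp add: setp)
      also have "\<dots> = set xs" by (auto simp: set_conv_nth n_def)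
      finally show ?thesis using set by simp
    qed
    moreover have "adj_matrix A ?ys = permute p M"
      using p(4) Mij by (auto simp: adj_matrix_def permute_def)
    ultimately show ?thesis using p by auto
  qed
  then show ?thesis using as(3) dn unfolding n d_def[symmetric] by blast
qed

theorem classification:
  assumes "card V \<le> 8"
  shows "\<exists>xs. distinct xs \<and> set xs = V \<and>
    adj_matrix A xs \<in> {wheel 3, wheel 5, graph7, wheel 7, graph8}"
proof -
  obtain d where d: "3 \<le> d" "d < card V"
    and s: "\<And>ps T. search ps T d (card V - 1) [first_row (card V) d] \<Longrightarrow>
      ps \<noteq> [] \<and> (\<exists>xs. distinct xs \<and> set xs = V \<and> adj_matrix A xs = T)"
    using search_imp_isomorphic by blast
  have s': "ps \<noteq> [] \<and> (\<exists>xs. distinct xs \<and> set xs = V \<and> adj_matrix A xs = T)"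
    if "card V = n" "d = d'" "search ps T d' k [first_row n d']" "n = Suc k" for ps T n d' k
    using s[of ps T] that by simp
  consider "card V = 4" "d = 3" | "card V = 5" "d = 3" | "card V = 5" "d = 4"
    | "card V = 6" "d = 3" | "card V = 6" "d = 4" | "card V = 6" "d = 5"
    | "card V = 7" "d = 3" | "card V = 7" "d = 4" | "card V = 7" "d = 5" | "card V = 7" "d = 6"
    | "card V = 8" "d = 3" | "card V = 8" "d = 4" | "card V = 8" "d = 5" | "card V = 8" "d = 6" | "card V = 8" "d = 7"
  proof -
    have "card V = 4 \<or> card V = 5 \<or> card V = 6 \<or> card V = 7 \<or> card V = 8"
      and "d = 3 \<or> d = 4 \<or> d = 5 \<or> d = 6 \<or> d = 7" using d assms by linarith+
    then show ?thesis using d that by (elim disjE) simp_all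
  qed
  then show ?thesis
  proof cases
    case 1 from s'[OF this search_4_3] show ?thesis by auto
  next case 2 from s'[OF this search_5_3] show ?thesis by auto
  next case 3 from s'[OF this search_5_4] show ?thesis by auto
  next case 4 from s'[OF this search_6_3] show ?thesis by auto
  next case 5 from s'[OF this search_6_4] show ?thesis by auto
  next case 6 from s'[OF this search_6_5] show ?thesis by auto
  next case 7 from s'[OF this search_7_3] show ?thesis by auto
  next case 8 from s'[OF this search_7_4] show ?thesis by auto
  next case 9 from s'[OF this search_7_5] show ?thesis by auto
  next case 10 from s'[OF this search_7_6] show ?thesis by auto
  next case 11 from s'[OF this search_8_3] show ?thesis by auto
  next case 12 from s'[OF this search_8_4] show ?thesis by auto
  next case 13 from s'[OF this search_8_5] show ?thesis by auto
  next case 14 from s'[OF this search_8_6] show ?thesis by auto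
  next case 15 from s'[OF this search_8_7] show ?thesis by auto
  qed
qed

end

section \<open>Realization of graphs by Gram matrices\<close>

definition realizes :: "(real^3) list \<Rightarrow> real \<Rightarrow> bool list list \<Rightarrow> bool" where
  "realizes xs r T \<longleftrightarrow> 0 < r \<and> r < 1 \<and> (\<forall>x\<in>set xs. norm x = 1) \<and>
     list_all2 (\<lambda>x row. list_all2 (\<lambda>y b. - r \<le> x \<bullet> y \<and> (x \<bullet> y = - r) = b) xs row) xs T"

text \<open>The hypothesis of \<open>self_polarI\<close> on the existence of flag edges, for an adjacency matrix.\<close>

definition self_dual_matrix :: "bool list list \<Rightarrow> bool" where
  "self_dual_matrix T = (T \<noteq> [] \<and> distinct T \<and> (let I = [0..<length T] in
     list_all (\<lambda>v. list_ex (\<lambda>w. T ! v ! w) I \<and> list_all (\<lambda>w. if T ! v ! w then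
       list_ex (\<lambda>x. list_ex (\<lambda>y. if T ! w ! x \<and> T ! w ! y then
         list_ex (\<lambda>p. T ! v ! p \<and> T ! x ! p \<and> \<not> T ! y ! p) I \<and>
         list_ex (\<lambda>q. T ! v ! q \<and> T ! y ! q \<and> \<not> T ! x ! q) I else False) I) I else True) I) I))"

lemma self_dual_matrix_wheel:
  "self_dual_matrix (wheel 3)" "self_dual_matrix (wheel 5)" "self_dual_matrix (wheel 7)"
  by code_simp+

lemma self_dual_matrix_graph: "self_dual_matrix graph7" "self_dual_matrix graph8"
  by code_simp+

lemma realizes_adj_matrix:
  assumes "realizes xs r T"
  shows "adj_matrix (\<lambda>x y. x \<bullet> y = - r) xs = T"
proof (rule nth_equalityI)
  have len: "length T = length xs" and
    row: "\<And>i. i < length xs \<Longrightarrow> list_all2 (\<lambda>y b. - r \<le> xs ! i \<bullet> y \<and> (xs ! i \<bullet> y = - r) = b) xs (T ! i)"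
    using assms by (auto simp: realizes_def list_all2_conv_all_nth)
  show "length (adj_matrix (\<lambda>x y. x \<bullet> y = - r) xs) = length T" by (simp add: len)
  fix i assume "i < length (adj_matrix (\<lambda>x y. x \<bullet> y = - r) xs)"
  then have i: "i < length xs" by simp
  show "adj_matrix (\<lambda>x y. x \<bullet> y = - r) xs ! i = T ! i"
    using row[OF i] i by (auto simp: list_all2_conv_all_nth intro!: nth_equalityI)
qed

lemma realizes_self_polar:
  assumes xs: "realizes xs r T" and T: "self_dual_matrix T"
  shows "distinct xs" and "self_polar (set xs) r"
proof -
  let ?A = "\<lambda>x y. x \<bullet> y = - r"
  have mat: "T = adj_matrix ?A xs" using realizes_adj_matrix[OF xs] ..
  define n where "n = length xs"
  have lenT: "length T = n" by (simp add: mat n_def)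
  have Tij: "T ! i ! j = (xs ! i \<bullet> xs ! j = - r)" if "i < n" "j < n" for i j
    using that by (simp add: mat n_def)
  have r: "0 < r" "r < 1" and norm: "\<And>x. x \<in> set xs \<Longrightarrow> norm x = 1"
    using xs by (auto simp: realizes_def)
  have gram: "- r \<le> xs ! i \<bullet> xs ! j" if "i < n" "j < n" for i j
    using xs that by (auto simp: realizes_def list_all2_conv_all_nth n_def)
  \<comment> \<open>Equal points would have equal rows.\<close>
  have "distinct T" using T by (simp add: self_dual_matrix_def)
  then show "distinct xs" by (simp add: mat adj_matrix_def distinct_map)
  have idx: "\<exists>i<n. v = xs ! i" if "v \<in> set xs" for v using that by (auto simp: in_set_conv_nth n_def)
  have nb: "xs ! j \<in> nbrs r (set xs) (xs ! i) \<longleftrightarrow> T ! i ! j" if "i < n" "j < n" for i j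
    using that Tij by (simp add: nbrs_def n_def)
  have ex: "\<exists>w<n. T ! v ! w" if "v < n" for v
  proof -
    have "\<forall>v\<in>set [0..<n]. list_ex (\<lambda>w. T ! v ! w) [0..<n]"
      using T unfolding self_dual_matrix_def Let_def list_all_iff lenT by simp
    from bspec[OF this, of v] that show ?thesis unfolding list_ex_iff by auto
  qed
  have fl: "\<exists>x<n. \<exists>y<n. T ! w ! x \<and> T ! w ! y \<and> (\<exists>p<n. T ! v ! p \<and> T ! x ! p \<and> \<not> T ! y ! p) \<and>
      (\<exists>q<n. T ! v ! q \<and> T ! y ! q \<and> \<not> T ! x ! q)" if vw: "v < n" "w < n" "T ! v ! w" for v w
  proof -
    have "\<forall>w\<in>set [0..<n]. if T ! v ! w then
       list_ex (\<lambda>x. list_ex (\<lambda>y. if T ! w ! x \<and> T ! w ! y then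
         list_ex (\<lambda>p. T ! v ! p \<and> T ! x ! p \<and> \<not> T ! y ! p) [0..<n] \<and>
         list_ex (\<lambda>q. T ! v ! q \<and> T ! y ! q \<and> \<not> T ! x ! q) [0..<n] else False) [0..<n]) [0..<n] else True"
      using T vw(1) unfolding self_dual_matrix_def Let_def list_all_iff lenT by simp
    from bspec[OF this, of w] vw show ?thesis
      unfolding list_ex_iff by (auto split: if_splits) blast
  qed
  show "self_polar (set xs) r"
  proof (rule self_polarI)
    show "set xs \<noteq> {}" using T by (auto simp: self_dual_matrix_def mat adj_matrix_def)
    fix u v assume "u \<in> set xs" "v \<in> set xs"
    then show "- r \<le> u \<bullet> v" using idx gram by metis
  next
    fix v assume "v \<in> set xs"
    then obtain i where i: "i < n" "v = xs ! i" using idx by blast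
    then show "nbrs r (set xs) v \<noteq> {}" using ex[of i] nb by blast
  next
    fix v w assume v: "v \<in> set xs" and w: "w \<in> nbrs r (set xs) v"
    obtain i where i: "i < n" "v = xs ! i" using idx v by blast
    have "w \<in> set xs" using w by (simp add: nbrs_def)
    then obtain j where j: "j < n" "w = xs ! j" using idx by blast
    have "T ! i ! j" using w nb i j by simp
    then obtain x y p q where "x < n" "y < n" "p < n" "q < n" "T ! j ! x" "T ! j ! y"
      "T ! i ! p" "T ! x ! p" "\<not> T ! y ! p" "T ! i ! q" "T ! y ! q" "\<not> T ! x ! q"
      using fl[OF i(1) j(1)] by blast
    then have "flag_edges r (set xs) v w (xs ! x) (xs ! y)"
      unfolding flag_edges_def i(2) j(2) using nb i j by (intro conjI bexI[of _ "xs ! p"] bexI[of _ "xs ! q"]) auto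
    then show "\<exists>x y. flag_edges r (set xs) v w x y" by blast
  qed (use r norm in auto)
qed

lemma self_polar_facet_sizes:
  assumes "distinct xs" and "self_polar (set xs) r"
  shows "facet_sizes (convex hull set xs) = mset (map (\<lambda>a. codeg a a) (adj_matrix (\<lambda>x y. x \<bullet> y = - r) xs))"
proof -
  interpret self_polar "set xs" r by fact
  have "codeg (map (A x) xs) (map (A x) xs) = card (N x)" for x
    using codeg_map[OF assms(1), of "A x" "A x"] by (simp add: nbrs_def)
  then show ?thesis
    using mset_set_set[OF assms(1)] by (simp add: facet_sizes_P adj_matrix_def image_mset.compositionality comp_def)
qed

text \<open>Matching the points by their positions in the lists preserves the graph, and nothing
  metric has to agree.\<close>

lemma adj_matrix_eq_imp_equivalent:
  assumes xs: "distinct xs" "self_polar (set xs) r" and ys: "distinct ys" "self_polar (set ys) s"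
    and mat: "adj_matrix (\<lambda>x y. x \<bullet> y = - r) xs = adj_matrix (\<lambda>x y. x \<bullet> y = - s) ys"
  shows "combinatorially_equivalent (convex hull set xs) (convex hull set ys)"
proof -
  define n where "n = length xs"
  have len: "length ys = n" using mat by (metis adj_matrix_nth(1) n_def)
  have bx: "bij_betw ((!) xs) {..<n} (set xs)" and byy: "bij_betw ((!) ys) {..<n} (set ys)"
    using xs ys len by (auto simp: n_def bij_betw_nth)
  let ?i = "the_inv_into {..<n} ((!) xs)"
  have bi: "bij_betw ?i (set xs) {..<n}" by (rule bij_betw_the_inv_into[OF bx])
  have i: "xs ! ?i x = x" "?i x < n" if "x \<in> set xs" for x
    using f_the_inv_into_f_bij_betw[OF bx] bij_betwE[OF bi] that by auto
  have eq: "(xs ! i \<bullet> xs ! j = - r) = (ys ! i \<bullet> ys ! j = - s)" if "i < n" "j < n" for i j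
  proof -
    have "adj_matrix (\<lambda>x y. x \<bullet> y = - r) xs ! i ! j = adj_matrix (\<lambda>x y. x \<bullet> y = - s) ys ! i ! j"
      by (simp only: mat)
    then show ?thesis using that len by (simp add: n_def)
  qed
  show ?thesis
  proof (rule self_polar_combinatorially_equivalent[OF xs(2) ys(2)])
    show "bij_betw ((!) ys \<circ> ?i) (set xs) (set ys)" by (rule bij_betw_trans[OF bi byy])
    fix u v assume "u \<in> set xs" "v \<in> set xs"
    then show "(u \<bullet> v = - r) = (((!) ys \<circ> ?i) u \<bullet> ((!) ys \<circ> ?i) v = - s)"
      using eq[of "?i u" "?i v"] i by simp
  qed
qed

section \<open>Coordinates for points on parallels of the unit sphere\<close>

definition vec3 :: "real \<Rightarrow> real \<Rightarrow> real \<Rightarrow> real^3" where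
  "vec3 x y z = vector [x, y, z]"

lemma inner_vec3 [simp]: "vec3 a b c \<bullet> vec3 x y z = a * x + b * y + c * z"
  by (simp add: vec3_def inner_vec_def sum_3)

lemma norm_vec3: "norm (vec3 a b c) = sqrt (a\<^sup>2 + b\<^sup>2 + c\<^sup>2)"
  by (simp add: norm_eq_sqrt_inner power2_eq_square)

lemma scaleR_vec3 [simp]: "k *\<^sub>R vec3 a b c = vec3 (k * a) (k * b) (k * c)"
  by (simp add: vec3_def vec_eq_iff forall_3)

lemma add_vec3 [simp]: "vec3 a b c + vec3 x y z = vec3 (a + x) (b + y) (c + z)"
  by (simp add: vec3_def vec_eq_iff forall_3)

definition ring_pt :: "nat \<Rightarrow> real \<Rightarrow> nat \<Rightarrow> real^3" where
  "ring_pt l h j = vec3 (sqrt (1 - h\<^sup>2) * cos (2 * pi * real j / real l))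
     (sqrt (1 - h\<^sup>2) * sin (2 * pi * real j / real l)) h"

lemma inner_ring_pt:
  "ring_pt l h i \<bullet> ring_pt l k j =
    sqrt (1 - h\<^sup>2) * sqrt (1 - k\<^sup>2) * cos (2 * pi * (real i - real j) / real l) + h * k"
proof -
  have "2 * pi * (real i - real j) / real l = 2 * pi * real i / real l - 2 * pi * real j / real l"
    by (simp add: diff_divide_distrib right_diff_distrib)
  then show ?thesis by (simp only: ring_pt_def inner_vec3 cos_diff) (simp add: algebra_simps)
qed

lemma inner_pole_ring_pt: "vec3 0 0 1 \<bullet> ring_pt l h j = h" "ring_pt l h j \<bullet> vec3 0 0 1 = h"
  by (simp_all add: ring_pt_def)

lemma norm_ring_pt: assumes "\<bar>h\<bar> \<le> 1" shows "norm (ring_pt l h j) = 1"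
proof -
  have "h\<^sup>2 \<le> 1" using assms by (simp add: abs_square_le_1)
  then have "ring_pt l h j \<bullet> ring_pt l h j = 1" by (simp add: inner_ring_pt) (simp add: power2_eq_square)
  then show ?thesis by (simp add: norm_eq_sqrt_inner)
qed

text \<open>A shift by \<pi> turns the cosine into \<open>- cos (pi * k / l)\<close> with
  \<open>k = \<bar>2 * m - l\<bar>\<close>, an odd number between 1 and \<open>l\<close>. On this
  range the cosine of \<open>pi * k / l\<close> decreases in \<open>k\<close>, and
  \<open>k = 1\<close> belongs to the two vertices farthest from the first.\<close>

lemma cos_regular_polygon:
  fixes l m :: nat
  assumes l: "odd l" and m: "m < l"
  shows "- cos (pi / real l) \<le> cos (2 * pi * real m / real l)"
    and "cos (2 * pi * real m / real l) = - cos (pi / real l) \<longleftrightarrow> 2 * m = l - 1 \<or> 2 * m = l + 1"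
proof -
  define k where "k = \<bar>2 * real m - real l\<bar>"
  have l0: "real l > 0" using m by simp
  have k: "k = real (nat \<bar>2 * int m - int l\<bar>)" by (simp add: k_def)
  have "2 * int m - int l \<noteq> 0" using l by presburger
  then have k1: "1 \<le> k" unfolding k by linarith
  have kl: "k \<le> real l" using m by (simp add: k_def abs_le_iff)
  have "cos (2 * pi * real m / real l) = - cos (2 * pi * real m / real l - pi)" by (simp add: cos_diff)
  also have "2 * pi * real m / real l - pi = pi * (2 * real m - real l) / real l"
    using l0 by (simp add: field_simps)
  also have "cos (pi * (2 * real m - real l) / real l) = cos \<bar>pi * (2 * real m - real l) / real l\<bar>"
    by (rule cos_abs_real[symmetric])
  also have "\<bar>pi * (2 * real m - real l) / real l\<bar> = pi * k / real l"
    using l0 by (simp add: k_def abs_mult)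
  finally have eq: "cos (2 * pi * real m / real l) = - cos (pi * k / real l)" .
  have b: "0 \<le> pi / real l" "pi / real l \<le> pi * k / real l" "pi * k / real l \<le> pi"
    using l0 k1 kl by (auto simp: field_simps)
  show "- cos (pi / real l) \<le> cos (2 * pi * real m / real l)"
    unfolding eq using cos_monotone_0_pi_le[OF b] by simp
  have "cos (pi * k / real l) = cos (pi / real l) \<longleftrightarrow> pi * k / real l = pi / real l"
    using b cos_inj_pi[of "pi * k / real l" "pi / real l"] by (smt (verit, best))
  also have "\<dots> \<longleftrightarrow> k = 1" using l0 by simp
  also have "\<dots> \<longleftrightarrow> 2 * m = l - 1 \<or> 2 * m = l + 1"
    unfolding k using m by linarith
  finally show "cos (2 * pi * real m / real l) = - cos (pi / real l) \<longleftrightarrow> 2 * m = l - 1 \<or> 2 * m = l + 1"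
    unfolding eq by simp
qed

text \<open>The height \<open>h\<close> at which \<open>h\<^sup>2 - (1 - h\<^sup>2) cos (\<pi> / l) = h\<close>: the pole and the farthest
  vertices of the base then have the same inner product with a vertex of the base.\<close>

definition wheel_height :: "nat \<Rightarrow> real" where
  "wheel_height l = - (cos (pi / real l) / (1 + cos (pi / real l)))"

definition wheel_pts :: "nat \<Rightarrow> (real^3) list" where
  "wheel_pts l = vec3 0 0 1 # map (ring_pt l (wheel_height l)) [0..<l]"

lemma wheel_height:
  assumes "3 \<le> l"
  shows "0 < - wheel_height l" "- wheel_height l < cos (pi / real l)" "cos (pi / real l) < 1" "0 < cos (pi / real l)"
    "(wheel_height l)\<^sup>2 - (1 - (wheel_height l)\<^sup>2) * cos (pi / real l) = wheel_height l"
proof -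
  let ?c = "cos (pi / real l)"
  have "pi / real l < pi / 2" using assms by (simp add: field_simps)
  then show c: "0 < ?c" using assms by (intro cos_gt_zero) (auto simp: field_simps)
  have "?c < cos 0" using assms by (intro cos_monotone_0_pi) (auto simp: field_simps)
  then show "?c < 1" by simp
  show "0 < - wheel_height l" using c by (simp add: wheel_height_def)
  have "?c / (1 + ?c) < ?c / 1" using c by (intro divide_strict_left_mono) auto
  then show "- wheel_height l < ?c" by (simp add: wheel_height_def)
  have "wheel_height l * (1 + ?c) = - ?c" using c by (simp add: wheel_height_def)
  then show "(wheel_height l)\<^sup>2 - (1 - (wheel_height l)\<^sup>2) * ?c = wheel_height l" by algebra
qed

text \<open>By the equation for the height \<open>h\<close>, the inner product of two base points
  exceeds \<open>h\<close> by \<open>1 - h\<^sup>2\<close> times a quantity that is nonnegative by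
  \<open>cos_regular_polygon\<close> and vanishes only for a vertex and one of the two farthest from
  it.\<close>

lemma realizes_wheel:
  assumes l: "odd l" "3 \<le> l"
  shows "realizes (wheel_pts l) (- wheel_height l) (wheel l)"
proof -
  define h where "h = wheel_height l"
  note wh = wheel_height[OF l(2), folded h_def]
  have h1: "\<bar>h\<bar> \<le> 1" and h2: "h\<^sup>2 < 1" using wh by (auto simp: abs_square_less_1)
  have pts: "wheel_pts l ! i = (if i = 0 then vec3 0 0 1 else ring_pt l h (i - 1))" if "i < Suc l" for i
    using that by (cases i) (auto simp: wheel_pts_def h_def)
  have T: "wheel l ! i ! j = ((i = 0) \<noteq> (j = 0) \<or> 0 < i \<and> 0 < j \<and>
      (2 * (i - j) + 2 * (j - i) = l - 1 \<or> 2 * (i - j) + 2 * (j - i) = l + 1))" if "i < Suc l" "j < Suc l" for i j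
    using that by (simp add: wheel_def del: upt_Suc)
  have ring: "h \<le> ring_pt l h i \<bullet> ring_pt l h j \<and> (ring_pt l h i \<bullet> ring_pt l h j = h) =
      (2 * (i - j) + 2 * (j - i) = l - 1 \<or> 2 * (i - j) + 2 * (j - i) = l + 1)" if ij: "i < l" "j < l" for i j
  proof -
    define m where "m = (i - j) + (j - i)"
    have m: "m < l" "2 * (i - j) + 2 * (j - i) = 2 * m" using ij by (auto simp: m_def)
    have "cos (2 * pi * (real i - real j) / real l) = cos (2 * pi * real m / real l)"
    proof (cases "j \<le> i")
      case True
      then show ?thesis by (simp add: m_def of_nat_diff)
    next
      case False
      then have "2 * pi * (real i - real j) / real l = - (2 * pi * real m / real l)"
        unfolding minus_divide_left by (simp add: m_def of_nat_diff algebra_simps)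
      then show ?thesis by simp
    qed
    then have "ring_pt l h i \<bullet> ring_pt l h j = (1 - h\<^sup>2) * cos (2 * pi * real m / real l) + h\<^sup>2"
      using h2 by (simp add: inner_ring_pt power2_eq_square)
    also have "\<dots> = h + (1 - h\<^sup>2) * (cos (2 * pi * real m / real l) - - cos (pi / real l))"
      using wh(5) by (simp add: algebra_simps)
    finally have eq: "ring_pt l h i \<bullet> ring_pt l h j = \<dots>" .
    have "0 \<le> (1 - h\<^sup>2) * (cos (2 * pi * real m / real l) - - cos (pi / real l))"
      using h2 cos_regular_polygon(1)[OF l(1) m(1)] by simp
    moreover have "(1 - h\<^sup>2) * (cos (2 * pi * real m / real l) - - cos (pi / real l)) = 0 \<longleftrightarrow>
        2 * m = l - 1 \<or> 2 * m = l + 1"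
      using h2 cos_regular_polygon(2)[OF l(1) m(1)] by auto
    ultimately show ?thesis unfolding eq m(2) by auto
  qed
  have len: "length (wheel_pts l) = Suc l" by (simp add: wheel_pts_def)
  have lenT: "length (wheel l) = Suc l" "\<And>i. i < Suc l \<Longrightarrow> length (wheel l ! i) = Suc l"
    by (simp_all add: wheel_def del: upt_Suc)
  have norm: "norm x = 1" if "x \<in> set (wheel_pts l)" for x
    using that norm_ring_pt[OF h1] by (auto simp: wheel_pts_def h_def norm_vec3)
  have "- (- h) \<le> wheel_pts l ! i \<bullet> wheel_pts l ! j \<and> (wheel_pts l ! i \<bullet> wheel_pts l ! j = - (- h)) = wheel l ! i ! j"
    if ij: "i < Suc l" "j < Suc l" for i j
  proof (cases "i = 0 \<or> j = 0")
    case True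
    then show ?thesis unfolding T[OF ij] pts[OF ij(1)] pts[OF ij(2)]
      using wh by (auto simp: inner_pole_ring_pt)
  next
    case False
    then obtain i' j' where "i = Suc i'" "j = Suc j'" by (metis not0_implies_Suc)
    then show ?thesis unfolding T[OF ij] pts[OF ij(1)] pts[OF ij(2)]
      using ring[of i' j'] ij by simp
  qed
  then show ?thesis
    unfolding realizes_def h_def[symmetric] list_all2_conv_all_nth
    using norm wh len lenT by auto
qed

section \<open>Explicit realizations of \<open>graph7\<close> and \<open>graph8\<close>\<close>

lemma graph7_eq: "graph7 =
  [[False, False, False, False, True, True, True],
   [False, False, True, True, False, True, True],
   [False, True, False, True, True, False, True],
   [False, True, True, False, True, True, False],
   [True, False, True, True, False, False, False],
   [True, True, False, True, False, False, False],
   [True, True, True, False, False, False, False]]"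
  by code_simp

lemma graph8_eq: "graph8 =
  [[False, True, True, True, True, True, False, False],
   [True, False, True, True, False, False, False, False],
   [True, True, False, False, True, False, True, False],
   [True, True, False, False, False, True, False, True],
   [True, False, True, False, False, False, False, True],
   [True, False, False, True, False, False, True, False],
   [False, False, True, False, False, True, False, True],
   [False, False, False, True, True, False, True, False]]"
  by code_simp

text \<open>Prescribing the Gram matrix of a pole and two rings of three points at heights \<open>h\<close> and \<open>- t\<close>
  leads to these two equations; eliminating \<open>t\<close> gives a quartic in \<open>h\<close>.\<close>

lemma exists_pentagon_parameters:
  obtains h t :: real where "1/10 < h" "h < 11/100" "3 * h\<^sup>2 = 1 - 2 * t" "(1 + h) * (1 - t\<^sup>2) = 4 * t\<^sup>2 * (1 - h)"
proof -
  let ?f = "\<lambda>h::real. - (27 * h^4 - 18 * h^3 - 36 * h^2 - 6 * h + 1)"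
  have "\<exists>h. 1/10 \<le> h \<and> h \<le> 11/100 \<and> ?f h = 0"
    by (rule IVT') (auto simp: power_divide intro!: continuous_intros)
  then obtain h :: real where h: "1/10 \<le> h" "h \<le> 11/100" "27 * h^4 - 18 * h^3 - 36 * h^2 - 6 * h + 1 = 0" by auto
  have "h \<noteq> 1/10"
  proof
    assume e: "h = 1/10"
    show False using h(3)[unfolded e] by (simp add: power_divide)
  qed
  have "h \<noteq> 11/100"
  proof
    assume e: "h = 11/100"
    show False using h(3)[unfolded e] by (simp add: power_divide)
  qed
  define t where "t = (1 - 3 * h\<^sup>2) / 2"
  \<comment> \<open>Besides the quartic, the substitution for \<open>t\<close> leaves only the
    factor \<open>1 - h\<close>.\<close>
  have "4 * ((1 + h) * (1 - t\<^sup>2) - 4 * t\<^sup>2 * (1 - h)) = - (1 - h) * (27 * h^4 - 18 * h^3 - 36 * h^2 - 6 * h + 1)"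
    unfolding t_def by (simp add: field_simps power2_eq_square power3_eq_cube power4_eq_xxxx)
  then have "(1 + h) * (1 - t\<^sup>2) = 4 * t\<^sup>2 * (1 - h)" using h(3) by simp
  moreover have "3 * h\<^sup>2 = 1 - 2 * t" by (simp add: t_def field_simps)
  ultimately show ?thesis using that[of h t] h \<open>h \<noteq> 1/10\<close> \<open>h \<noteq> 11/100\<close> by simp
qed

lemma cos_third_turn: "i < 3 \<Longrightarrow> j < 3 \<Longrightarrow> cos (2 * pi * (real i - real j) / 3) = (if i = j then 1 else -1/2)"
proof -
  assume ij: "i < 3" "j < 3"
  have 2: "cos (2 * pi * 2 / 3) = -1/2"
  proof -
    have "2 * pi * 2 / 3 = 2 * pi - 2 * pi / 3" by simp
    then show ?thesis by (simp only: cos_diff) (simp add: cos_120)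
  qed
  have m: "cos (2 * pi * (- 1) / 3) = -1/2" "cos (2 * pi * (- 2) / 3) = -1/2"
    using 2 cos_120 cos_minus[of "2 * pi / 3"] cos_minus[of "2 * pi * 2 / 3"] by simp_all
  have "i = 0 \<or> i = 1 \<or> i = 2" "j = 0 \<or> j = 1 \<or> j = 2" using ij by auto
  then show ?thesis using 2 m cos_120 by (elim disjE) simp_all
qed

definition pts7 :: "real \<Rightarrow> real \<Rightarrow> (real^3) list" where
  "pts7 h t = [vec3 0 0 1, ring_pt 3 h 0, ring_pt 3 h 1, ring_pt 3 h 2,
     ring_pt 3 (- t) 0, ring_pt 3 (- t) 1, ring_pt 3 (- t) 2]"

text \<open>The number \<open>t\<close> is both the radius of the inner sphere and that of the
  circle touched by the pentagon in Lovasz's construction with \<open>l = 3\<close> and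
  \<open>k = 2\<close>. The bounds supply the sign conditions for both roles.\<close>

lemma pentagon_bounds:
  fixes h t :: real
  assumes "1/10 < h" "h < 11/100" "3 * h\<^sup>2 = 1 - 2 * t"
  shows "12/25 < t" "t < 49/100"
proof -
  have "(1/10)\<^sup>2 < h\<^sup>2" "h\<^sup>2 < (11/100)\<^sup>2" using assms by (auto intro!: power_strict_mono)
  then show "12/25 < t" "t < 49/100" using assms(3) by (simp_all add: power_divide)
qed

lemma pentagon_sqrt:
  fixes h t :: real
  assumes h: "1/10 < h" "h < 11/100" and t: "3 * h\<^sup>2 = 1 - 2 * t" "(1 + h) * (1 - t\<^sup>2) = 4 * t\<^sup>2 * (1 - h)"
  shows "sqrt (1 - h\<^sup>2) * sqrt (1 - t\<^sup>2) = 2 * t * (1 - h)"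
proof -
  note b = pentagon_bounds[OF h t(1)]
  have "(1 - h\<^sup>2) * (1 - t\<^sup>2) = (2 * t * (1 - h))\<^sup>2" using t(2) by algebra
  then have "sqrt ((1 - h\<^sup>2) * (1 - t\<^sup>2)) = 2 * t * (1 - h)" using b h by (simp add: real_sqrt_unique)
  then show ?thesis by (simp add: real_sqrt_mult)
qed

text \<open>The first equation makes the points of the upper ring adjacent to each other. The second
  one, in the form of \<open>pentagon_sqrt\<close>, does so for an upper and a lower point with
  different indices. The pole is adjacent to the lower ring because of the height
  \<open>- t\<close>, and all other pairs satisfy strict inequalities.\<close>

lemma realizes_graph7:
  assumes h: "1/10 < h" "h < 11/100" and t: "3 * h\<^sup>2 = 1 - 2 * t" "(1 + h) * (1 - t\<^sup>2) = 4 * t\<^sup>2 * (1 - h)"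
  shows "realizes (pts7 h t) t graph7"
proof -
  note b = pentagon_bounds[OF h t(1)]
  have h2: "h\<^sup>2 < 1" and t2: "t\<^sup>2 < 1" using h b by (auto simp: abs_square_less_1)
  have c: "cos (2 * pi * (real i - real j) / real 3) = (if i = j then 1 else -1/2)" if "i < 3" "j < 3" for i j
    using cos_third_turn[OF that] by simp
  have hh: "ring_pt 3 h i \<bullet> ring_pt 3 h j = (if i = j then 1 else - t)" if "i < 3" "j < 3" for i j
    unfolding inner_ring_pt c[OF that] using h2 t(1) by (simp add: power2_eq_square field_simps)
  have tt: "ring_pt 3 (- t) i \<bullet> ring_pt 3 (- t) j = (if i = j then 1 else (3 * t\<^sup>2 - 1) / 2)" if "i < 3" "j < 3" for i j
    unfolding inner_ring_pt c[OF that] using t2 by (simp add: power2_eq_square field_simps)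
  have ht: "ring_pt 3 h i \<bullet> ring_pt 3 (- t) j = (if i = j then 2 * t * (1 - h) - h * t else - t)" if "i < 3" "j < 3" for i j
    unfolding inner_ring_pt c[OF that] power2_minus pentagon_sqrt[OF h t] by (simp add: field_simps)
  have th: "ring_pt 3 (- t) i \<bullet> ring_pt 3 h j = (if i = j then 2 * t * (1 - h) - h * t else - t)" if "i < 3" "j < 3" for i j
    using ht[OF that(2,1)] by (simp add: inner_commute)
  have "(3 * t - 1) * (t + 1) > 0" using b by simp
  then have tt': "- t < (3 * t\<^sup>2 - 1) / 2" by (simp add: power2_eq_square algebra_simps)
  have "3 * h * t < 3 * t" using h b by simp
  then have ht': "- t < 2 * t * (1 - h) - h * t" by (simp add: algebra_simps)
  have norm: "norm (ring_pt 3 h i) = 1" "norm (ring_pt 3 (- t) i) = 1" for i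
    using norm_ring_pt[of h 3 i] norm_ring_pt[of "- t" 3 i] h b by auto
  show ?thesis
    unfolding realizes_def pts7_def graph7_eq
    using b h tt' ht' by (simp add: norm norm_vec3 hh tt ht th inner_pole_ring_pt)
qed

lemma realizes_graph8:
  fixes p0 p1 p2 p3 p4 p5 p6 p7 :: "real^3"
  assumes "0 < r" "r < 1"
    "norm p0 = 1" "norm p1 = 1" "norm p2 = 1" "norm p3 = 1" "norm p4 = 1" "norm p5 = 1" "norm p6 = 1" "norm p7 = 1"
    "p0 \<bullet> p1 = - r" "p0 \<bullet> p2 = - r" "p0 \<bullet> p3 = - r" "p0 \<bullet> p4 = - r" "p0 \<bullet> p5 = - r"
    "p1 \<bullet> p2 = - r" "p1 \<bullet> p3 = - r" "p2 \<bullet> p4 = - r" "p2 \<bullet> p6 = - r" "p3 \<bullet> p5 = - r" "p3 \<bullet> p7 = - r"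
    "p4 \<bullet> p7 = - r" "p5 \<bullet> p6 = - r" "p6 \<bullet> p7 = - r"
    "- r < p0 \<bullet> p6" "- r < p0 \<bullet> p7" "- r < p1 \<bullet> p4" "- r < p1 \<bullet> p5" "- r < p1 \<bullet> p6" "- r < p1 \<bullet> p7"
    "- r < p2 \<bullet> p3" "- r < p2 \<bullet> p5" "- r < p2 \<bullet> p7" "- r < p3 \<bullet> p4" "- r < p3 \<bullet> p6"
    "- r < p4 \<bullet> p5" "- r < p4 \<bullet> p6" "- r < p5 \<bullet> p7"
  shows "realizes [p0, p1, p2, p3, p4, p5, p6, p7] r graph8"
proof -
  have self: "p \<bullet> p = 1" if "norm p = 1" for p :: "real^3" using that by (simp add: dot_square_norm)
  have lt: "- r \<le> x \<and> x \<noteq> - r" if "- r < x" for x using that by simp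
  note low = assms(25-38)[THEN lt]
  have low': "- r \<le> y \<bullet> x \<and> y \<bullet> x \<noteq> - r" if "- r \<le> x \<bullet> y \<and> x \<bullet> y \<noteq> - r" for x y :: "real^3"
    using that by (simp add: inner_commute)
  have eq': "y \<bullet> x = - r" if "x \<bullet> y = - r" for x y :: "real^3" using that by (simp add: inner_commute)
  show ?thesis
    unfolding realizes_def graph8_eq
    using low low[THEN low'] assms(11-24)[THEN eq'] assms(1-24) by (simp add: self)
qed

text \<open>The points are symmetric under the reflection in the first coordinate. The five neighbours of
  the pole lie at height \<open>- r\<close> and consecutive ones differ by a rotation by the angle with cosine
  \<open>x\<close> and sine \<open>y\<close>; the remaining two points turn out to have height \<open>r\<close>, and \<open>r\<close> is determined
  by the equation for \<open>f * s * q\<close>.\<close>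

lemma exists_pts8:
  "\<exists>xs r. realizes xs r graph8"
proof -
  \<comment> \<open>The polynomial arises from \<open>f * s * q * (1 + r) = r * k\<^sup>2\<close>
    below by squaring, inserting the values of the squares and cancelling
    \<open>(1 - r) / 2\<close>.\<close>
  let ?f = "\<lambda>r::real. - ((1 + r)^4 * (1 - 2 * r) - 2 * r^2 * (1 - r)^3)"
  have "\<exists>r. 49/100 \<le> r \<and> r \<le> 1/2 \<and> ?f r = 0"
    by (rule IVT') (auto simp: power_divide intro!: continuous_intros)
  then obtain r :: real where r: "49/100 \<le> r" "r \<le> 1/2" and root: "(1 + r)^4 * (1 - 2 * r) = 2 * r^2 * (1 - r)^3" by auto
  have "r \<noteq> 1/2"
  proof
    assume e: "r = 1/2"
    show False using root[unfolded e] by (simp add: power_divide)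
  qed
  then have r2: "r < 1/2" using r by simp
  define k where "k = 1 - r"
  define s where "s = sqrt (1 - r\<^sup>2)"
  define q where "q = sqrt (1 - 2 * r)"
  \<comment> \<open>For the last two points, with coordinates \<open>- f, g, r\<close> and
    \<open>f, g, r\<close>, unit length and inner product \<open>- r\<close> amount to
    \<open>2 * f\<^sup>2 = 1 + r\<close> and
    \<open>g\<^sup>2 = f\<^sup>2 * (1 - 2 * r)\<close>.\<close>
  define f where "f = sqrt ((1 + r) / 2)"
  \<comment> \<open>Consecutive points at height \<open>- r\<close> are adjacent iff
    \<open>s\<^sup>2 * x + r\<^sup>2 = - r\<close>, which determines the cosine \<open>x\<close>.
    The sine \<open>y\<close> is nonzero and real because \<open>r < 1/2\<close>.\<close>
  define x where "x = - r / k"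
  define y where "y = q / k"
  define g where "g = f * q"
  have k: "k > 1/2" "k \<le> 51/100" using r r2 by (auto simp: k_def)
  have "r\<^sup>2 < 1" using r r2 by (simp add: abs_square_less_1)
  then have s: "s > 0" "s\<^sup>2 = 1 - r\<^sup>2" by (auto simp: s_def)
  have q: "q > 0" "q\<^sup>2 = 1 - 2 * r" using r2 by (auto simp: q_def)
  have f: "f > 0" "f\<^sup>2 = (1 + r) / 2" using r by (auto simp: f_def)
  have kx: "k * x = - r" and ky: "k * y = q" using k by (auto simp: x_def y_def)
  have fsq: "f * s * q * (1 + r) = r * k\<^sup>2"
  proof -
    have "(f * s * q * (1 + r))\<^sup>2 = f\<^sup>2 * s\<^sup>2 * q\<^sup>2 * (1 + r)\<^sup>2" by (simp add: power_mult_distrib)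
    also have "\<dots> = (1 + r)^4 * (1 - 2 * r) * (1 - r) / 2"
      unfolding f s q by (simp add: field_simps power2_eq_square power4_eq_xxxx)
    also have "\<dots> = (r * k\<^sup>2)\<^sup>2" unfolding root k_def by (simp add: field_simps power2_eq_square power3_eq_cube)
    finally show ?thesis using f s q r k by (simp add: power2_eq_iff_nonneg)
  qed
  have xy: "x\<^sup>2 + y\<^sup>2 = 1"
  proof -
    have "k\<^sup>2 * (x\<^sup>2 + y\<^sup>2) = (k * x)\<^sup>2 + (k * y)\<^sup>2" by (simp add: algebra_simps power2_eq_square)
    also have "\<dots> = k\<^sup>2" unfolding kx ky using q by (simp add: k_def power2_eq_square algebra_simps)
    finally show ?thesis using k by simp
  qed
  have sx: "s\<^sup>2 * x = - r * (1 + r)"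
  proof -
    have "k * (s\<^sup>2 * x) = s\<^sup>2 * (k * x)" by simp
    also have "\<dots> = (1 - r\<^sup>2) * - r" by (simp only: kx s(2))
    also have "\<dots> = k * (- r * (1 + r))" by (simp add: k_def power2_eq_square algebra_simps)
    finally show ?thesis using k by (simp only: mult_cancel_left) simp
  qed
  have y0: "y > 0" using q k by (simp add: y_def)
  have y2: "y\<^sup>2 < 1/10"
  proof -
    have "k\<^sup>2 * y\<^sup>2 = q\<^sup>2" using ky by (metis power_mult_distrib)
    moreover have "k\<^sup>2 > (1/2)\<^sup>2" using k by (intro power_strict_mono) auto
    then have "1/4 * y\<^sup>2 < k\<^sup>2 * y\<^sup>2" using y0 by (intro mult_strict_right_mono) (auto simp: power_divide)
    ultimately show ?thesis using q r by simp
  qed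
  have x2: "x\<^sup>2 = 1 - y\<^sup>2" using xy by simp
  have s2: "s\<^sup>2 > 0" using s(1) by (rule zero_less_power)
  have fy: "f * s * y - g * s * x - r\<^sup>2 + 2 * r\<^sup>2 = f * s * q * (1 + r) / k + r\<^sup>2"
  proof -
    have "k * (f * s * y - g * s * x) = f * s * (k * y) - g * s * (k * x)" by (simp add: algebra_simps)
    also have "\<dots> = f * s * q * (1 + r)" unfolding kx ky g_def by (simp add: algebra_simps)
    finally have "f * s * y - g * s * x = f * s * q * (1 + r) / k" using k by (simp add: field_simps)
    then show ?thesis by simp
  qed
  have rk: "f * s * q * (1 + r) / k = r * k" unfolding fsq using k by (simp add: power2_eq_square)
  \<comment> \<open>This relation and \<open>fsx2\<close> express the adjacency of point 2 with 6
    and of point 4 with 7. Both reduce to the single equation \<open>fsq\<close>, so one parameter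
    is enough.\<close>
  have fsgx: "f * s * y - g * s * x = r * k" using fy rk by simp
  have rr: "r * k = r - r\<^sup>2" by (simp add: k_def power2_eq_square algebra_simps)
  have fsx2: "f * s * (2 * x * y) + g * s * (2 * x\<^sup>2 - 1) = - (r * k)"
  proof -
    have "k\<^sup>2 * (f * s * (2 * x * y) + g * s * (2 * x\<^sup>2 - 1)) =
        f * s * (2 * (k * x) * (k * y)) + g * s * (2 * (k * x)\<^sup>2 - k\<^sup>2)"
      by (simp add: algebra_simps power2_eq_square)
    also have "\<dots> = f * s * q * (- 2 * r + 2 * r\<^sup>2 - k\<^sup>2)"
      unfolding kx ky g_def by (simp add: algebra_simps power2_eq_square)
    also have "- 2 * r + 2 * r\<^sup>2 - k\<^sup>2 = - (1 + r) * k" by (simp add: k_def algebra_simps power2_eq_square)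
    also have "f * s * q * (- (1 + r) * k) = - (f * s * q * (1 + r)) * k" by (simp add: algebra_simps)
    also have "\<dots> = k\<^sup>2 * (- (r * k))" unfolding fsq by (simp add: power2_eq_square)
    finally show ?thesis using k by (simp only: mult_cancel_left) simp
  qed
  have pos1: "0 < f * s * y + g * s * x"
  proof -
    have "k * (f * s * y + g * s * x) = f * s * (k * y) + g * s * (k * x)" by (simp add: algebra_simps)
    also have "\<dots> = f * s * q * k" unfolding kx ky g_def by (simp add: k_def algebra_simps)
    finally have "f * s * y + g * s * x = f * s * q" using k by simp
    then show ?thesis using f s q by simp
  qed
  have pos2: "0 < g * s * (2 * x\<^sup>2 - 1) - f * s * (2 * x * y)"
  proof -
    have "x < 0" using k r by (simp add: x_def)
    then have "f * s * (2 * x * y) < 0" using f s y0 by (simp add: mult_less_0_iff zero_less_mult_iff)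
    moreover have "g * s * (2 * x\<^sup>2 - 1) > 0" using f s q x2 y2 by (simp add: g_def)
    ultimately show ?thesis by simp
  qed
  have r0: "0 < r" "r\<^sup>2 < r" "0 \<le> r\<^sup>2" using r r2 by (auto simp: power2_eq_square)
  \<comment> \<open>\<open>ring\<close>, \<open>ring3\<close> and \<open>ring4\<close> treat points
    that are two, three and four rotation steps apart; the polynomials in \<open>x\<close> and
    \<open>y\<close> are the cosines of the multiple angles.\<close>
  have ring: "- r < s\<^sup>2 * (2 * x\<^sup>2 - 1) + r\<^sup>2"
  proof -
    have "s\<^sup>2 * (2 * x\<^sup>2 - 1) > 0" using s2 x2 y2 by simp
    then show ?thesis using r0 by linarith
  qed
  have ring3: "- r < s\<^sup>2 * (4 * x^3 - 3 * x) + r\<^sup>2"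
  proof -
    have "s\<^sup>2 * (4 * x^3 - 3 * x) = (s\<^sup>2 * x) * (4 * x\<^sup>2 - 3)" by (simp add: algebra_simps power2_eq_square power3_eq_cube)
    also have "\<dots> = - r * (1 + r) * (1 - 4 * y\<^sup>2)" unfolding sx x2 by simp
    also have "\<dots> = r * (1 + r) * (4 * y\<^sup>2) - r - r\<^sup>2" by (simp add: power2_eq_square algebra_simps)
    finally have "s\<^sup>2 * (4 * x^3 - 3 * x) = r * (1 + r) * (4 * y\<^sup>2) - r - r\<^sup>2" .
    moreover have "0 < r * (1 + r) * (4 * y\<^sup>2)"
      using r0(1) y0 by (intro mult_pos_pos) auto
    ultimately show ?thesis by linarith
  qed
  have ring4: "- r < s\<^sup>2 * ((2 * x\<^sup>2 - 1)\<^sup>2 - (2 * x * y)\<^sup>2) + r\<^sup>2"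
  proof -
    have "(2 * x\<^sup>2 - 1)\<^sup>2 - (2 * x * y)\<^sup>2 = 1 - 8 * y\<^sup>2 + 8 * y\<^sup>2 * y\<^sup>2"
      unfolding power_mult_distrib x2 by (simp add: power2_eq_square algebra_simps)
    moreover have "0 \<le> 8 * y\<^sup>2 * y\<^sup>2" by simp
    ultimately have "(2 * x\<^sup>2 - 1)\<^sup>2 - (2 * x * y)\<^sup>2 > 0" using y2 by linarith
    from mult_pos_pos[OF s2 this] show ?thesis using r0 by linarith
  qed
  have c2: "(2 * x * y)\<^sup>2 + (2 * x\<^sup>2 - 1)\<^sup>2 = 1"
    unfolding power_mult_distrib x2 by (simp add: power2_eq_square algebra_simps)
  have f67: "- (f\<^sup>2) + g\<^sup>2 + r\<^sup>2 = - r" "f\<^sup>2 + g\<^sup>2 + r\<^sup>2 = 1"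
    unfolding g_def power_mult_distrib q f by (simp_all add: field_simps power2_eq_square)
  have norm: "norm (vec3 (s * a) (s * b) (- r)) = 1" if "a\<^sup>2 + b\<^sup>2 = 1" for a b
  proof -
    have "(s * a)\<^sup>2 + (s * b)\<^sup>2 + r\<^sup>2 = s\<^sup>2 * (a\<^sup>2 + b\<^sup>2) + r\<^sup>2" by (simp add: power_mult_distrib algebra_simps)
    then show ?thesis using s that by (simp add: norm_vec3)
  qed
  have "realizes [vec3 0 0 1, vec3 (s * 0) (s * 1) (- r), vec3 (s * y) (s * x) (- r), vec3 (s * - y) (s * x) (- r),
    vec3 (s * (2 * x * y)) (s * (2 * x\<^sup>2 - 1)) (- r), vec3 (s * - (2 * x * y)) (s * (2 * x\<^sup>2 - 1)) (- r),
    vec3 (- f) g r, vec3 f g r] r graph8"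
  proof (rule realizes_graph8)
    have a24: "s * y * (s * (2 * x * y)) + s * x * (s * (2 * x\<^sup>2 - 1)) + - r * - r = - r"
    proof -
      have "s * y * (s * (2 * x * y)) + s * x * (s * (2 * x\<^sup>2 - 1)) = (s\<^sup>2 * x) * (2 * (x\<^sup>2 + y\<^sup>2) - 1)"
        by (simp add: power2_eq_square algebra_simps)
      then show ?thesis unfolding xy sx by (simp add: power2_eq_square algebra_simps)
    qed
    have a25: "- r < s * y * (s * - (2 * x * y)) + s * x * (s * (2 * x\<^sup>2 - 1)) + - r * - r"
    proof -
      have "s * y * (s * - (2 * x * y)) + s * x * (s * (2 * x\<^sup>2 - 1)) = s\<^sup>2 * (2 * x^3 - x - 2 * x * y\<^sup>2)"
        by (simp add: power2_eq_square power3_eq_cube algebra_simps)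
      also have "y\<^sup>2 = 1 - x\<^sup>2" using xy by simp
      also have "2 * x^3 - x - 2 * x * (1 - x\<^sup>2) = 4 * x^3 - 3 * x" by (simp add: power2_eq_square power3_eq_cube algebra_simps)
      finally show ?thesis using ring3 by (simp add: power2_eq_square)
    qed
    have a45: "- r < s * (2 * x * y) * (s * - (2 * x * y)) + s * (2 * x\<^sup>2 - 1) * (s * (2 * x\<^sup>2 - 1)) + - r * - r"
      using ring4 by (simp add: power2_eq_square algebra_simps)
    have a23: "- r < s * y * (s * - y) + s * x * (s * x) + - r * - r"
    proof -
      have "s * y * (s * - y) + s * x * (s * x) = s\<^sup>2 * (x\<^sup>2 - y\<^sup>2)" by (simp add: power2_eq_square algebra_simps)
      also have "x\<^sup>2 - y\<^sup>2 = 2 * x\<^sup>2 - 1" using xy by simp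
      finally show ?thesis using ring by (simp add: power2_eq_square)
    qed
    have a14: "- r < s * 1 * (s * (2 * x\<^sup>2 - 1)) + - r * - r" using ring by (simp add: power2_eq_square algebra_simps)
    have a12: "s * 1 * (s * x) + - r * - r = - r" using sx by (simp add: power2_eq_square algebra_simps)
    have a16: "- r < s * 1 * g + - r * r"
    proof -
      have "s * g > 0" using s f q by (simp add: g_def)
      moreover have "s * 1 * g + - r * r = s * g - r\<^sup>2" by (simp add: power2_eq_square)
      ultimately show ?thesis using r0 by linarith
    qed
    have a26: "s * y * - f + s * x * g + - r * r = - r"
    proof -
      have "s * y * - f + s * x * g + - r * r = - (f * s * y - g * s * x) - r\<^sup>2"
        by (simp add: power2_eq_square algebra_simps)
      then show ?thesis using fsgx rr by linarith
    qed
    have a27: "- r < s * y * f + s * x * g + - r * r"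
    proof -
      have "s * y * f + s * x * g + - r * r = (f * s * y + g * s * x) - r\<^sup>2"
        by (simp add: power2_eq_square algebra_simps)
      then show ?thesis using pos1 r0 by linarith
    qed
    have a46: "- r < s * (2 * x * y) * - f + s * (2 * x\<^sup>2 - 1) * g + - r * r"
    proof -
      have "s * (2 * x * y) * - f + s * (2 * x\<^sup>2 - 1) * g + - r * r
          = (g * s * (2 * x\<^sup>2 - 1) - f * s * (2 * x * y)) - r\<^sup>2"
        by (simp add: power2_eq_square algebra_simps)
      then show ?thesis using pos2 r0 by linarith
    qed
    have a47: "s * (2 * x * y) * f + s * (2 * x\<^sup>2 - 1) * g + - r * r = - r"
    proof -
      have "s * (2 * x * y) * f + s * (2 * x\<^sup>2 - 1) * g + - r * r
          = (f * s * (2 * x * y) + g * s * (2 * x\<^sup>2 - 1)) - r\<^sup>2"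
        by (simp add: power2_eq_square algebra_simps)
      then show ?thesis using fsx2 rr by linarith
    qed
    show "vec3 (s * y) (s * x) (- r) \<bullet> vec3 (s * (2 * x * y)) (s * (2 * x\<^sup>2 - 1)) (- r) = - r"
      unfolding inner_vec3 by (rule a24)
    show "vec3 (s * - y) (s * x) (- r) \<bullet> vec3 (s * - (2 * x * y)) (s * (2 * x\<^sup>2 - 1)) (- r) = - r"
      unfolding inner_vec3 using a24 by simp
    show "- r < vec3 (s * y) (s * x) (- r) \<bullet> vec3 (s * - (2 * x * y)) (s * (2 * x\<^sup>2 - 1)) (- r)"
      unfolding inner_vec3 by (rule a25)
    show "- r < vec3 (s * - y) (s * x) (- r) \<bullet> vec3 (s * (2 * x * y)) (s * (2 * x\<^sup>2 - 1)) (- r)"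
      unfolding inner_vec3 using a25 by simp
    show "- r < vec3 (s * (2 * x * y)) (s * (2 * x\<^sup>2 - 1)) (- r) \<bullet> vec3 (s * - (2 * x * y)) (s * (2 * x\<^sup>2 - 1)) (- r)"
      unfolding inner_vec3 by (rule a45)
    show "- r < vec3 (s * y) (s * x) (- r) \<bullet> vec3 (s * - y) (s * x) (- r)"
      unfolding inner_vec3 by (rule a23)
    show "- r < vec3 (s * 0) (s * 1) (- r) \<bullet> vec3 (s * (2 * x * y)) (s * (2 * x\<^sup>2 - 1)) (- r)"
      unfolding inner_vec3 using a14 by simp
    show "- r < vec3 (s * 0) (s * 1) (- r) \<bullet> vec3 (s * - (2 * x * y)) (s * (2 * x\<^sup>2 - 1)) (- r)"
      unfolding inner_vec3 using a14 by simp
    show "vec3 (s * 0) (s * 1) (- r) \<bullet> vec3 (s * y) (s * x) (- r) = - r"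
      unfolding inner_vec3 using a12 by simp
    show "vec3 (s * 0) (s * 1) (- r) \<bullet> vec3 (s * - y) (s * x) (- r) = - r"
      unfolding inner_vec3 using a12 by simp
    show "- r < vec3 (s * 0) (s * 1) (- r) \<bullet> vec3 (- f) g r" "- r < vec3 (s * 0) (s * 1) (- r) \<bullet> vec3 f g r"
      unfolding inner_vec3 using a16 by simp_all
    show "vec3 (s * y) (s * x) (- r) \<bullet> vec3 (- f) g r = - r" unfolding inner_vec3 by (rule a26)
    show "vec3 (s * - y) (s * x) (- r) \<bullet> vec3 f g r = - r" unfolding inner_vec3 using a26 by simp
    show "- r < vec3 (s * y) (s * x) (- r) \<bullet> vec3 f g r" unfolding inner_vec3 by (rule a27)
    show "- r < vec3 (s * - y) (s * x) (- r) \<bullet> vec3 (- f) g r" unfolding inner_vec3 using a27 by simp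
    show "- r < vec3 (s * (2 * x * y)) (s * (2 * x\<^sup>2 - 1)) (- r) \<bullet> vec3 (- f) g r"
      unfolding inner_vec3 by (rule a46)
    show "- r < vec3 (s * - (2 * x * y)) (s * (2 * x\<^sup>2 - 1)) (- r) \<bullet> vec3 f g r"
      unfolding inner_vec3 using a46 by simp
    show "vec3 (s * (2 * x * y)) (s * (2 * x\<^sup>2 - 1)) (- r) \<bullet> vec3 f g r = - r"
      unfolding inner_vec3 by (rule a47)
    show "vec3 (s * - (2 * x * y)) (s * (2 * x\<^sup>2 - 1)) (- r) \<bullet> vec3 (- f) g r = - r"
      unfolding inner_vec3 using a47 by simp
    show "vec3 (- f) g r \<bullet> vec3 f g r = - r" unfolding inner_vec3 using f67(1) by (simp add: power2_eq_square)
    show "norm (vec3 (- f) g r) = 1" "norm (vec3 f g r) = 1" using f67(2) by (simp_all add: norm_vec3)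
    show "norm (vec3 (s * 0) (s * 1) (- r)) = 1" by (rule norm) simp
    show "norm (vec3 (s * y) (s * x) (- r)) = 1" by (rule norm) (use xy in simp)
    show "norm (vec3 (s * - y) (s * x) (- r)) = 1" by (rule norm) (use xy in simp)
    show "norm (vec3 (s * (2 * x * y)) (s * (2 * x\<^sup>2 - 1)) (- r)) = 1" by (rule norm) (rule c2)
    show "norm (vec3 (s * - (2 * x * y)) (s * (2 * x\<^sup>2 - 1)) (- r)) = 1" by (rule norm) (use c2 in simp)
  qed (use r0(1) r2 in \<open>simp_all add: norm_vec3\<close>)
  then show ?thesis by blast
qed

section \<open>Lovasz's construction\<close>

text \<open>For angles between 0 and \<pi> the sine is nonnegative and hence determined by the
  cosine, so the height singles out one point of a half-meridian.\<close>

lemma half_meridian_Int_parallel: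
  assumes "norm pole = 1" "norm v = 1" "pole \<bullet> v = 0" "\<bar>h\<bar> \<le> 1"
  shows "half_meridian pole v \<inter> parallel_at pole h = {h *\<^sub>R pole + sqrt (1 - h\<^sup>2) *\<^sub>R v}"
proof (intro equalityI subsetI)
  have pp: "pole \<bullet> pole = 1" "v \<bullet> v = 1" "v \<bullet> pole = 0"
    using assms by (auto simp: dot_square_norm inner_commute)
  fix x assume "x \<in> half_meridian pole v \<inter> parallel_at pole h"
  then obtain \<phi> where x: "x = cos \<phi> *\<^sub>R pole + sin \<phi> *\<^sub>R v" "0 \<le> \<phi>" "\<phi> \<le> pi" and "x \<bullet> pole = h"
    by (auto simp: half_meridian_def parallel_at_def)
  then have "cos \<phi> = h" using pp by (simp add: inner_add_left)
  moreover have "sin \<phi> = sqrt (1 - (cos \<phi>)\<^sup>2)"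
    using x(2,3) sin_ge_zero by (simp add: sin_squared_eq[symmetric])
  ultimately show "x \<in> {h *\<^sub>R pole + sqrt (1 - h\<^sup>2) *\<^sub>R v}" using x(1) by simp
next
  have pp: "pole \<bullet> pole = 1" "v \<bullet> v = 1" "v \<bullet> pole = 0"
    using assms by (auto simp: dot_square_norm inner_commute)
  have h: "-1 \<le> h" "h \<le> 1" "h\<^sup>2 \<le> 1" using assms(4) by (auto simp: abs_square_le_1)
  fix x assume "x \<in> {h *\<^sub>R pole + sqrt (1 - h\<^sup>2) *\<^sub>R v}"
  then have x: "x = h *\<^sub>R pole + sqrt (1 - h\<^sup>2) *\<^sub>R v" by simp
  have "x \<bullet> x = 1" using pp assms(3) h
    by (simp add: x inner_add_left inner_add_right) (simp add: power2_eq_square)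
  moreover have "x \<bullet> pole = h" using pp by (simp add: x inner_add_left)
  ultimately have "x \<in> parallel_at pole h" by (simp add: parallel_at_def norm_eq_sqrt_inner)
  moreover have "x = cos (arccos h) *\<^sub>R pole + sin (arccos h) *\<^sub>R v"
    using h by (simp add: x cos_arccos sin_arccos)
  then have "x \<in> half_meridian pole v"
    unfolding half_meridian_def using arccos_lbound[OF h(1,2)] arccos_ubound[OF h(1,2)] by blast
  ultimately show "x \<in> half_meridian pole v \<inter> parallel_at pole h" by blast
qed

lemma inscribed_Re_le_1:
  assumes "inscribed_tangent_polygon r0 t k x" "i \<le> 2 * k"
  shows "\<bar>Re (x i)\<bar> \<le> 1"
proof -
  have "(Re (x i))\<^sup>2 + (Im (x i) / r0)\<^sup>2 = 1"
    using assms by (auto simp: inscribed_tangent_polygon_def ellipse_def)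
  then have "(Re (x i))\<^sup>2 \<le> 1" by (smt (verit) zero_le_power2)
  then show ?thesis by (simp add: abs_square_le_1)
qed

text \<open>The map from the ellipse to the circle keeps real parts, so the heights of the parallels
  are the abscissas of the polygon itself. The pole is placed on the third coordinate axis.\<close>

lemma lovasz_polyhedronI:
  assumes l: "odd l" "l \<ge> 3" and k: "k \<ge> 1" and t: "0 < t" "t < cos (pi / real l)"
    and x: "inscribed_tangent_polygon (cos (pi / real l)) t k x"
    and P: "P = convex hull (insert (vec3 0 0 1) (\<Union>i\<in>{1..k}. ring_pt l (Re (x i)) ` {..<l}))"
  shows "lovasz_polyhedron P"
proof -
  let ?r0 = "cos (pi / real l)"
  let ?p = "vec3 0 0 1" and ?e = "vec3 1 0 0" and ?f = "vec3 0 1 0"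
  define v where "v j = cos (2 * pi * real j / real l) *\<^sub>R ?e + sin (2 * pi * real j / real l) *\<^sub>R ?f" for j
  define V where "V = {v j | j. j < l}"
  have v: "norm (v j) = 1" "?p \<bullet> v j = 0" for j by (simp_all add: v_def norm_vec3)
  have ring: "half_meridian ?p (v j) \<inter> parallel_at ?p (Re (ellipse_to_circle ?r0 (x i))) = {ring_pt l (Re (x i)) j}"
    if "i \<in> {1..k}" for i j
  proof -
    have "\<bar>Re (x i)\<bar> \<le> 1" using inscribed_Re_le_1[OF x] that by simp
    then have "half_meridian ?p (v j) \<inter> parallel_at ?p (Re (x i)) = {Re (x i) *\<^sub>R ?p + sqrt (1 - (Re (x i))\<^sup>2) *\<^sub>R v j}"
      using v by (intro half_meridian_Int_parallel) (auto simp: norm_vec3)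
    then show ?thesis by (simp add: ellipse_to_circle_def v_def ring_pt_def)
  qed
  have rings: "(\<Union>w\<in>V. \<Union>i\<in>{1..k}. half_meridian ?p w \<inter> parallel_at ?p (Re (ellipse_to_circle ?r0 (x i))))
      = (\<Union>i\<in>{1..k}. ring_pt l (Re (x i)) ` {..<l})"
  proof (intro equalityI subsetI)
    fix z assume "z \<in> (\<Union>w\<in>V. \<Union>i\<in>{1..k}. half_meridian ?p w \<inter> parallel_at ?p (Re (ellipse_to_circle ?r0 (x i))))"
    then obtain i j where i: "i \<in> {1..k}" and j: "j < l"
      and z: "z \<in> half_meridian ?p (v j) \<inter> parallel_at ?p (Re (ellipse_to_circle ?r0 (x i)))"
      unfolding V_def by blast
    have "z = ring_pt l (Re (x i)) j" using z unfolding ring[OF i] by simp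
    then show "z \<in> (\<Union>i\<in>{1..k}. ring_pt l (Re (x i)) ` {..<l})" using i j by blast
  next
    fix z assume "z \<in> (\<Union>i\<in>{1..k}. ring_pt l (Re (x i)) ` {..<l})"
    then obtain i j where i: "i \<in> {1..k}" and j: "j < l" and z: "z = ring_pt l (Re (x i)) j" by blast
    have "z \<in> half_meridian ?p (v j) \<inter> parallel_at ?p (Re (ellipse_to_circle ?r0 (x i)))"
      unfolding ring[OF i] z by simp
    then show "z \<in> (\<Union>w\<in>V. \<Union>i\<in>{1..k}. half_meridian ?p w \<inter> parallel_at ?p (Re (ellipse_to_circle ?r0 (x i))))"
      using i j unfolding V_def by blast
  qed
  show ?thesis
    unfolding lovasz_polyhedron_def
  proof (rule exI[of _ l], rule exI[of _ k], rule exI[of _ ?r0], rule exI[of _ t], rule exI[of _ x],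
      rule exI[of _ "\<lambda>i. ellipse_to_circle ?r0 (x i)"], rule exI[of _ ?p], rule exI[of _ ?e], rule exI[of _ ?f],
      rule exI[of _ V], intro conjI)
    show "V = {cos (2 * pi * real j / real l) *\<^sub>R ?e + sin (2 * pi * real j / real l) *\<^sub>R ?f | j. j < l}"
      by (simp only: V_def v_def)
    show "P = convex hull insert ?p (\<Union>w\<in>V. \<Union>i\<in>{1..k}. half_meridian ?p w \<inter> parallel_at ?p (Re (ellipse_to_circle ?r0 (x i))))"
      by (simp only: P rings)
  qed (use l k t x in \<open>simp_all add: norm_vec3 orthogonal_def\<close>)
qed

text \<open>One functional settles both claims: over \<open>S\<close> it is largest just at
  \<open>p\<close> and \<open>q\<close>, and \<open>t * norm a = \<beta>\<close> puts its supporting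
  line at distance \<open>t\<close> from the origin. An unnormalized \<open>a\<close> keeps the
  conditions on the sides polynomial.\<close>

lemma tangent_side:
  fixes a p q :: complex
  assumes "finite S" "p \<in> S" "q \<in> S" "p \<noteq> q" and t: "0 < t" and \<beta>: "0 < \<beta>" "t * norm a = \<beta>"
    and pq: "a \<bullet> p = \<beta>" "a \<bullet> q = \<beta>" and less: "\<forall>z\<in>S. z = p \<or> z = q \<or> a \<bullet> z < \<beta>"
  shows "closed_segment p q edge_of convex hull S" and "\<exists>w. affine hull {p, q} \<inter> sphere 0 t = {w}"
proof -
  have a: "a \<noteq> 0" using \<beta> by auto
  have le: "a \<bullet> z \<le> \<beta>" if "z \<in> S" for z using bspec[OF less that] pq by auto
  have "{z \<in> S. (- a) \<bullet> z = - \<beta>} = {p, q}" using assms(2,3) pq less by fastforce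
  then have seg: "convex hull S \<inter> {z. (- a) \<bullet> z = - \<beta>} = closed_segment p q"
    using convex_hull_Int_hyperplane[OF assms(1), of "- \<beta>" "- a"] le by (simp add: segment_convex_hull)
  have "convex hull S \<subseteq> {z. a \<bullet> z \<le> \<beta>}"
    by (rule hull_minimal) (use le convex_halfspace_le in auto)
  then have "(convex hull S \<inter> {z. (- a) \<bullet> z = - \<beta>}) face_of convex hull S"
    by (intro face_of_Int_supporting_hyperplane_ge) auto
  then show "closed_segment p q edge_of convex hull S"
    unfolding seg edge_of_def using \<open>p \<noteq> q\<close>
    by (simp add: segment_convex_hull aff_dim_convex_hull aff_dim_2)
  have "affine hull {p, q} = {z. a \<bullet> z = \<beta>}"
  proof (rule affine_dim_equal)
    show "affine hull {p, q} \<subseteq> {z. a \<bullet> z = \<beta>}"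
      by (rule hull_minimal) (use pq in \<open>auto simp: affine_hyperplane\<close>)
    show "aff_dim (affine hull {p, q}) = aff_dim {z. a \<bullet> z = \<beta>}"
      using \<open>p \<noteq> q\<close> a by (simp add: aff_dim_2)
  qed (auto simp: affine_hyperplane)
  moreover have "{z. a \<bullet> z = \<beta>} \<inter> sphere 0 t = {(t / norm a) *\<^sub>R a}"
  proof (intro equalityI subsetI)
    fix z assume "z \<in> {z. a \<bullet> z = \<beta>} \<inter> sphere 0 t"
    then have z: "a \<bullet> z = norm a * norm z" "norm z = t" using \<beta> by auto
    then have "norm a *\<^sub>R z = norm z *\<^sub>R a" using norm_cauchy_schwarz_eq by blast
    then have "(1 / norm a) *\<^sub>R norm a *\<^sub>R z = (1 / norm a) *\<^sub>R t *\<^sub>R a" using z by metis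
    then show "z \<in> {(t / norm a) *\<^sub>R a}" using a by simp
  next
    fix z assume "z \<in> {(t / norm a) *\<^sub>R a}"
    then show "z \<in> {z. a \<bullet> z = \<beta>} \<inter> sphere 0 t"
      using a t \<beta>(2)[symmetric] by (simp add: dot_square_norm power2_eq_square)
  qed
  ultimately show "\<exists>w. affine hull {p, q} \<inter> sphere 0 t = {w}" by auto
qed

lemma inner_Complex: "Complex a b \<bullet> Complex c d = a * c + b * d"
  by (simp add: inner_complex_def)

lemma norm_Complex_eq: "0 < t \<Longrightarrow> 0 \<le> b \<Longrightarrow> b\<^sup>2 = t\<^sup>2 * (c\<^sup>2 + d\<^sup>2) \<Longrightarrow> t * norm (Complex c d) = b"
  by (metis cmod_def complex.sel less_imp_le mult_nonneg_nonneg norm_ge_zero power2_eq_iff_nonneg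
      power_mult_distrib real_sqrt_pow2 sum_power2_ge_zero)

lemma norm_Complex_minus: "norm (Complex a (- b)) = norm (Complex a b)"
  by (simp add: cmod_def)

text \<open>The side opposite to the vertex 1 lies on the line of real part \<open>h\<close>, at
  distance \<open>- h\<close> from the origin. The choice of \<open>wheel_height\<close> gives the
  two slanted sides the same distance; for these the condition is \<open>b2\<close>.\<close>

lemma triangle_inscribed:
  assumes l: "3 \<le> l"
  defines "h \<equiv> wheel_height l" and "c \<equiv> cos (pi / real l)"
  defines "b \<equiv> c * sqrt (1 - h\<^sup>2)"
  shows "inscribed_tangent_polygon c (- h) 1 (\<lambda>i. [1, Complex h b, Complex h (- b)] ! (i mod 3))"
proof -
  note wh = wheel_height[OF l, folded h_def c_def]
  have h2: "h\<^sup>2 < 1" using wh by (auto simp: abs_square_less_1)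
  have b: "b > 0" "b\<^sup>2 = c\<^sup>2 * (1 - h\<^sup>2)" using wh h2 by (auto simp: b_def power_mult_distrib)
  let ?x = "\<lambda>i::nat. [1, Complex h b, Complex h (- b)] ! (i mod 3)"
  have upto: "{..2::nat} = {0, 1, 2}" by auto
  have S: "?x ` {..2 * 1} = {1, Complex h b, Complex h (- b)}" by (simp add: upto)
  have one: "(1 :: complex) = Complex 1 0" by (simp add: complex_eq_iff)
  have c1: "c * (1 + h) = - h"
    using wh by (auto simp: h_def wheel_height_def c_def[symmetric] field_simps)
  have b2: "b\<^sup>2 = (- h)\<^sup>2 * (b\<^sup>2 + (1 - h)\<^sup>2)"
  proof -
    have "c\<^sup>2 * (1 - h\<^sup>2) * (1 - h\<^sup>2) = (c * (1 + h))\<^sup>2 * (1 - h)\<^sup>2" by (simp add: power2_eq_square algebra_simps)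
    then have "b\<^sup>2 * (1 - h\<^sup>2) = h\<^sup>2 * (1 - h)\<^sup>2" unfolding b c1 by simp
    then show ?thesis by (simp add: algebra_simps)
  qed
  have n1: "- h * norm (Complex b (1 - h)) = b" "- h * norm (Complex b (- (1 - h))) = b"
    unfolding norm_Complex_minus using wh b b2 by (intro norm_Complex_eq; simp)+
  have n2: "- h * norm (Complex (- 1) 0) = - h" by (simp add: cmod_def)
  have el: "1 \<in> ellipse c" "Complex h b \<in> ellipse c" "Complex h (- b) \<in> ellipse c"
    using wh(4) b(2) by (auto simp: ellipse_def power_divide)
  have bh: "b * h < 0" using b wh by (simp add: mult_pos_neg)
  let ?S = "{1, Complex h b, Complex h (- b)}"
  have s01: "closed_segment (1) (Complex h b) edge_of convex hull ?S \<and>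
      (\<exists>w. affine hull {1, Complex h b} \<inter> sphere 0 (- h) = {w})"
    by (intro conjI tangent_side[of ?S "1" "Complex h b" "- h" "b" "Complex b (1 - h)", OF _ _ _ _ _ _ n1(1)])
      (use wh b bh in \<open>simp_all add: one inner_Complex algebra_simps\<close>, ((insert wh b bh, (intro conjI)?; linarith)+)?)
  have s12: "closed_segment (Complex h b) (Complex h (- b)) edge_of convex hull ?S \<and>
      (\<exists>w. affine hull {Complex h b, Complex h (- b)} \<inter> sphere 0 (- h) = {w})"
    by (intro conjI tangent_side[of ?S "Complex h b" "Complex h (- b)" "- h" "- h" "Complex (- 1) 0", OF _ _ _ _ _ _ n2])
      (use wh b in \<open>simp_all add: one inner_Complex algebra_simps\<close>, ((insert wh b, (intro conjI)?; linarith)+)?)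
  have s20: "closed_segment (Complex h (- b)) (1) edge_of convex hull ?S \<and>
      (\<exists>w. affine hull {Complex h (- b), 1} \<inter> sphere 0 (- h) = {w})"
    by (intro conjI tangent_side[of ?S "Complex h (- b)" "1" "- h" "b" "Complex b (- (1 - h))", OF _ _ _ _ _ _ n1(2)])
      (use wh b bh in \<open>simp_all add: one inner_Complex algebra_simps\<close>, ((insert wh b bh, (intro conjI)?; linarith)+)?)
  have "?x i \<in> ellipse c \<and> closed_segment (?x i) (?x (Suc i)) edge_of convex hull ?S \<and>
      (\<exists>w. affine hull {?x i, ?x (Suc i)} \<inter> sphere 0 (- h) = {w})" if "i \<le> 2 * 1" for i
  proof -
    have "i = 0 \<or> i = 1 \<or> i = 2" using that by auto
    then show ?thesis by (elim disjE; simp only:) (use s01 s12 s20 el in simp_all)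
  qed
  moreover have "inj_on ?x {..2 * 1}"
    using b wh by (auto simp: upto inj_on_def complex_eq_iff)
  ultimately show ?thesis unfolding inscribed_tangent_polygon_def S by simp
qed

text \<open>The vertical side has distance \<open>t\<close> by construction. For the sides at the
  vertex 1, tangency is the second parameter equation in the form \<open>side1\<close>; for the
  remaining two, \<open>side2\<close> takes both equations. The semi-axis \<open>1/2\<close> is
  \<open>cos (pi / 3)\<close>.\<close>

lemma pentagon_inscribed:
  assumes h: "1/10 < h" "h < 11/100" and t: "3 * h\<^sup>2 = 1 - 2 * t" "(1 + h) * (1 - t\<^sup>2) = 4 * t\<^sup>2 * (1 - h)"
  defines "b \<equiv> sqrt (1 - h\<^sup>2) / 2" and "c \<equiv> sqrt (1 - t\<^sup>2) / 2"
  shows "inscribed_tangent_polygon (1/2) t 2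
    (\<lambda>i. [1, Complex h b, Complex (- t) c, Complex (- t) (- c), Complex h (- b)] ! (i mod 5))"
proof -
  note tb = pentagon_bounds[OF h t(1)]
  have h2: "h\<^sup>2 < 1/10" and t2: "1/5 < t\<^sup>2" "t\<^sup>2 < 1"
  proof -
    show "h\<^sup>2 < 1/10" using t(1) tb by simp
    have "(12/25)\<^sup>2 < t\<^sup>2" using tb by (intro power_strict_mono) auto
    then show "1/5 < t\<^sup>2" by (simp add: power_divide)
    show "t\<^sup>2 < 1" using tb by (simp add: abs_square_less_1)
  qed
  have b: "b > 0" "b\<^sup>2 = (1 - h\<^sup>2) / 4" and c: "c > 0" "c\<^sup>2 = (1 - t\<^sup>2) / 4"
    using h2 t2 by (auto simp: b_def c_def power_divide)
  have bc: "b * c = t * (1 - h) / 2" using pentagon_sqrt[OF h t] by (simp add: b_def c_def)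
  have "c\<^sup>2 < b\<^sup>2" using b c h2 t2 by simp
  then have cb: "c < b" using b c by (simp add: power2_less_imp_less)
  let ?x = "\<lambda>i::nat. [1, Complex h b, Complex (- t) c, Complex (- t) (- c), Complex h (- b)] ! (i mod 5)"
  let ?S = "{1, Complex h b, Complex (- t) c, Complex (- t) (- c), Complex h (- b)}"
  have upto: "{..4::nat} = {0, 1, 2, 3, 4}" by auto
  have S: "?x ` {..2 * 2} = ?S" by (simp add: upto)
  have one: "(1 :: complex) = Complex 1 0" by (simp add: complex_eq_iff)
  have side1: "b\<^sup>2 = t\<^sup>2 * (b\<^sup>2 + (1 - h)\<^sup>2)"
  proof -
    have "4 * (b\<^sup>2 * (1 - t\<^sup>2)) = (1 - h) * ((1 + h) * (1 - t\<^sup>2))" unfolding b by (simp add: power2_eq_square field_simps)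
    also have "\<dots> = 4 * (t\<^sup>2 * (1 - h)\<^sup>2)" unfolding t(2) by (simp add: power2_eq_square algebra_simps)
    finally show ?thesis by (simp add: algebra_simps)
  qed
  have side2: "(h * c + t * b)\<^sup>2 = t\<^sup>2 * ((c - b)\<^sup>2 + (t + h)\<^sup>2)"
  proof -
    \<comment> \<open>The second parameter equation is linear in \<open>h\<close>. Combined with the
      first it annihilates the polynomial in \<open>K\<close>, which is a factor of the defect in
      the tangency condition.\<close>
    have B: "h * (1 + 3 * t\<^sup>2) = 5 * t\<^sup>2 - 1" using t(2) by (simp add: algebra_simps)
    have "(1 + 3 * t\<^sup>2) * (1 + t - 9 * t\<^sup>2 + 3 * t^3 + 12 * t\<^sup>2 * h) = 0"
      using B t(1) by algebra
    moreover have "1 + 3 * t\<^sup>2 > 0" using t2 by simp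
    ultimately have K: "1 + t - 9 * t\<^sup>2 + 3 * t^3 + 12 * t\<^sup>2 * h = 0" by simp
    have "12 * ((h * c + t * b)\<^sup>2 - t\<^sup>2 * ((c - b)\<^sup>2 + (t + h)\<^sup>2)) = (1 - 3 * t) * (1 + t - 9 * t\<^sup>2 + 3 * t^3 + 12 * t\<^sup>2 * h)"
      using b(2) c(2) bc t(1) by algebra
    then show ?thesis unfolding K by simp
  qed
  have pos2: "0 < h * c + t * b" using h b c tb by (simp add: add_pos_pos)
  have n1: "t * norm (Complex b (1 - h)) = b" "t * norm (Complex b (- (1 - h))) = b"
    unfolding norm_Complex_minus using b(1) side1 tb by (intro norm_Complex_eq; simp)+
  have n2: "t * norm (Complex (c - b) (t + h)) = h * c + t * b" "t * norm (Complex (c - b) (- (t + h))) = h * c + t * b"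
    unfolding norm_Complex_minus using pos2 side2 tb by (intro norm_Complex_eq; simp)+
  have n3: "t * norm (Complex (- 1) 0) = t" by (simp add: cmod_def)
  have el: "1 \<in> ellipse (1/2)" "Complex h b \<in> ellipse (1/2)" "Complex (- t) c \<in> ellipse (1/2)"
    "Complex (- t) (- c) \<in> ellipse (1/2)" "Complex h (- b) \<in> ellipse (1/2)"
    using b(2) c(2) by (auto simp: ellipse_def power_mult_distrib)
  have hb: "0 < b * h" "b * h < b" "0 < b * t" "0 < c * h" "c * h < c" "0 < c * t" "c * t < c"
    using h b c tb by auto
  note facts = h tb b(1) c(1) cb hb
  have s1: "closed_segment (1) (Complex h b) edge_of convex hull ?S \<and>
      (\<exists>w. affine hull {1, Complex h b} \<inter> sphere 0 (t) = {w})"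
    by (intro conjI tangent_side[of ?S "1" "Complex h b" "t" "b" "Complex b (1 - h)", OF _ _ _ _ _ _ n1(1)])
      (use facts in \<open>simp_all add: one inner_Complex algebra_simps\<close>, ((insert facts, (intro conjI)?; linarith)+)?)
  have s2: "closed_segment (Complex h b) (Complex (- t) c) edge_of convex hull ?S \<and>
      (\<exists>w. affine hull {Complex h b, Complex (- t) c} \<inter> sphere 0 (t) = {w})"
    by (intro conjI tangent_side[of ?S "Complex h b" "Complex (- t) c" "t" "h * c + t * b" "Complex (c - b) (t + h)", OF _ _ _ _ _ _ n2(1)])
      (use facts in \<open>simp_all add: one inner_Complex algebra_simps\<close>, ((insert facts, (intro conjI)?; linarith)+)?)
  have s3: "closed_segment (Complex (- t) c) (Complex (- t) (- c)) edge_of convex hull ?S \<and>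
      (\<exists>w. affine hull {Complex (- t) c, Complex (- t) (- c)} \<inter> sphere 0 (t) = {w})"
    by (intro conjI tangent_side[of ?S "Complex (- t) c" "Complex (- t) (- c)" "t" "t" "Complex (- 1) 0", OF _ _ _ _ _ _ n3])
      (use facts in \<open>simp_all add: one inner_Complex algebra_simps\<close>, ((insert facts, (intro conjI)?; linarith)+)?)
  have s4: "closed_segment (Complex (- t) (- c)) (Complex h (- b)) edge_of convex hull ?S \<and>
      (\<exists>w. affine hull {Complex (- t) (- c), Complex h (- b)} \<inter> sphere 0 (t) = {w})"
    by (intro conjI tangent_side[of ?S "Complex (- t) (- c)" "Complex h (- b)" "t" "h * c + t * b" "Complex (c - b) (- (t + h))", OF _ _ _ _ _ _ n2(2)])
      (use facts in \<open>simp_all add: one inner_Complex algebra_simps\<close>, ((insert facts, (intro conjI)?; linarith)+)?)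
  have s5: "closed_segment (Complex h (- b)) (1) edge_of convex hull ?S \<and>
      (\<exists>w. affine hull {Complex h (- b), 1} \<inter> sphere 0 (t) = {w})"
    by (intro conjI tangent_side[of ?S "Complex h (- b)" "1" "t" "b" "Complex b (- (1 - h))", OF _ _ _ _ _ _ n1(2)])
      (use facts in \<open>simp_all add: one inner_Complex algebra_simps\<close>, ((insert facts, (intro conjI)?; linarith)+)?)
  have "?x i \<in> ellipse (1/2) \<and> closed_segment (?x i) (?x (Suc i)) edge_of convex hull ?S \<and>
      (\<exists>w. affine hull {?x i, ?x (Suc i)} \<inter> sphere 0 t = {w})" if "i \<le> 2 * 2" for i
  proof -
    have "i = 0 \<or> i = 1 \<or> i = 2 \<or> i = 3 \<or> i = 4" using that by auto
    then show ?thesis by (elim disjE; simp only:) (use s1 s2 s3 s4 s5 el in simp_all)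
  qed
  moreover have "inj_on ?x {..2 * 2}"
    using facts by (auto simp: upto inj_on_def complex_eq_iff)
  ultimately show ?thesis unfolding inscribed_tangent_polygon_def S by simp
qed

section \<open>The exceptional polyhedron\<close>

lemma vertices_linear_image:
  assumes "linear g" "inj g"
  shows "vertices (g ` F) = g ` vertices F"
proof -
  have "z \<in> vertices F \<longleftrightarrow> g z \<in> vertices (g ` F)" for z
    using face_of_linear_image[OF assms, of "{z}" F] by (simp add: vertices_def face_of_singleton)
  moreover have "vertices (g ` F) \<subseteq> g ` F" by (auto simp: vertices_def extreme_point_of_def)
  ultimately show ?thesis by blast
qed

lemma facet_linear_image:
  fixes g :: "'a::euclidean_space \<Rightarrow> 'a"
  assumes "linear g" "inj g" "F \<in> facets Q"
  shows "g ` F \<in> facets (g ` Q)"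
  using assms face_of_linear_image[OF assms(1,2), of F Q]
  by (auto simp: facets_def facet_of_def)

lemma unique_size:
  assumes A: "finite A" and eq: "image_mset g (mset_set A) = add_mset a M" and "a \<notin># M"
  shows "\<exists>F. {G \<in> A. g G = a} = {F}"
proof -
  have "count (image_mset g (mset_set A)) a = (\<Sum>x | x \<in># mset_set A \<and> a = g x. count (mset_set A) x)"
    by (rule count_image_mset')
  also have "\<dots> = (\<Sum>x \<in> {G \<in> A. g G = a}. 1)"
    by (rule sum.cong) (use A in auto)
  also have "\<dots> = card {G \<in> A. g G = a}" by simp
  finally have "card {G \<in> A. g G = a} = 1" using eq assms(3) by (simp add: not_in_iff)
  then show ?thesis by (simp add: card_1_singleton_iff)
qed

locale polar_rings =
  fixes pole e f :: "real^3" and l :: nat and H :: "real set"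
  assumes orthonormal: "pole \<bullet> pole = 1" "e \<bullet> e = 1" "f \<bullet> f = 1" "pole \<bullet> e = 0" "pole \<bullet> f = 0" "e \<bullet> f = 0"
    and l: "odd l" "3 \<le> l" and H: "finite H" "\<And>h. h \<in> H \<Longrightarrow> \<bar>h\<bar> \<le> 1"
begin

lemma orthonormal' [simp]:
  "pole \<bullet> pole = 1" "e \<bullet> e = 1" "f \<bullet> f = 1" "pole \<bullet> e = 0" "pole \<bullet> f = 0" "e \<bullet> f = 0"
  "e \<bullet> pole = 0" "f \<bullet> pole = 0" "f \<bullet> e = 0"
  using orthonormal by (simp_all add: inner_commute)

definition v :: "nat \<Rightarrow> real^3" where
  "v j = cos (2 * pi * real j / real l) *\<^sub>R e + sin (2 * pi * real j / real l) *\<^sub>R f"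

definition pt :: "real \<Rightarrow> nat \<Rightarrow> real^3" where
  "pt h j = h *\<^sub>R pole + sqrt (1 - h\<^sup>2) *\<^sub>R v j"

definition S :: "(real^3) set" where
  "S = insert pole {pt h j | h j. h \<in> H \<and> j < l}"

definition rot :: "real^3 \<Rightarrow> real^3" where
  "rot x = (x \<bullet> pole) *\<^sub>R pole
     + (cos (2 * pi / real l) * (x \<bullet> e) - sin (2 * pi / real l) * (x \<bullet> f)) *\<^sub>R e
     + (sin (2 * pi / real l) * (x \<bullet> e) + cos (2 * pi / real l) * (x \<bullet> f)) *\<^sub>R f"

lemma l_pos: "real l > 0" using l by simp

lemma inner_v: "v i \<bullet> v j = cos (2 * pi * (real i - real j) / real l)" "v i \<bullet> pole = 0" "pole \<bullet> v i = 0"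
proof -
  have "2 * pi * (real i - real j) / real l = 2 * pi * real i / real l - 2 * pi * real j / real l"
    by (simp add: diff_divide_distrib right_diff_distrib)
  then show "v i \<bullet> v j = cos (2 * pi * (real i - real j) / real l)"
    unfolding v_def by (simp only: cos_diff) (simp add: inner_add_left inner_add_right)
qed (simp_all add: v_def inner_add_left inner_add_right)

lemma v_l: "v l = v 0"
  using l_pos by (simp add: v_def)

lemma pt_pole: "pt h j \<bullet> pole = h"
  by (simp add: pt_def inner_add_left inner_v)

lemma norm_pt: "\<bar>h\<bar> \<le> 1 \<Longrightarrow> norm (pt h j) = 1"
proof -
  assume "\<bar>h\<bar> \<le> 1"
  then have "h\<^sup>2 \<le> 1" by (simp add: abs_square_le_1)
  then have "pt h j \<bullet> pt h j = 1"
    by (simp add: pt_def inner_add_left inner_add_right inner_v) (simp add: power2_eq_square)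
  then show ?thesis by (simp add: norm_eq_sqrt_inner)
qed

lemma S_sphere: "finite S" "S \<subseteq> sphere 0 1"
proof -
  have "{pt h j | h j. h \<in> H \<and> j < l} = (\<lambda>(h, j). pt h j) ` (H \<times> {..<l})" by auto
  then show "finite S" using H(1) by (simp add: S_def)
  show "S \<subseteq> sphere 0 1" using norm_pt H(2) by (auto simp: S_def norm_eq_sqrt_inner)
qed

lemma expansion: "x = (x \<bullet> pole) *\<^sub>R pole + (x \<bullet> e) *\<^sub>R e + (x \<bullet> f) *\<^sub>R f"
proof -
  have p: "pole \<noteq> 0" using orthonormal(1) by force
  obtain \<alpha> \<beta> where ab: "x - (x \<bullet> pole) *\<^sub>R pole = \<alpha> *\<^sub>R e + \<beta> *\<^sub>R f"
    using plane_combination[of pole e f "x - (x \<bullet> pole) *\<^sub>R pole" f e] p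
    by (auto simp: inner_diff_right inner_commute)
  have "(x - (x \<bullet> pole) *\<^sub>R pole) \<bullet> e = \<alpha>" "(x - (x \<bullet> pole) *\<^sub>R pole) \<bullet> f = \<beta>"
    unfolding ab by (simp_all add: inner_add_left)
  then have "x \<bullet> e = \<alpha>" "x \<bullet> f = \<beta>" by (simp_all add: inner_diff_left)
  then show ?thesis using ab by (simp add: algebra_simps)
qed

lemma linear_rot: "linear rot"
  by (rule linearI) (simp_all add: rot_def inner_add_left algebra_simps)

lemma inj_rot: "inj rot"
proof -
  have "x = 0" if "rot x = 0" for x
  proof -
    let ?c = "cos (2 * pi / real l)" and ?s = "sin (2 * pi / real l)"
    have 0: "rot x \<bullet> pole = 0" "rot x \<bullet> e = 0" "rot x \<bullet> f = 0" using that by simp_all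
    then have 1: "x \<bullet> pole = 0" "?c * (x \<bullet> e) - ?s * (x \<bullet> f) = 0" "?s * (x \<bullet> e) + ?c * (x \<bullet> f) = 0"
      by (simp_all add: rot_def inner_add_left)
    have *: "(c * a - s * b)\<^sup>2 + (s * a + c * b)\<^sup>2 = (s\<^sup>2 + c\<^sup>2) * (a\<^sup>2 + b\<^sup>2)" for a b c s :: real
      by (simp add: power2_eq_square algebra_simps)
    from *[of ?c "x \<bullet> e" ?s "x \<bullet> f"] have "(x \<bullet> e)\<^sup>2 + (x \<bullet> f)\<^sup>2 = 0" unfolding 1 by simp
    then have "x \<bullet> e = 0" "x \<bullet> f = 0" by (simp_all add: sum_power2_eq_zero_iff)
    then show ?thesis using expansion[of x] 1(1) by simp
  qed
  then show ?thesis using linear_injective_0[OF linear_rot] by blast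
qed

lemma rot_v: "rot (v j) = v (Suc j)"
proof -
  have "2 * pi * real (Suc j) / real l = 2 * pi * real j / real l + 2 * pi / real l"
    by (simp add: add_divide_distrib algebra_simps)
  then have *: "v (Suc j) = (cos (2 * pi * real j / real l) * cos (2 * pi / real l) - sin (2 * pi * real j / real l) * sin (2 * pi / real l)) *\<^sub>R e
      + (sin (2 * pi * real j / real l) * cos (2 * pi / real l) + cos (2 * pi * real j / real l) * sin (2 * pi / real l)) *\<^sub>R f"
    unfolding v_def by (simp only: cos_add sin_add)
  have "v j \<bullet> e = cos (2 * pi * real j / real l)" "v j \<bullet> f = sin (2 * pi * real j / real l)"
    by (simp_all add: v_def inner_add_left)
  then show ?thesis unfolding * rot_def inner_v by (simp add: mult.commute add.commute)
qed

lemma rot_pole: "rot pole = pole"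
  by (simp add: rot_def)

lemma rot_pt: "rot (pt h j) = pt h (Suc j)"
  by (simp add: pt_def linear_add[OF linear_rot] linear_scale[OF linear_rot] rot_pole rot_v)

lemma rot_S: "rot ` S = S"
proof -
  have "rot ` {pt h j | h j. h \<in> H \<and> j < l} = {pt h j | h j. h \<in> H \<and> j < l}"
  proof (intro equalityI subsetI)
    fix x assume "x \<in> rot ` {pt h j | h j. h \<in> H \<and> j < l}"
    then obtain h j where hj: "h \<in> H" "j < l" "x = pt h (Suc j)" using rot_pt by auto
    show "x \<in> {pt h j | h j. h \<in> H \<and> j < l}"
    proof (cases "Suc j = l")
      case True
      then have "x = pt h 0" using hj(3) by (simp add: pt_def v_l)
      moreover have "0 < l" using l by simp
      ultimately show ?thesis using hj(1) by blast
    next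
      case False
      then have "Suc j < l" using hj(2) by simp
      then show ?thesis using hj(1,3) by blast
    qed
  next
    fix x assume "x \<in> {pt h j | h j. h \<in> H \<and> j < l}"
    then obtain h j where hj: "h \<in> H" "j < l" "x = pt h j" by blast
    show "x \<in> rot ` {pt h j | h j. h \<in> H \<and> j < l}"
    proof (cases j)
      case 0
      then have "x = pt h (Suc (l - 1))" using hj l by (simp add: pt_def v_l)
      then have "x = rot (pt h (l - 1))" by (simp only: rot_pt)
      moreover have "l - 1 < l" using l by simp
      ultimately show ?thesis using hj by blast
    next
      case (Suc i)
      then have "x = rot (pt h i)" using hj by (simp add: rot_pt)
      moreover have "i < l" using hj(2) Suc by simp
      ultimately show ?thesis using hj(1) by blast
    qed
  qed
  then show ?thesis by (simp add: S_def rot_pole)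
qed

lemma pt_inj:
  assumes "pt h i = pt k j" "\<bar>h\<bar> < 1" "i < l" "j < l"
  shows "h = k" "i = j"
proof -
  show hk: "h = k" using assms(1) pt_pole by metis
  have "h\<^sup>2 < 1" using assms(2) by (simp add: abs_square_less_1)
  then have "v i = v j" using assms(1) hk by (simp add: pt_def)
  then have "v i \<bullet> v j = v j \<bullet> v j" by simp
  then have "cos (2 * pi * (real i - real j) / real l) = 1" by (simp add: inner_v)
  then obtain n :: int where "2 * pi * (real i - real j) / real l = n * 2 * pi"
    unfolding cos_one_2pi_int by auto
  then have "(2 * pi) * (real i - real j) = (2 * pi) * (real_of_int n * real l)"
    using l_pos by (simp add: field_simps)
  then have "real i - real j = real_of_int n * real l" by (simp only: mult_cancel_left) simp
  then have eq: "int i - int j = n * int l" by (metis of_int_diff of_int_eq_iff of_int_mult of_int_of_nat_eq)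
  have "\<bar>int i - int j\<bar> < int l" using assms(3,4) by linarith
  then have lt: "\<bar>n\<bar> * int l < int l" unfolding eq abs_mult by simp
  have "n = 0"
  proof (rule ccontr)
    assume "n \<noteq> 0"
    then have "1 * int l \<le> \<bar>n\<bar> * int l" by (intro mult_right_mono) auto
    then show False using lt by simp
  qed
  then show "i = j" using eq by simp
qed

text \<open>Off the axis every orbit of \<open>rot\<close> has \<open>l\<close> points, one on each
  meridian, so an invariant set is counted by its heights. Forward invariance suffices, since
  \<open>l - j\<close> steps lead from index \<open>j\<close> back to index 0.\<close>

lemma invariant_card:
  assumes X: "X \<subseteq> S" "rot ` X \<subseteq> X"
  defines "K \<equiv> {h \<in> H. \<bar>h\<bar> < 1 \<and> pt h 0 \<in> X}"
  shows "X - {pole, - pole} = {pt h j | h j. h \<in> K \<and> j < l}"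
    and "card (X - {pole, - pole}) = card K * l"
proof -
  have step: "pt h (j + i) \<in> X" if "pt h j \<in> X" for h j i
  proof (induction i)
    case (Suc i)
    then have "rot (pt h (j + i)) \<in> X" using X(2) by blast
    then show ?case by (simp add: rot_pt)
  qed (use that in simp)
  show eq: "X - {pole, - pole} = {pt h j | h j. h \<in> K \<and> j < l}"
  proof (intro equalityI subsetI)
    fix x assume x: "x \<in> X - {pole, - pole}"
    then obtain h j where hj: "h \<in> H" "j < l" "x = pt h j" using X(1) by (auto simp: S_def)
    have "\<bar>h\<bar> \<noteq> 1"
    proof
      assume "\<bar>h\<bar> = 1"
      then have "h = 1 \<or> h = -1" by linarith
      then show False using x hj by (auto simp: pt_def)
    qed
    then have "\<bar>h\<bar> < 1" using H(2)[OF hj(1)] by simp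
    moreover have "pt h 0 \<in> X"
    proof -
      have "pt h (j + (l - j)) \<in> X" using x hj by (intro step) simp
      then show ?thesis using hj by (simp add: pt_def v_l)
    qed
    ultimately show "x \<in> {pt h j | h j. h \<in> K \<and> j < l}" using hj by (auto simp: K_def)
  next
    fix x assume "x \<in> {pt h j | h j. h \<in> K \<and> j < l}"
    then obtain h j where hj: "h \<in> K" "j < l" "x = pt h j" by blast
    then have "x \<in> X" using step[of h 0 j] by (simp add: K_def)
    moreover have "x \<bullet> pole = h" using hj by (simp add: pt_pole)
    then have "x \<noteq> pole" "x \<noteq> - pole" using hj by (auto simp: K_def)
    ultimately show "x \<in> X - {pole, - pole}" by simp
  qed
  have "X - {pole, - pole} = (\<lambda>(h, j). pt h j) ` (K \<times> {..<l})" unfolding eq by auto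
  moreover have "inj_on (\<lambda>(h, j). pt h j) (K \<times> {..<l})"
  proof (rule inj_onI, clarsimp)
    fix h i k j assume "h \<in> K" "i < l" "k \<in> K" "j < l" "pt h i = pt k j"
    then show "h = k \<and> i = j" using pt_inj[of h i k j] by (simp add: K_def)
  qed
  ultimately show "card (X - {pole, - pole}) = card K * l"
    by (simp add: card_image card_cartesian_product)
qed

text \<open>As the only pentagon, \<open>F\<close> is invariant under \<open>rot\<close>. Counting
  orbits among the eight vertices and among the five of \<open>F\<close> leaves
  \<open>l = 3\<close>, two rings, and an \<open>F\<close> made of both poles and one ring. The axis
  between the poles then lies in \<open>F\<close> and contains the centre of the other ring; a face
  through that centre contains the points of the ring, a contradiction.\<close>

lemma no_unique_pentagon:
  assumes card: "card S = 8" and F: "{G \<in> facets (convex hull S). card (vertices G) = 5} = {F}"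
  shows False
proof -
  let ?Q = "convex hull S"
  have VQ: "vertices ?Q = S" by (rule vertices_convex_hull_sphere[OF S_sphere])
  have rQ: "rot ` ?Q = ?Q"
    using convex_hull_linear_image[OF linear_rot, of S] rot_S by simp
  have Ff: "F \<in> facets ?Q" "card (vertices F) = 5" using F by blast+
  have "rot ` F \<in> facets ?Q" using facet_linear_image[OF linear_rot inj_rot Ff(1)] rQ by simp
  moreover have "card (vertices (rot ` F)) = 5"
    using Ff(2) vertices_linear_image[OF linear_rot inj_rot] card_image[of rot "vertices F"] inj_rot
    by (metis inj_on_subset subset_UNIV)
  ultimately have "rot ` F \<in> {F}" unfolding F[symmetric] by simp
  then have rF: "rot ` F = F" by simp
  define W where "W = vertices F"
  have rW: "rot ` W = W" unfolding W_def using vertices_linear_image[OF linear_rot inj_rot, of F] rF by simp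
  have face: "F face_of ?Q" using Ff(1) by (simp add: facets_def facet_of_imp_face_of)
  have W: "W = S \<inter> F" using vertices_face[OF face] by (simp only: W_def VQ)
  define K where "K X = {h \<in> H. \<bar>h\<bar> < 1 \<and> pt h 0 \<in> X}" for X
  let ?p = "{pole, - pole}"
  have cS: "card (S - ?p) = card (K S) * l" using invariant_card(2)[of S] rot_S by (simp add: K_def)
  have cW: "card (W - ?p) = card (K W) * l" using invariant_card(2)[of W] rW W by (simp add: K_def)
  have finW: "finite W" using W S_sphere(1) by simp
  have pS: "pole \<in> S" by (simp add: S_def)
  have "card ?p \<le> 2" by (simp add: card_insert_if)
  then have p2: "card (X \<inter> ?p) \<le> 2" for X by (meson Int_lower2 card_mono finite.emptyI finite.insertI le_trans)
  have "card (S \<inter> ?p) + card (S - ?p) = 8"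
    using card S_sphere(1) card_Int_Diff[of S ?p] by simp
  moreover have "card (S \<inter> ?p) \<ge> 1"
    using pS S_sphere(1) by (simp add: Suc_le_eq card_gt_0_iff)
  \<comment> \<open>One or two of the eight vertices lie on the axis, so the full orbits make up six
    or seven points.\<close>
  ultimately have S67: "card (K S) * l = 6 \<or> card (K S) * l = 7" using p2[of S] cS by linarith
  have "card (W \<inter> ?p) + card (W - ?p) = 5"
    using Ff(2) finW card_Int_Diff[of W ?p] by (simp add: W_def)
  then have W345: "card (W \<inter> ?p) + card (K W) * l = 5" using cW by simp
  have "card (K W) \<noteq> 0"
  proof
    assume "card (K W) = 0"
    then show False using W345 p2[of W] by simp
  qed
  then have "l \<le> card (K W) * l" by simp
  then have "l \<le> 5" using W345 by linarith
  moreover have "l \<noteq> 4" using l by auto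
  ultimately have "l = 3 \<or> l = 5" using l by linarith
  moreover have "l \<noteq> 5"
  proof
    assume "l = 5"
    then show False using S67 by presburger
  qed
  ultimately have l3: "l = 3" by simp
  then have KS: "card (K S) = 2" using S67 by presburger
  have "b = 1 \<and> a = 2" if "a + b * 3 = 5" "a \<le> 2" for a b :: nat using that by presburger
  from this[OF W345[unfolded l3] p2] have KW: "card (K W) = 1" "card (W \<inter> ?p) = 2" by blast+
  have "W \<inter> ?p = ?p"
    using KW(2) \<open>card ?p \<le> 2\<close> by (intro card_seteq) auto
  then have poles: "pole \<in> F" "- pole \<in> F" using W by auto
  have "\<not> K S \<subseteq> K W"
  proof
    assume "K S \<subseteq> K W"
    then have "card (K S) \<le> card (K W)" using H(1) by (intro card_mono) (auto simp: K_def)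
    then show False using KS KW by simp
  qed
  then obtain h where h: "h \<in> H" "\<bar>h\<bar> < 1" "pt h 0 \<in> S" "pt h 0 \<notin> W" by (auto simp: K_def)
  define a where "a = pt h 0"
  define m where "m = (1 / 2) *\<^sub>R pt h 1 + (1 / 2) *\<^sub>R pt h 2"
  have aQ: "a \<in> ?Q" using h by (simp add: a_def hull_inc)
  have "pt h j \<in> S" if "j < l" for j using h(1) that unfolding S_def by blast
  then have "pt h 1 \<in> S" "pt h 2 \<in> S" using l(2) by simp_all
  then have mQ: "m \<in> ?Q" unfolding m_def by (intro convexD[OF convex_convex_hull]) (auto simp: hull_inc)
  have v3: "v 0 + v 1 + v 2 = 0"
  proof -
    have c: "cos (2 * pi * 2 / 3) = -1/2" "sin (2 * pi * 2 / 3) = - sin (2 * pi / 3)"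
    proof -
      have "2 * pi * 2 / 3 = 2 * pi - 2 * pi / 3" by simp
      then show "cos (2 * pi * 2 / 3) = -1/2" "sin (2 * pi * 2 / 3) = - sin (2 * pi / 3)"
        by (simp_all only: cos_diff sin_diff) (simp_all add: cos_120)
    qed
    have "v 0 + v 1 + v 2 = (1 + cos (2 * pi / 3) + cos (2 * pi * 2 / 3)) *\<^sub>R e
        + (sin (2 * pi / 3) + sin (2 * pi * 2 / 3)) *\<^sub>R f"
      unfolding v_def unfolding l3 by (simp add: algebra_simps)
    then show ?thesis unfolding c cos_120 by simp
  qed
  \<comment> \<open>The centre of the ring outside \<open>F\<close>, two thirds of the way from its
    point \<open>a\<close> to the midpoint \<open>m\<close> of the other two.\<close>
  define c where "c = h *\<^sub>R pole"
  have "c = (1 - 2 / 3) *\<^sub>R a + (2 / 3) *\<^sub>R m"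
  proof -
    have "(1 - 2 / 3) *\<^sub>R a + (2 / 3) *\<^sub>R m = h *\<^sub>R pole + (sqrt (1 - h\<^sup>2) / 3) *\<^sub>R (v 0 + v 1 + v 2)"
      by (simp add: a_def m_def pt_def vec_eq_iff field_simps)
    then show ?thesis using v3 by (simp add: c_def)
  qed
  moreover have "a \<noteq> m"
  proof
    assume "a = m"
    then have "a = c" using \<open>c = (1 - 2 / 3) *\<^sub>R a + (2 / 3) *\<^sub>R m\<close> by (metis diff_add_cancel scaleR_left_distrib scaleR_one)
    then have "norm c = 1" using norm_pt[of h 0] h by (simp add: a_def)
    then show False using h orthonormal(1) by (simp add: c_def norm_eq_sqrt_inner)
  qed
  ultimately have "c \<in> open_segment a m" by (auto simp: in_segment intro!: exI[of _ "2/3"])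
  moreover have "c \<in> F"
  proof -
    have "c = ((1 + h) / 2) *\<^sub>R pole + ((1 - h) / 2) *\<^sub>R (- pole)"
      by (simp add: c_def scaleR_left_diff_distrib[symmetric] field_simps flip: scaleR_diff_left)
    also have "\<dots> \<in> F"
      by (rule convexD[OF face_of_imp_convex[OF face] poles]) (use h in \<open>auto simp: field_simps abs_less_iff\<close>)
    finally show ?thesis .
  qed
  ultimately have "a \<in> F" using face_ofD[OF face _ aQ mQ] by blast
  then show False using h W by (simp add: a_def)
qed

end

text \<open>The polygon is reduced to the set \<open>H\<close> of abscissas of its vertices 1 to
  \<open>k\<close>; they lie between -1 and 1 because the major semi-axis of the ellipse is
  1.\<close>

lemma lovasz_polyhedron_rings:
  assumes lov: "lovasz_polyhedron Q"
  shows "\<exists>pole e f l H. polar_rings pole e f l H \<and> Q = convex hull polar_rings.S pole e f l H"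
proof -
  obtain l k r0 t x y pole e f V where l: "odd l" "l \<ge> 3"
    and x: "inscribed_tangent_polygon r0 t k x" and y: "\<forall>i. y i = ellipse_to_circle r0 (x i)"
    and on: "norm pole = 1" "norm e = 1" "norm f = 1" "orthogonal pole e" "orthogonal pole f" "orthogonal e f"
    and V: "V = {cos (2 * pi * real j / real l) *\<^sub>R e + sin (2 * pi * real j / real l) *\<^sub>R f | j. j < l}"
    and Q: "Q = convex hull (insert pole (\<Union>v\<in>V. \<Union>i\<in>{1..k}. half_meridian pole v \<inter> parallel_at pole (Re (y i))))"
    using lov unfolding lovasz_polyhedron_def by (elim exE conjE) (rule that)
  define H where "H = (\<lambda>i. Re (y i)) ` {1..k}"
  have yx: "Re (y i) = Re (x i)" for i using y by (simp add: ellipse_to_circle_def)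
  have H1: "\<bar>Re (y i)\<bar> \<le> 1" if "i \<in> {1..k}" for i
    using inscribed_Re_le_1[OF x, of i] that by (simp add: yx)
  interpret polar_rings pole e f l H
  proof
    show "\<bar>h\<bar> \<le> 1" if "h \<in> H" for h using that H1 by (auto simp: H_def)
  qed (use on l in \<open>auto simp: orthogonal_def dot_square_norm H_def\<close>)
  have V': "V = v ` {..<l}" unfolding V v_def by auto
  have "norm (v j) = 1" for j
  proof -
    have "v j \<bullet> v j = 1" by (simp add: inner_v)
    then show ?thesis by (simp add: norm_eq_sqrt_inner)
  qed
  then have ring: "half_meridian pole (v j) \<inter> parallel_at pole (Re (y i)) = {pt (Re (y i)) j}" if "i \<in> {1..k}" for i j
    unfolding pt_def using on H1[OF that] inner_v by (intro half_meridian_Int_parallel) auto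
  have "(\<Union>v\<in>V. \<Union>i\<in>{1..k}. half_meridian pole v \<inter> parallel_at pole (Re (y i))) = {pt h j | h j. h \<in> H \<and> j < l}"
  proof (intro equalityI subsetI)
    fix z assume "z \<in> (\<Union>v\<in>V. \<Union>i\<in>{1..k}. half_meridian pole v \<inter> parallel_at pole (Re (y i)))"
    then obtain i j where i: "i \<in> {1..k}" and j: "j < l" and z: "z \<in> half_meridian pole (v j) \<inter> parallel_at pole (Re (y i))"
      unfolding V' by blast
    have "z = pt (Re (y i)) j" using z unfolding ring[OF i] by simp
    then show "z \<in> {pt h j | h j. h \<in> H \<and> j < l}" using i j unfolding H_def by blast
  next
    fix z assume "z \<in> {pt h j | h j. h \<in> H \<and> j < l}"
    then obtain i j where i: "i \<in> {1..k}" and j: "j < l" and z: "z = pt (Re (y i)) j" unfolding H_def by blast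
    have "z \<in> half_meridian pole (v j) \<inter> parallel_at pole (Re (y i))" unfolding ring[OF i] z by simp
    then show "z \<in> (\<Union>v\<in>V. \<Union>i\<in>{1..k}. half_meridian pole v \<inter> parallel_at pole (Re (y i)))"
      using i j unfolding V' by blast
  qed
  then have QS: "Q = convex hull S" using Q by (simp only: S_def)
  then show ?thesis using polar_rings_axioms by blast
qed

lemma lovasz_polyhedron_imp_polytope:
  assumes "lovasz_polyhedron Q" shows "polytope Q"
proof -
  obtain pole e f l H where R: "polar_rings pole e f l H" and Q: "Q = convex hull polar_rings.S pole e f l H"
    using lovasz_polyhedron_rings[OF assms] by blast
  show ?thesis unfolding Q by (rule polytope_convex_hull[OF polar_rings.S_sphere(1)[OF R]])
qed

text \<open>The numerical hypotheses on \<open>Q\<close> are invariants of the face lattice, so the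
  conclusion excludes not only the fifth polyhedron itself but every polyhedron equivalent to
  it.\<close>

lemma lovasz_not_facet_sizes:
  assumes lov: "lovasz_polyhedron Q" and card: "card (vertices Q) = 8"
    and sizes: "facet_sizes Q = {#5, 4, 4, 3, 3, 3, 3, 3#}"
  shows False
proof -
  obtain pole e f l H where R: "polar_rings pole e f l H" and QS: "Q = convex hull polar_rings.S pole e f l H"
    using lovasz_polyhedron_rings[OF lov] by blast
  interpret polar_rings pole e f l H by (rule R)
  have "card S = 8" using card vertices_convex_hull_sphere[OF S_sphere] by (simp add: QS)
  moreover have "finite (facets Q)"
    unfolding facets_def QS using finite_polytope_facets polytope_convex_hull[OF S_sphere(1)] by blast
  then obtain F where "{G \<in> facets Q. card (vertices G) = 5} = {F}"
    using unique_size[of "facets Q" "\<lambda>F. card (vertices F)" 5 "{#4, 4, 3, 3, 3, 3, 3#}"] sizes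
    by (auto simp: facet_sizes_def)
  ultimately show False using no_unique_pentagon QS by blast
qed

section \<open>The five polyhedra\<close>

lemma realizes_imp_strongly_self_dual:
  assumes "realizes xs r T" "self_dual_matrix T"
  shows "strongly_self_dual (convex hull set xs)" and "card (vertices (convex hull set xs)) = length T"
    and "facet_sizes (convex hull set xs) = mset (map (\<lambda>a. codeg a a) T)"
proof -
  note xs = realizes_self_polar[OF assms]
  interpret self_polar "set xs" r by (rule xs(2))
  show "strongly_self_dual (convex hull set xs)" by (rule strongly_self_dual_P)
  have "length T = length xs" using realizes_adj_matrix[OF assms(1)] adj_matrix_nth(1) by metis
  then show "card (vertices (convex hull set xs)) = length T"
    using distinct_card[OF xs(1)] by (simp add: vertices_P)
  show "facet_sizes (convex hull set xs) = mset (map (\<lambda>a. codeg a a) T)"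
    using self_polar_facet_sizes[OF xs] realizes_adj_matrix[OF assms(1)] by simp
qed

lemma wheel_degrees:
  "map (\<lambda>a. codeg a a) (wheel 7) = [7, 3, 3, 3, 3, 3, 3, 3]"
  by code_simp

lemma graph_degrees:
  "map (\<lambda>a. codeg a a) graph7 = [3, 4, 4, 4, 3, 3, 3]"
  "map (\<lambda>a. codeg a a) graph8 = [5, 3, 4, 4, 3, 3, 3, 3]"
  by code_simp+

lemma wheel_3: "wheel 3 = [[False, True, True, True], [True, False, True, True],
    [True, True, False, True], [True, True, True, False]]"
  by code_simp

lemma set_wheel_pts: "set (wheel_pts l) = insert (vec3 0 0 1) (ring_pt l (wheel_height l) ` {..<l})"
  by (auto simp: wheel_pts_def)

lemma lovasz_wheel:
  assumes l: "odd l" "3 \<le> l"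
  shows "lovasz_polyhedron (convex hull set (wheel_pts l))"
proof (rule lovasz_polyhedronI[OF l, of 1])
  note wh = wheel_height[OF l(2)]
  show "0 < - wheel_height l" "- wheel_height l < cos (pi / real l)" by (rule wh)+
  show "inscribed_tangent_polygon (cos (pi / real l)) (- wheel_height l) 1
    (\<lambda>i. [1, Complex (wheel_height l) (cos (pi / real l) * sqrt (1 - (wheel_height l)\<^sup>2)),
      Complex (wheel_height l) (- (cos (pi / real l) * sqrt (1 - (wheel_height l)\<^sup>2)))] ! (i mod 3))"
    by (rule triangle_inscribed[OF l(2)])
qed (simp_all add: set_wheel_pts)

lemma lovasz_pts7:
  assumes h: "1/10 < h" "h < 11/100" and t: "3 * h\<^sup>2 = 1 - 2 * t" "(1 + h) * (1 - t\<^sup>2) = 4 * t\<^sup>2 * (1 - h)"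
  shows "lovasz_polyhedron (convex hull set (pts7 h t))"
proof (rule lovasz_polyhedronI[of 3 2 t])
  note b = pentagon_bounds[OF h t(1)]
  have c3: "cos (pi / real 3) = 1 / 2" by (simp add: cos_60)
  show "0 < t" "t < cos (pi / real 3)" using b unfolding c3 by simp_all
  let ?x = "\<lambda>i. [1, Complex h (sqrt (1 - h\<^sup>2) / 2), Complex (- t) (sqrt (1 - t\<^sup>2) / 2),
     Complex (- t) (- (sqrt (1 - t\<^sup>2) / 2)), Complex h (- (sqrt (1 - h\<^sup>2) / 2))] ! (i mod 5)"
  show "inscribed_tangent_polygon (cos (pi / real 3)) t 2 ?x"
    unfolding c3 by (rule pentagon_inscribed[OF h t])
  have "{1..2::nat} = {1, 2}" "{..<3::nat} = {0, 1, 2}" by auto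
  then show "convex hull set (pts7 h t) = convex hull (insert (vec3 0 0 1) (\<Union>i\<in>{1..2}. ring_pt 3 (Re (?x i)) ` {..<3}))"
    by (simp add: pts7_def insert_commute)
qed simp_all

text \<open>\<open>wheel 3\<close> is the complete graph on four vertices, so all distinct points
  have the same inner product and hence the same distance.\<close>

lemma regular_tetrahedron_wheel: "regular_tetrahedron (convex hull set (wheel_pts 3))"
  unfolding regular_tetrahedron_def
proof (intro exI conjI)
  let ?xs = "wheel_pts 3" and ?r = "- wheel_height 3"
  have real: "realizes ?xs ?r (wheel 3)" by (rule realizes_wheel) auto
  have dist: "distinct ?xs" by (rule realizes_self_polar(1)[OF real self_dual_matrix_wheel(1)])
  have len: "length ?xs = 4" by (simp add: wheel_pts_def)
  show "card (set ?xs) = 4" using distinct_card[OF dist] len by simp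
  have r: "0 < ?r" and norm: "\<And>x. x \<in> set ?xs \<Longrightarrow> norm x = 1"
    using real by (auto simp: realizes_def)
  show "0 < sqrt (2 + 2 * ?r)" using r by (simp only: real_sqrt_gt_0_iff)
  show "pairwise (\<lambda>p q. dist p q = sqrt (2 + 2 * ?r)) (set ?xs)"
  proof (rule pairwiseI)
    fix p q assume pq: "p \<in> set ?xs" "q \<in> set ?xs" "p \<noteq> q"
    obtain i where i: "i < 4" "?xs ! i = p" using pq(1) unfolding in_set_conv_nth len by blast
    obtain j where j: "j < 4" "?xs ! j = q" using pq(2) unfolding in_set_conv_nth len by blast
    note ij = i j
    have "i \<noteq> j" using pq(3) ij by blast
    have "wheel 3 ! i ! j = (p \<bullet> q = - ?r)"
      using ij len by (simp flip: realizes_adj_matrix[OF real])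
    moreover have "i = 0 \<or> i = 1 \<or> i = 2 \<or> i = 3" "j = 0 \<or> j = 1 \<or> j = 2 \<or> j = 3"
      using i(1) j(1) by linarith+
    then have "wheel 3 ! i ! j" using \<open>i \<noteq> j\<close> unfolding wheel_3 by (elim disjE) simp_all
    ultimately have "p \<bullet> q = - ?r" by simp
    moreover have "(p - q) \<bullet> (p - q) = p \<bullet> p + q \<bullet> q - 2 * (p \<bullet> q)"
      by (simp add: inner_diff_left inner_diff_right inner_commute)
    moreover have "p \<bullet> p = 1" "q \<bullet> q = 1" using norm pq by (simp_all add: dot_square_norm)
    ultimately have "(p - q) \<bullet> (p - q) = 2 + 2 * ?r" by linarith
    then show "dist p q = sqrt (2 + 2 * ?r)" unfolding dist_norm norm_eq_sqrt_inner by (rule arg_cong)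
  qed
qed simp

text \<open>The dimension of the base follows from that of the whole polytope, which has interior
  points: the apex lies off the plane of the base and contributes exactly one dimension.\<close>

lemma pyramid_wheel:
  assumes l: "odd l" "3 \<le> l" and T: "self_dual_matrix (wheel l)"
  shows "pyramid_over_gon l (convex hull set (wheel_pts l))"
  unfolding pyramid_over_gon_def
proof (intro exI conjI)
  let ?R = "ring_pt l (wheel_height l) ` {..<l}" and ?p = "vec3 0 0 1"
  note wh = wheel_height[OF l(2)]
  note real = realizes_wheel[OF l]
  interpret self_polar "set (wheel_pts l)" "- wheel_height l" by (rule realizes_self_polar(2)[OF real T])
  show "polytope (convex hull ?R)" by (simp add: polytope_convex_hull)
  have sub: "?R \<subseteq> {x. ?p \<bullet> x = wheel_height l}" by (auto simp: inner_pole_ring_pt)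
  then have "affine hull ?R \<subseteq> {x. ?p \<bullet> x = wheel_height l}"
    by (rule hull_minimal) (rule affine_hyperplane)
  then have apex: "?p \<notin> affine hull ?R" using wh by auto
  then show "?p \<notin> affine hull (convex hull ?R)" by (simp add: affine_hull_convex_hull)
  have "0 \<in> interior P" using interior_mono[OF cball_subset] r_pos by (auto simp: interior_cball)
  then have "aff_dim P = 3" using aff_dim_nonempty_interior[of P] by auto
  then have "aff_dim (insert ?p ?R) = 3" by (simp add: aff_dim_convex_hull set_wheel_pts)
  then show "aff_dim (convex hull ?R) = 2" using apex by (simp add: aff_dim_convex_hull aff_dim_insert)
  have "?R \<subseteq> sphere 0 1" using V_sphere by (auto simp: set_wheel_pts)
  then have "vertices (convex hull ?R) = ?R" by (intro vertices_convex_hull_sphere) auto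
  moreover have "distinct (map (ring_pt l (wheel_height l)) [0..<l])"
    using realizes_self_polar(1)[OF real T] by (simp add: wheel_pts_def)
  then have "card ?R = l"
    using distinct_card[of "map (ring_pt l (wheel_height l)) [0..<l]"] by (simp add: atLeast0LessThan)
  ultimately show "card (vertices (convex hull ?R)) = l" by simp
  show "convex hull set (wheel_pts l) = convex hull insert ?p (convex hull ?R)"
    unfolding set_wheel_pts by (rule hull_insert)
qed

text \<open>Quantifying over all realizations of \<open>T\<close> leaves the choice of
  representatives free; existence of a realization is a separate matter.\<close>

lemma strongly_self_dual_classification:
  assumes Q: "strongly_self_dual Q" "card (vertices Q) \<le> 8"
  shows "\<exists>T\<in>{wheel 3, wheel 5, graph7, wheel 7, graph8}. \<forall>ys s. realizes ys s T \<longrightarrow>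
    combinatorially_equivalent Q (convex hull set ys)"
proof -
  obtain r where r: "self_polar (vertices Q) r" and hull: "Q = convex hull vertices Q"
    using strongly_self_dual_imp_self_polar[OF Q(1)] by blast
  interpret self_polar "vertices Q" r by (rule r)
  obtain xs where xs: "distinct xs" "set xs = vertices Q"
    and T: "adj_matrix A xs \<in> {wheel 3, wheel 5, graph7, wheel 7, graph8}"
    using classification[OF Q(2)] by blast
  have sd: "self_dual_matrix (adj_matrix A xs)"
    using T self_dual_matrix_wheel self_dual_matrix_graph by auto
  have "combinatorially_equivalent Q (convex hull set ys)" if ys: "realizes ys s (adj_matrix A xs)" for ys s
  proof -
    note y = realizes_self_polar[OF ys sd]
    have "self_polar (set xs) r" using r xs(2) by simp
    from adj_matrix_eq_imp_equivalent[OF xs(1) this y] show ?thesis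
      using realizes_adj_matrix[OF ys] xs(2) hull by simp
  qed
  then show ?thesis using T by blast
qed

theorem theorem4:
  "\<exists>P1 P2 P3 P4 P5 :: (real^3) set.
     (\<forall>P\<in>{P1, P2, P3, P4, P5}. strongly_self_dual P \<and> card (vertices P) \<le> 8) \<and>
     sorted_wrt (\<lambda>P Q. \<not> combinatorially_equivalent P Q) [P1, P2, P3, P4, P5] \<and>
     (\<forall>Q :: (real^3) set. strongly_self_dual Q \<and> card (vertices Q) \<le> 8 \<longrightarrow>
        (\<exists>P\<in>{P1, P2, P3, P4, P5}. combinatorially_equivalent Q P)) \<and>
     (\<forall>P\<in>{P1, P2, P3, P4}. lovasz_polyhedron P) \<and>
     card (vertices P1) = 4 \<and> regular_tetrahedron P1 \<and>
     card (vertices P2) = 6 \<and> pyramid_over_gon 5 P2 \<and>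
     card (vertices P3) = 7 \<and> facet_sizes P3 = {#4, 4, 4, 3, 3, 3, 3#} \<and>
     card (vertices P4) = 8 \<and> pyramid_over_gon 7 P4 \<and>
     card (vertices P5) = 8 \<and> facet_sizes P5 = {#5, 4, 4, 3, 3, 3, 3, 3#} \<and>
     \<not> lovasz_polyhedron P5 \<and>
     (\<forall>Q. lovasz_polyhedron Q \<longrightarrow> \<not> combinatorially_equivalent Q P5)"
proof -
  obtain h t :: real where ht: "1/10 < h" "h < 11/100" "3 * h\<^sup>2 = 1 - 2 * t" "(1 + h) * (1 - t\<^sup>2) = 4 * t\<^sup>2 * (1 - h)"
    by (rule exists_pentagon_parameters)
  obtain xs r where xs: "realizes xs r graph8" using exists_pts8 by blast
  note w3 = realizes_wheel[of 3, simplified] and w5 = realizes_wheel[of 5, simplified]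
    and w7 = realizes_wheel[of 7, simplified] and g7 = realizes_graph7[OF ht]
  define P1 where "P1 = convex hull set (wheel_pts 3)"
  define P2 where "P2 = convex hull set (wheel_pts 5)"
  define P3 where "P3 = convex hull set (pts7 h t)"
  define P4 where "P4 = convex hull set (wheel_pts 7)"
  define P5 where "P5 = convex hull set xs"
  note s1 = realizes_imp_strongly_self_dual[OF w3 self_dual_matrix_wheel(1), folded P1_def]
    and s2 = realizes_imp_strongly_self_dual[OF w5 self_dual_matrix_wheel(2), folded P2_def]
    and s3 = realizes_imp_strongly_self_dual[OF g7 self_dual_matrix_graph(1), folded P3_def]
    and s4 = realizes_imp_strongly_self_dual[OF w7 self_dual_matrix_wheel(3), folded P4_def]
    and s5 = realizes_imp_strongly_self_dual[OF xs self_dual_matrix_graph(2), folded P5_def]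
  have len: "length (wheel l) = Suc l" for l by (simp add: wheel_def del: upt_Suc)
  have card: "card (vertices P1) = 4" "card (vertices P2) = 6" "card (vertices P3) = 7"
    "card (vertices P4) = 8" "card (vertices P5) = 8"
    using s1(2) s2(2) s3(2) s4(2) s5(2) by (simp_all add: len graph7_eq graph8_eq)
  have sizes: "facet_sizes P3 = {#4, 4, 4, 3, 3, 3, 3#}" "facet_sizes P5 = {#5, 4, 4, 3, 3, 3, 3, 3#}"
    "7 \<in># facet_sizes P4"
    using s3(3) s5(3) s4(3) unfolding graph_degrees wheel_degrees by simp_all
  have poly: "polytope P1" "polytope P2" "polytope P3" "polytope P4" "polytope P5"
    using s1(1) s2(1) s3(1) s4(1) s5(1) by (simp_all add: strongly_self_dual_def)
  have inv: "card (vertices P) = card (vertices Q)" "facet_sizes P = facet_sizes Q"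
    if "combinatorially_equivalent P Q" "polytope P" "polytope Q" for P Q :: "(real^3) set"
    using combinatorially_equivalent_imp_facet_sizes_eq that by blast+
  have noteq: "sorted_wrt (\<lambda>P Q. \<not> combinatorially_equivalent P Q) [P1, P2, P3, P4, P5]"
  proof -
    \<comment> \<open>Both have eight vertices; the heptagonal facet of \<open>P4\<close> tells them
      apart.\<close>
    have "\<not> combinatorially_equivalent P4 P5"
      using inv(2)[OF _ poly(4,5)] sizes by auto
    then show ?thesis
      using inv(1)[OF _ poly(1,2)] inv(1)[OF _ poly(1,3)] inv(1)[OF _ poly(1,4)] inv(1)[OF _ poly(1,5)]
        inv(1)[OF _ poly(2,3)] inv(1)[OF _ poly(2,4)] inv(1)[OF _ poly(2,5)]
        inv(1)[OF _ poly(3,4)] inv(1)[OF _ poly(3,5)] card by auto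
  qed
  have lov: "\<not> combinatorially_equivalent Q P5" if Q: "lovasz_polyhedron Q" for Q
  proof
    assume eq: "combinatorially_equivalent Q P5"
    have "polytope Q" using Q by (rule lovasz_polyhedron_imp_polytope)
    from inv[OF eq this poly(5)] show False
      using lovasz_not_facet_sizes[OF Q] card(5) sizes(2) by simp
  qed
  have all: "\<exists>P\<in>{P1, P2, P3, P4, P5}. combinatorially_equivalent Q P"
    if Q: "strongly_self_dual Q" "card (vertices Q) \<le> 8" for Q :: "(real^3) set"
  proof -
    obtain T where T: "T \<in> {wheel 3, wheel 5, graph7, wheel 7, graph8}"
      and eq: "\<And>ys s. realizes ys s T \<Longrightarrow> combinatorially_equivalent Q (convex hull set ys)"
      using strongly_self_dual_classification[OF Q] by blast
    from T consider "T = wheel 3" | "T = wheel 5" | "T = graph7" | "T = wheel 7" | "T = graph8" by blast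
    then show ?thesis
    proof cases
      case 1
      then show ?thesis using eq w3 unfolding P1_def by blast
    next
      case 2
      then show ?thesis using eq w5 unfolding P2_def by blast
    next
      case 3
      then show ?thesis using eq g7 unfolding P3_def by blast
    next
      case 4
      then show ?thesis using eq w7 unfolding P4_def by blast
    next
      case 5
      then show ?thesis using eq xs unfolding P5_def by blast
    qed
  qed
  show ?thesis
  proof (rule exI[of _ P1], rule exI[of _ P2], rule exI[of _ P3], rule exI[of _ P4], rule exI[of _ P5], intro conjI)
    show "\<forall>P\<in>{P1, P2, P3, P4, P5}. strongly_self_dual P \<and> card (vertices P) \<le> 8"
      using s1(1) s2(1) s3(1) s4(1) s5(1) card by simp
    show "\<forall>Q. strongly_self_dual Q \<and> card (vertices Q) \<le> 8 \<longrightarrow>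
        (\<exists>P\<in>{P1, P2, P3, P4, P5}. combinatorially_equivalent Q P)"
      by (intro allI impI all) (elim conjE, assumption)+
    show "\<forall>P\<in>{P1, P2, P3, P4}. lovasz_polyhedron P"
      unfolding P1_def P2_def P3_def P4_def using lovasz_wheel lovasz_pts7[OF ht] by simp
    show "regular_tetrahedron P1" "pyramid_over_gon 5 P2" "pyramid_over_gon 7 P4"
      unfolding P1_def P2_def P4_def
      using regular_tetrahedron_wheel pyramid_wheel self_dual_matrix_wheel by simp_all
    show "\<not> lovasz_polyhedron P5"
      using lovasz_not_facet_sizes card(5) sizes(2) by blast
    show "\<forall>Q. lovasz_polyhedron Q \<longrightarrow> \<not> combinatorially_equivalent Q P5"
      using lov by simp
  qed (fact noteq card sizes)+
qed

end
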